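(* Let $0<q<1$ and $-1<\alpha<q$. The transform $\mathcal{B}_{\alpha}^{(q)}:\mathcal{H}_{q,\alpha}\to\mathcal{A}^2_{q,\alpha}(\mathbb{C})$ defined by $$\mathcal{B}_{\alpha}^{(q)}[\varphi](z)=\left(\mathcal{N}_{q,\alpha}(z\bar z)\right)^{1/2}\langle\varphi,\vartheta_z^{q,\alpha}\rangle_{\mathcal{H}_{q,\alpha}},\qquad z\in\mathbb{C}_q,$$ is an isometric isomorphism, given by $$\mathcal{B}_{\alpha}^{(q)}[\varphi](z)=\int_{\mathcal{I}_q}\mathcal{T}(z,\xi)\,\varphi(\xi)\,\omega_{q,\alpha}(\xi)\,d\xi,\qquad z\in\mathbb{C}_q,$$ with the integral kernel $$\mathcal{T}(z,\xi)=\frac{1}{(z\sqrt{1-q}\,e^{-i\theta};q)_\infty}\;{}_2\phi_1\!\left(\begin{matrix}\sqrt{\alpha}\,e^{-i\theta},\,-\sqrt{\alpha}\,e^{-i\theta}\\ -\alpha\end{matrix}\,\Big|\,q;\,z\sqrt{1-q}\,e^{i\theta}\right),\qquad \xi=\frac{2}{\sqrt{1-q}}\cos\theta .$$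
   Context: Notation: $(a;q)_n=\prod_{k=0}^{n-1}(1-aq^k)$ for $0\le n\le\infty$, $(a_1,\dots,a_m;q)_n=\prod_i(a_i;q)_n$, $[n]_q=\frac{1-q^n}{1-q}$, $[n]_q!=\prod_{k=1}^n[k]_q$, ${}_2\phi_1\!\left(\begin{matrix}a_1,a_2\\ b\end{matrix}\Big|q;t\right)=\sum_{k\ge0}\frac{(a_1,a_2;q)_k}{(b;q)_k}\frac{t^k}{(q;q)_k}$. $\mathbb{C}_q=\{\zeta\in\mathbb{C}:(1-q)\zeta\bar\zeta<1\}$, $\mathcal{I}_q=\left(-\frac{2}{\sqrt{1-q}},\frac{2}{\sqrt{1-q}}\right)$, $x_n^{q,\alpha}!=(-\alpha;q)_n[n]_q!$; $\sqrt\alpha$ is a square root of $\alpha$ (imaginary if $\alpha<0$). $\delta_c$ is the Dirac mass at $c$. $\mathcal{H}_{q,\alpha}=L^2(\mathcal{I}_q,\omega_{q,\alpha}(x)dx)$ (inner product linear in the first argument), where $$\omega_{q,\alpha}(x)=\frac{(q,-\alpha;q)_\infty}{2\pi}\sqrt{\frac{1-q}{4-(1-q)x^2}}\;\frac{g(x,1;q)\,g(x,-1;q)\,g(x,\sqrt q;q)\,g(x,-\sqrt q;q)}{g(x,\sqrt\alpha;q)\,g(x,-\sqrt\alpha;q)},$$ $$g(x,\gamma;q)=\prod_{k=0}^\infty\left(1-\gamma x(1-q)^{1/2}q^k+\gamma^2q^{2k}\right).$$ Coherent states: the wave functions are $$\vartheta_z^{q,\alpha}(x)=\left(\mathcal{N}_{q,\alpha}(z\bar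 z)\right)^{-1/2}\sum_{n\ge0}\frac{\bar z^n}{\sqrt{x_n^{q,\alpha}!}}\varphi_n^{(q)}(x),\qquad \mathcal{N}_{q,\alpha}(z\bar z)=\sum_{n\ge0}\frac{(z\bar z)^n}{x_n^{q,\alpha}!}={}_2\phi_1\!\left(\begin{matrix}0,0\\-\alpha\end{matrix}\Big|q;z\bar z(1-q)\right),$$ $$\varphi_n^{(q)}(x)=\left((-\alpha,q;q)_n\right)^{-1/2}Q_n\!\left(\tfrac{x\sqrt{1-q}}{2};\sqrt\alpha,-\sqrt\alpha\,|\,q\right),$$ where the Al-Salam-Chihara polynomials are, for $\xi=\cos\theta$, $$Q_n(\xi;a,b|q)=\frac{(ab;q)_n}{a^n}\sum_{k=0}^n\frac{(q^{-n},ae^{i\theta},ae^{-i\theta};q)_k}{(ab;q)_k}\frac{q^k}{(q;q)_k};$$ for $\alpha=0$ (that is, $a=b=0$) they reduce to the continuous $q$-Hermite polynomials $H_n(\cos\theta|q)=\sum_{k=0}^n\frac{(q;q)_n}{(q;q)_k(q;q)_{n-k}}e^{i(n-2k)\theta}$. Target space: let $L^2(\mathbb{C}_q,\nu_{q,\alpha})$ be the space of complex-valued functions on $\mathbb{C}_q$ which are square integrable with respect to the measure $$\nu_{q,\alpha}(d^2z)=\frac{1}{2\pi}\lambda_{[0,2\pi)}(d\theta)\,\rho_{q,\alpha}(dr),\qquad z=re^{i\theta},\ r\ge0,\ \theta\in[0,2\pi),$$ where $\lambda_{[0,2\pi)}$ is the Lebesgue measure on $[0,2\pi)$ and $$\rho_{q,\alpha}=(-\alpha,q;q)_{\infty}\sum_{n=0}^{\infty}\frac{q^n}{(q;q)_n}\,h_n(-\alpha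 q^{-1}|q)\,\delta_{(1-q)^{-1/2}q^{n/2}},\qquad h_n(z|q)=\sum_{k=0}^n\frac{(q;q)_n}{(q;q)_k(q;q)_{n-k}}z^k$$ ($h_n$ are the Rogers-Szegő polynomials). $\mathcal{A}^2_{q,\alpha}(\mathbb{C})$ denotes the closure in $L^2(\mathbb{C}_q,\nu_{q,\alpha})$ of the linear span of the monomials $\left\{z^n/\sqrt{x_n^{q,\alpha}!}\right\}_{n\ge0}$; it is a Hilbert space whose reproducing kernel is given by $$K_{q,\alpha}(z,w)=\sum_{j\ge0}\frac{(z\bar w)^j}{(-\alpha;q)_j[j]_q!}={}_2\phi_1\!\left(\begin{matrix}0,0\\-\alpha\end{matrix}\Big|q;z\bar w(1-q)\right).$$
   Formalization: The n=0 atom of ρ puts mass on the boundary circle, outside the open disc C_q, where isometry would fail (φ=1); so ν is taken on the closed disc with all atoms, and B[φ] is the element of A² agreeing with the formula on C_q (boundary values then determined a.e.). *)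

theory Defs
  imports "HOL-Analysis.Analysis"
begin

definition qpoch :: "'a::real_normed_field \<Rightarrow> 'a \<Rightarrow> nat \<Rightarrow> 'a" where
  "qpoch a q n = (\<Prod>k<n. 1 - a * q ^ k)"

definition qpoch_inf :: "'a::real_normed_field \<Rightarrow> 'a \<Rightarrow> 'a" where
  "qpoch_inf a q = (\<Prod>k. 1 - a * q ^ k)"

definition qnum :: "real \<Rightarrow> nat \<Rightarrow> real" where
  "qnum q n = (1 - q ^ n) / (1 - q)"

definition qfact :: "real \<Rightarrow> nat \<Rightarrow> real" where
  "qfact q n = (\<Prod>k=1..n. qnum q k)"

definition qbinom :: "real \<Rightarrow> nat \<Rightarrow> nat \<Rightarrow> real" where
  "qbinom q n k = qpoch q q n / (qpoch q q k * qpoch q q (n - k))"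

definition phi21 :: "complex \<Rightarrow> complex \<Rightarrow> complex \<Rightarrow> complex \<Rightarrow> complex \<Rightarrow> complex" where
  "phi21 a1 a2 b q t =
     (\<Sum>k. qpoch a1 q k * qpoch a2 q k / qpoch b q k * (t ^ k / qpoch q q k))"

definition xfact :: "real \<Rightarrow> real \<Rightarrow> nat \<Rightarrow> real" where
  "xfact q \<alpha> n = qpoch (- \<alpha>) q n * qfact q n"

text \<open>Polynomials in \<open>\<xi> = cos \<theta>\<close>, for \<open>\<xi>\<close> in \<open>[-1, 1]\<close>, with \<open>\<theta> = arccos \<xi>\<close>.\<close>

definition continuous_q_Hermite :: "nat \<Rightarrow> real \<Rightarrow> real \<Rightarrow> complex" where
  "continuous_q_Hermite n \<xi> q =
     (\<Sum>k\<le>n. of_real (qbinom q n k) * cis ((real n - 2 * real k) * arccos \<xi>))"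

text \<open>The defining formula divides by \<open>a ^ n\<close>; the case \<open>a = b = 0\<close> is the continuous
  \<open>q\<close>-Hermite polynomial. The definition is not meaningful for \<open>a = 0 \<noteq> b\<close>.\<close>

definition al_salam_chihara ::
  "nat \<Rightarrow> real \<Rightarrow> complex \<Rightarrow> complex \<Rightarrow> real \<Rightarrow> complex" where
  "al_salam_chihara n \<xi> a b q =
     (if a = 0 \<and> b = 0 then continuous_q_Hermite n \<xi> q
      else let q' = complex_of_real q; \<theta> = arccos \<xi> in
        qpoch (a * b) q' n / a ^ n *
        (\<Sum>k\<le>n. qpoch (q' powi (- int n)) q' k * qpoch (a * cis \<theta>) q' k * qpoch (a * cis (- \<theta>)) q' k
                 / qpoch (a * b) q' k * (q' ^ k / qpoch q' q' k)))"

definition rogers_szego :: "nat \<Rightarrow> real \<Rightarrow> real \<Rightarrow> real" where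
  "rogers_szego n z q = (\<Sum>k\<le>n. qbinom q n k * z ^ k)"

text \<open>Elements of \<open>L\<^sup>2\<close> are represented by functions; equality in \<open>L\<^sup>2\<close> is equality
  almost everywhere.\<close>

definition L2 :: "'a measure \<Rightarrow> ('a \<Rightarrow> complex) set" where
  "L2 M = {f \<in> borel_measurable M. integrable M (\<lambda>x. (cmod (f x))\<^sup>2)}"

definition L2_inner :: "'a measure \<Rightarrow> ('a \<Rightarrow> complex) \<Rightarrow> ('a \<Rightarrow> complex) \<Rightarrow> complex" where
  "L2_inner M f g = (LINT x|M. f x * cnj (g x))"

definition L2_norm :: "'a measure \<Rightarrow> ('a \<Rightarrow> complex) \<Rightarrow> real" where
  "L2_norm M f = sqrt (LINT x|M. (cmod (f x))\<^sup>2)"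

text \<open>\<open>U\<close> induces a linear isometric bijection between the spaces of almost-everywhere classes
  of \<open>S\<close> (functions on \<open>M\<close>) and of \<open>T\<close> (functions on \<open>N\<close>).\<close>

definition L2_isometric_isomorphism ::
  "'a measure \<Rightarrow> ('a \<Rightarrow> complex) set \<Rightarrow> 'b measure \<Rightarrow> ('b \<Rightarrow> complex) set
    \<Rightarrow> (('a \<Rightarrow> complex) \<Rightarrow> ('b \<Rightarrow> complex)) \<Rightarrow> bool" where
  "L2_isometric_isomorphism M S N T U \<longleftrightarrow>
     (\<forall>f\<in>S. U f \<in> T) \<and>
     (\<forall>f\<in>S. \<forall>g\<in>S. (AE x in N. U f x = U g x) \<longleftrightarrow> (AE x in M. f x = g x)) \<and>
     (\<forall>f\<in>S. \<forall>g\<in>S. \<forall>a b. AE y in N. U (\<lambda>x. a * f x + b * g x) y = a * U f y + b * U g y) \<and>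
     (\<forall>f\<in>S. L2_norm N (U f) = L2_norm M f) \<and>
     (\<forall>h\<in>T. \<exists>f\<in>S. AE y in N. U f y = h y)"

definition Iq :: "real \<Rightarrow> real set" where
  "Iq q = {- 2 / sqrt (1 - q) <..< 2 / sqrt (1 - q)}"

definition gfun :: "real \<Rightarrow> real \<Rightarrow> complex \<Rightarrow> complex" where
  "gfun q x \<gamma> = (\<Prod>k. 1 - \<gamma> * of_real (x * sqrt (1 - q) * q ^ k) + \<gamma>\<^sup>2 * of_real (q ^ (2 * k)))"

text \<open>For \<open>\<alpha> < 0\<close> the root \<open>csqrt \<alpha>\<close> is imaginary and the two factors of the denominator are
  complex conjugates, so the quotient is real and \<open>Re\<close> only adjusts the type.\<close>

definition weight :: "real \<Rightarrow> real \<Rightarrow> real \<Rightarrow> real" where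
  "weight q \<alpha> x =
     qpoch_inf q q * qpoch_inf (- \<alpha>) q / (2 * pi) * sqrt ((1 - q) / (4 - (1 - q) * x\<^sup>2)) *
     Re (gfun q x 1 * gfun q x (- 1) * gfun q x (of_real (sqrt q)) * gfun q x (- of_real (sqrt q))
         / (gfun q x (csqrt (of_real \<alpha>)) * gfun q x (- csqrt (of_real \<alpha>))))"

definition H_measure :: "real \<Rightarrow> real \<Rightarrow> real measure" where
  "H_measure q \<alpha> = density (restrict_space lborel (Iq q)) (\<lambda>x. ennreal (weight q \<alpha> x))"

definition Cq :: "real \<Rightarrow> complex set" where
  "Cq q = {\<zeta>. (1 - q) * (cmod \<zeta>)\<^sup>2 < 1}"

definition phi_fun :: "real \<Rightarrow> real \<Rightarrow> nat \<Rightarrow> real \<Rightarrow> complex" where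
  "phi_fun q \<alpha> n x =
     of_real (1 / sqrt (qpoch (- \<alpha>) q n * qpoch q q n)) *
     al_salam_chihara n (x * sqrt (1 - q) / 2) (csqrt (of_real \<alpha>)) (- csqrt (of_real \<alpha>)) q"

definition cs_norm :: "real \<Rightarrow> real \<Rightarrow> real \<Rightarrow> real" where
  "cs_norm q \<alpha> r = (\<Sum>n. r ^ n / xfact q \<alpha> n)"

definition coherent_state :: "real \<Rightarrow> real \<Rightarrow> complex \<Rightarrow> real \<Rightarrow> complex" where
  "coherent_state q \<alpha> z x =
     of_real (1 / sqrt (cs_norm q \<alpha> ((cmod z)\<^sup>2))) *
     (\<Sum>n. cnj z ^ n / of_real (sqrt (xfact q \<alpha> n)) * phi_fun q \<alpha> n x)"

definition bargmann :: "real \<Rightarrow> real \<Rightarrow> (real \<Rightarrow> complex) \<Rightarrow> complex \<Rightarrow> complex" where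
  "bargmann q \<alpha> \<phi> z =
     of_real (sqrt (cs_norm q \<alpha> ((cmod z)\<^sup>2))) *
     L2_inner (H_measure q \<alpha>) \<phi> (coherent_state q \<alpha> z)"

definition kernel_T :: "real \<Rightarrow> real \<Rightarrow> complex \<Rightarrow> real \<Rightarrow> complex" where
  "kernel_T q \<alpha> z \<xi> =
     (let \<theta> = arccos (\<xi> * sqrt (1 - q) / 2);
          s = csqrt (of_real \<alpha>);
          t = z * of_real (sqrt (1 - q))
      in 1 / qpoch_inf (t * cis (- \<theta>)) (of_real q) *
         phi21 (s * cis (- \<theta>)) (- s * cis (- \<theta>)) (- of_real \<alpha>) (of_real q) (t * cis \<theta>))"

definition rho_mass :: "real \<Rightarrow> real \<Rightarrow> nat \<Rightarrow> real" where
  "rho_mass q \<alpha> n =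
     qpoch_inf (- \<alpha>) q * qpoch_inf q q * (q ^ n / qpoch q q n) * rogers_szego n (- \<alpha> / q) q"

definition rho_measure :: "real \<Rightarrow> real \<Rightarrow> real measure" where
  "rho_measure q \<alpha> =
     distr (density (count_space UNIV) (\<lambda>n. ennreal (rho_mass q \<alpha> n))) borel
       (\<lambda>n. (1 - q) powr (- 1 / 2) * q powr (real n / 2))"

text \<open>The atom \<open>n = 0\<close> of \<open>rho_measure\<close> puts mass on the boundary circle of \<open>Cq q\<close>. Hence the
  measure lives on the closed disc; it is taken here as a measure on the whole plane.\<close>

definition nu_measure :: "real \<Rightarrow> real \<Rightarrow> complex measure" where
  "nu_measure q \<alpha> =
     distr (scale_measure (ennreal (1 / (2 * pi))) (restrict_space lborel {0..<2 * pi})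
              \<Otimes>\<^sub>M rho_measure q \<alpha>) borel
       (\<lambda>(\<theta>, r). of_real r * cis \<theta>)"

definition monomial_span :: "real \<Rightarrow> real \<Rightarrow> (complex \<Rightarrow> complex) set" where
  "monomial_span q \<alpha> =
     {p. \<exists>N c. p = (\<lambda>z. \<Sum>n<N. c n * (z ^ n / of_real (sqrt (xfact q \<alpha> n))))}"

definition A2 :: "real \<Rightarrow> real \<Rightarrow> (complex \<Rightarrow> complex) set" where
  "A2 q \<alpha> =
     {F \<in> L2 (nu_measure q \<alpha>).
        \<forall>\<epsilon>>0. \<exists>p\<in>monomial_span q \<alpha>. L2_norm (nu_measure q \<alpha>) (\<lambda>z. F z - p z) < \<epsilon>}"

text \<open>\<open>U\<close> realizes the transform as a map into \<open>A2 q \<alpha>\<close>: on the open disc the values of \<open>U \<phi>\<close> are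
  those of the transform, and its values on the boundary circle are only constrained by
  \<open>U \<phi> \<in> A2 q \<alpha>\<close> (which determines them almost everywhere).\<close>

definition realizes_bargmann ::
  "real \<Rightarrow> real \<Rightarrow> ((real \<Rightarrow> complex) \<Rightarrow> (complex \<Rightarrow> complex)) \<Rightarrow> bool" where
  "realizes_bargmann q \<alpha> U \<longleftrightarrow>
     (\<forall>\<phi>\<in>L2 (H_measure q \<alpha>). U \<phi> \<in> A2 q \<alpha> \<and> (\<forall>z\<in>Cq q. U \<phi> z = bargmann q \<alpha> \<phi> z))"

end

theory Submission
  imports Defs
begin

text \<open>
  With \<open>a = \<surd>\<alpha>\<close> and \<open>u = e\<^sup>i\<^sup>\<theta>\<close>, the kernel \<open>\<T>(z, \<xi>)\<close> is the generating function of the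
  normalized Al-Salam--Chihara polynomials, so that
  \<open>\<T>(z, \<xi>) = (\<Sum>n. z\<^sup>n / \<surd>x\<^sub>n! * \<phi>\<^sub>n(\<xi>))\<close> and the transform sends the expansion
  \<open>\<Sum>c\<^sub>n \<phi>\<^sub>n\<close> to \<open>\<Sum>c\<^sub>n z\<^sup>n / \<surd>x\<^sub>n!\<close>. It therefore suffices that the \<open>\<phi>\<^sub>n\<close> form an orthonormal
  basis of the weighted space and that the normalized monomials are orthonormal for \<open>\<nu>\<close>.
  Orthogonality of the \<open>\<phi>\<^sub>n\<close> is reduced by the three-term recurrence to the vanishing of the
  single integrals of \<open>Q\<^sub>n\<close>, which follow from the two-parameter integral
  \<open>4\<pi> / ((q, ab; q)\<^sub>\<infinity>)\<close> of the weight; the latter is obtained by expanding in continuous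
  \<open>q\<close>-Hermite polynomials, and for those from the finite Jacobi triple product.
  Completeness is the Weierstrass theorem. The moments of \<open>\<rho>\<close> come from the generating function
  of the Rogers-Szego polynomials, whose positivity uses \<open>\<alpha> < q\<close>.
\<close>

section \<open>\<open>q\<close>-Pochhammer symbols\<close>

text \<open>The largest radius charged by \<open>\<nu>\<close> is the radius of \<open>Cq q\<close>
  itself, so a power series on the open disc leaves a set of positive measure undefined. Hence the
  values on the boundary circle come from a mean-square limit, and a separate argument must show
  that the inner circles already determine the coefficients of an element of the target space. The
  terminating sum that defines the polynomials divides by \<open>a^n\<close> and hides both their
  size and their limit at \<open>a = 0\<close>, so they are traded for the convolution coefficients
  of the generating function; reality and evenness in the angle are then read from the recurrence,
  whose middle term disappears for the parameters \<open>a, -a\<close>. The terminating sum is still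
  needed for the single integrals: its basis functions \<open>(a u, a / u; q)_k\<close> only shift
  \<open>a\<close> to \<open>a q^k\<close> in the denominator of the weight. The two bounds on
  \<open>\<alpha>\<close> act at different places: \<open>-1 < \<alpha>\<close> makes
  \<open>(-\<alpha>; q)_n\<close> positive, and \<open>\<alpha> < q\<close> says
  \<open>-1 < -\<alpha> / q\<close>, where \<open>-\<alpha> / q\<close> is the argument of the
  Rogers-Szego polynomials in the masses of \<open>\<rho>\<close>.\<close>

lemma qpoch_0 [simp]: "qpoch a q 0 = 1"
  by (simp add: qpoch_def)

lemma qpoch_Suc: "qpoch a q (Suc n) = qpoch a q n * (1 - a * q ^ n)"
  by (simp add: qpoch_def)

lemma qpoch_Suc_shift: "qpoch a q (Suc n) = (1 - a) * qpoch (a * q) q n"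
  unfolding qpoch_def by (subst prod.lessThan_Suc_shift) (simp add: mult_ac)

lemma qpoch_add: "qpoch a q (m + n) = qpoch a q m * qpoch (a * q ^ m) q n"
  by (induction n) (simp_all add: qpoch_Suc power_add mult_ac)

lemma qpoch_zero [simp]: "qpoch 0 q n = 1"
  by (simp add: qpoch_def)

lemma qpoch_of_real: "qpoch (of_real a) (of_real q) n = of_real (qpoch a q n)"
  by (simp add: qpoch_def)

locale q_parameter =
  fixes q :: real
  assumes q_pos: "0 < q" and q_less_1: "q < 1"
begin

abbreviation cq :: "'a::real_normed_field" where "cq \<equiv> of_real q"

lemma abs_q [simp]: "\<bar>q\<bar> = q" "norm q = q" "0 \<le> q" "q \<noteq> 0"
  using q_pos by auto

lemma qpow_le_1: "q ^ n \<le> 1"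
  using q_pos q_less_1 by (simp add: power_le_one)

lemma qpow_pos: "0 < q ^ n"
  using q_pos by simp

lemma qpow_less_1: "q ^ Suc n < 1"
  using q_pos q_less_1 by (rule power_Suc_less_one)

lemma factor_nonzero:
  fixes a :: "'a::real_normed_field"
  assumes "norm a < 1" shows "1 - a * cq ^ n \<noteq> 0"
proof
  assume "1 - a * cq ^ n = 0"
  then have "norm (a * cq ^ n) = 1" by (metis eq_iff_diff_eq_0 norm_one)
  then have "norm a * q ^ n = 1" using q_pos by (simp add: norm_mult norm_power)
  moreover have "norm a * q ^ n \<le> norm a * 1"
    by (intro mult_left_mono qpow_le_1) auto
  ultimately show False using assms by simp
qed

lemma qpoch_nonzero:
  fixes a :: "'a::real_normed_field"
  assumes "norm a < 1" shows "qpoch a cq n \<noteq> 0"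
  using factor_nonzero[OF assms] by (simp add: qpoch_def)

lemma norm_cq [simp]: "norm (cq :: 'a::real_normed_field) = q"
  using q_pos by simp

lemma qq_nonzero [simp]: "qpoch cq (cq :: 'a::real_normed_field) n \<noteq> 0"
  by (rule qpoch_nonzero) (simp add: q_less_1)

lemma qq_nonzero_real [simp]: "qpoch q q n \<noteq> 0"
  using qq_nonzero[where 'a = real] by simp

lemma qpoch_real_pos: assumes "a < 1" shows "0 < qpoch a q n"
proof -
  have "a * q ^ k < 1" for k
  proof (cases "0 \<le> a")
    case True
    have "a * q ^ k \<le> a * 1" by (intro mult_left_mono qpow_le_1 True)
    with assms show ?thesis by simp
  next
    case False
    then have "a * q ^ k < 0" using qpow_pos by (simp add: mult_neg_pos)
    then show ?thesis by simp
  qed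
  then show ?thesis by (simp add: qpoch_def prod_pos)
qed

lemma summable_qpow_norm:
  fixes a :: "'a::real_normed_field"
  shows "summable (\<lambda>k. norm (a * cq ^ k))"
  by (simp add: norm_mult norm_power summable_mult summable_geometric q_less_1)

lemma convergent_qpoch:
  fixes a :: "'a::{real_normed_field,banach}"
  shows "convergent_prod (\<lambda>k. 1 - a * cq ^ k)"
proof -
  have "summable (\<lambda>k. norm (1 - a * cq ^ k - 1))"
    using summable_qpow_norm[of a] by (simp add: norm_minus_commute)
  then show ?thesis
    by (intro abs_convergent_prod_imp_convergent_prod summable_imp_abs_convergent_prod)
qed

lemma qpoch_tendsto:
  fixes a :: "'a::{real_normed_field,banach}"
  shows "(\<lambda>n. qpoch a cq n) \<longlonglongrightarrow> qpoch_inf a cq"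
  unfolding qpoch_def qpoch_inf_def
  by (rule has_prod_imp_tendsto') (rule convergent_prod_has_prod[OF convergent_qpoch])

lemma qpoch_inf_nonzero:
  fixes a :: "'a::{real_normed_field,banach}"
  assumes "norm a < 1" shows "qpoch_inf a cq \<noteq> 0"
  unfolding qpoch_inf_def
  using convergent_qpoch factor_nonzero[OF assms] by (rule prodinf_nonzero)

lemma qpoch_inf_split:
  fixes a :: "'a::{real_normed_field,banach}"
  shows "qpoch_inf a cq = qpoch a cq n * qpoch_inf (a * cq ^ n) cq"
proof (rule LIMSEQ_unique)
  show "(\<lambda>m. qpoch a cq (n + m)) \<longlonglongrightarrow> qpoch_inf a cq"
    using LIMSEQ_ignore_initial_segment[OF qpoch_tendsto[of a], of n] by (simp add: add.commute)
  show "(\<lambda>m. qpoch a cq (n + m)) \<longlonglongrightarrow> qpoch a cq n * qpoch_inf (a * cq ^ n) cq"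
    unfolding qpoch_add by (intro tendsto_mult_left qpoch_tendsto)
qed

lemma qpoch_inf_of_real:
  "qpoch_inf (of_real a) (of_real q :: 'a::{real_normed_field,banach}) = of_real (qpoch_inf a q)"
proof (rule LIMSEQ_unique[OF qpoch_tendsto])
  show "(\<lambda>n. qpoch (of_real a) (cq :: 'a) n) \<longlonglongrightarrow> of_real (qpoch_inf a q)"
    unfolding qpoch_of_real using qpoch_tendsto[of a] by (auto intro: tendsto_of_real)
qed

lemma qpoch_inf_real_pos: assumes "a < 1" shows "0 < qpoch_inf a q"
proof -
  have le: "0 \<le> qpoch_inf a q"
    using qpoch_tendsto[of a] qpoch_real_pos[OF assms]
    by (intro LIMSEQ_le_const[of "qpoch a q"]) (auto intro: less_imp_le)
  have "qpoch_inf a q \<noteq> 0"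
    unfolding qpoch_inf_def
  proof (rule prodinf_nonzero)
    show "convergent_prod (\<lambda>k. 1 - a * q ^ k)" using convergent_qpoch[of a] by simp
    show "1 - a * q ^ k \<noteq> 0" for k
      using qpoch_real_pos[OF assms, of "Suc k"] by (auto simp: qpoch_Suc)
  qed
  with le show ?thesis by simp
qed

text \<open>The factors are at most \<open>1 + R q^k\<close>, and the products of these increase to
  their limit. The bound is independent of \<open>n\<close> and uniform on the disc, so it serves as
  a dominating constant.\<close>

lemma norm_qpoch_le:
  fixes a :: "'a::real_normed_field"
  assumes "norm a \<le> R"
  shows "norm (qpoch a cq n) \<le> qpoch_inf (- R) q"
proof -
  have R: "0 \<le> R" using assms norm_ge_zero order_trans by blast
  have "norm (qpoch a cq n) = (\<Prod>k<n. norm (1 - a * cq ^ k))"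
    by (simp add: qpoch_def prod_norm)
  also have "\<dots> \<le> qpoch (- R) q n"
    unfolding qpoch_def
  proof (rule prod_mono, intro conjI norm_ge_zero)
    fix k
    have "norm (1 - a * cq ^ k) \<le> norm (1::'a) + norm (a * cq ^ k)" by (rule norm_triangle_ineq4)
    also have "norm (a * cq ^ k) \<le> R * q ^ k"
      using assms q_pos by (simp add: norm_mult norm_power mult_right_mono)
    finally show "norm (1 - a * cq ^ k) \<le> 1 - - R * q ^ k" by simp
  qed
  also have "\<dots> \<le> qpoch_inf (- R) q"
  proof (rule incseq_le)
    show "incseq (qpoch (- R) q)"
    proof (rule incseq_SucI)
      fix n
      have "qpoch (- R) q n * 1 \<le> qpoch (- R) q n * (1 - - R * q ^ n)"
        using R qpoch_real_pos[of "- R"] qpow_pos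
        by (intro mult_left_mono) (auto intro: less_imp_le mult_nonneg_nonneg)
      then show "qpoch (- R) q n \<le> qpoch (- R) q (Suc n)" by (simp add: qpoch_Suc)
    qed
    show "qpoch (- R) q \<longlonglongrightarrow> qpoch_inf (- R) q" using qpoch_tendsto[of "- R"] by simp
  qed
  finally show ?thesis .
qed

text \<open>The factors are at least \<open>1 - r q^k\<close>, and the products of these decrease to
  a positive limit. This keeps the denominators uniformly away from 0.\<close>

lemma norm_qpoch_ge:
  fixes a :: "'a::real_normed_field"
  assumes "norm a \<le> r" "r < 1"
  shows "qpoch_inf r q \<le> norm (qpoch a cq n)"
proof -
  have r: "0 \<le> r" using assms norm_ge_zero order_trans by blast
  have "qpoch_inf r q \<le> qpoch r q n"
  proof (rule decseq_ge)
    show "decseq (qpoch r q)"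
    proof (rule decseq_SucI)
      fix n
      have "qpoch r q n * (1 - r * q ^ n) \<le> qpoch r q n * 1"
        using r qpoch_real_pos[of r] assms qpow_pos
        by (intro mult_left_mono) (auto intro: less_imp_le mult_nonneg_nonneg)
      then show "qpoch r q (Suc n) \<le> qpoch r q n" by (simp add: qpoch_Suc)
    qed
    show "qpoch r q \<longlonglongrightarrow> qpoch_inf r q" using qpoch_tendsto[of r] by simp
  qed
  also have "\<dots> \<le> (\<Prod>k<n. norm (1 - a * cq ^ k))"
    unfolding qpoch_def
  proof (rule prod_mono, intro conjI)
    fix k
    have "r * q ^ k \<le> r * 1" by (intro mult_left_mono qpow_le_1 r)
    then show "0 \<le> 1 - r * q ^ k" using assms by simp
    have "norm (1::'a) - norm (a * cq ^ k) \<le> norm (1 - a * cq ^ k)" by (rule norm_triangle_ineq2)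
    moreover have "norm (a * cq ^ k) \<le> r * q ^ k"
      using assms q_pos by (simp add: norm_mult norm_power mult_right_mono)
    ultimately show "1 - r * q ^ k \<le> norm (1 - a * cq ^ k)" by simp
  qed
  also have "\<dots> = norm (qpoch a cq n)"
    by (simp add: qpoch_def prod_norm)
  finally show ?thesis .
qed

text \<open>Weierstrass test with majorant \<open>R q^n\<close>. Uniformity on discs makes the
  infinite product continuous in \<open>a\<close>, hence the weights continuous in the
  angle.\<close>

lemma uniform_limit_qpoch:
  "uniform_limit (cball 0 R) (\<lambda>N a. qpoch a (cq :: complex) N) (\<lambda>a. qpoch_inf a cq) sequentially"
proof -
  have "uniformly_convergent_on (cball 0 R) (\<lambda>N a :: complex. \<Prod>k<N. 1 - a * cq ^ k)"
  proof (rule uniformly_convergent_on_prod')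
    show "uniformly_convergent_on (cball 0 R) (\<lambda>N x :: complex. \<Sum>n<N. norm (1 - x * cq ^ n - 1))"
    proof (rule Weierstrass_m_test')
      show "summable (\<lambda>n. R * q ^ n)"
        by (intro summable_mult summable_geometric) (simp add: q_less_1)
      show "\<And>n x. x \<in> cball 0 R \<Longrightarrow> norm (norm (1 - x * cq ^ n - 1)) \<le> R * q ^ n"
        using q_pos by (simp add: norm_mult norm_power mult_right_mono)
    qed
  qed (auto intro!: continuous_intros)
  then have "uniformly_convergent_on (cball 0 R) (\<lambda>N a. qpoch a (cq :: complex) N)"
    by (simp add: qpoch_def)
  then obtain l where l: "uniform_limit (cball 0 R) (\<lambda>N a. qpoch a (cq :: complex) N) l sequentially"
    by (auto simp: uniformly_convergent_on_def)
  have "l a = qpoch_inf a cq" if "a \<in> cball 0 R" for a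
    using tendsto_uniform_limitI[OF l that] qpoch_tendsto LIMSEQ_unique by blast
  then have "uniform_limit (cball 0 R) (\<lambda>N a. qpoch a (cq :: complex) N) l sequentially \<longleftrightarrow> ?thesis"
    by (intro uniform_limit_cong') auto
  then show ?thesis using l by simp
qed

lemma continuous_qpoch_inf [continuous_intros]:
  fixes f :: "'a::topological_space \<Rightarrow> complex"
  assumes "continuous_on S f" shows "continuous_on S (\<lambda>x. qpoch_inf (f x) cq)"
proof -
  have "continuous_on (ball 0 R) (\<lambda>a :: complex. qpoch_inf a cq)" for R :: real
  proof (rule continuous_on_subset[of "cball 0 R"])
    show "continuous_on (cball 0 R) (\<lambda>a :: complex. qpoch_inf a cq)"
      by (rule uniform_limit_theorem[OF _ uniform_limit_qpoch])
         (auto simp: qpoch_def intro!: always_eventually continuous_intros)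
  qed auto
  then have "continuous_on (\<Union>R :: real. ball 0 R) (\<lambda>a :: complex. qpoch_inf a cq)"
    by (intro continuous_on_open_UN) auto
  moreover have "(\<Union>R :: real. ball 0 R) = (UNIV :: complex set)"
    by (auto intro: gt_ex)
  ultimately have "continuous_on UNIV (\<lambda>a :: complex. qpoch_inf a cq)" by simp
  then show ?thesis using assms continuous_on_compose2 by blast
qed

section \<open>Euler's expansion of the reciprocal infinite product\<close>

lemma summable_euler:
  fixes s :: "'a::{real_normed_field,banach}"
  assumes "norm s < 1" shows "summable (\<lambda>n. norm (s ^ n / qpoch cq cq n))"
proof (rule summable_comparison_test_ev)
  let ?c = "qpoch_inf q q"
  show "summable (\<lambda>n. norm s ^ n * (1 / ?c))"
    using assms by (intro summable_mult2 summable_geometric) simp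
  have c: "0 < ?c" by (rule qpoch_inf_real_pos[OF q_less_1])
  have "norm (norm (s ^ n / qpoch cq cq n)) \<le> norm s ^ n * (1 / ?c)" for n
  proof -
    have "?c \<le> norm (qpoch cq (cq :: 'a) n)" by (rule norm_qpoch_ge) (simp_all add: q_less_1)
    then have "norm s ^ n / norm (qpoch cq (cq :: 'a) n) \<le> norm s ^ n / ?c"
      using c by (intro divide_left_mono mult_pos_pos) auto
    then show ?thesis by (simp add: norm_divide norm_power)
  qed
  then show "\<forall>\<^sub>F n in sequentially. norm (norm (s ^ n / qpoch cq cq n)) \<le> norm s ^ n * (1 / ?c)"
    by simp
qed

text \<open>The sum \<open>F\<close> satisfies \<open>F (s * q) = (1 - s) * F s\<close>; iterate and use continuity at \<open>0\<close>.\<close>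

lemma euler_sums:
  fixes s :: "'a::{real_normed_field,banach}"
  assumes s: "norm s < 1" shows "(\<lambda>n. s ^ n / qpoch cq cq n) sums (1 / qpoch_inf s cq)"
proof -
  define F where "F = (\<lambda>s::'a. \<Sum>n. s ^ n / qpoch cq cq n)"
  have sm: "summable (\<lambda>n. t ^ n / qpoch cq cq n)" if "norm t < 1" for t :: 'a
    using summable_euler[OF that] by (rule summable_norm_cancel)
  have small: "norm (t * cq ^ n) < 1" if "norm t < 1" for t :: 'a and n
  proof -
    have "norm (t * cq ^ n) \<le> norm t * 1"
      unfolding norm_mult norm_power norm_cq by (intro mult_left_mono qpow_le_1) auto
    with that show ?thesis by simp
  qed
  have step: "F (t * cq) = (1 - t) * F t" if t: "norm t < 1" for t
  proof -
    have "F t - F (t * cq) = (\<Sum>n. t ^ n / qpoch cq cq n - (t * cq) ^ n / qpoch cq cq n)"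
      unfolding F_def using sm[OF t] sm[OF small[OF t, of 1]] by (simp add: suminf_diff)
    also have "\<dots> = (\<Sum>n. t ^ Suc n / qpoch cq cq (Suc n) - (t * cq) ^ Suc n / qpoch cq cq (Suc n))"
      using suminf_split_head[of "\<lambda>n. t ^ n / qpoch cq cq n - (t * cq) ^ n / qpoch cq cq n"]
        summable_diff[OF sm[OF t] sm[OF small[OF t, of 1]]] by simp
    also have "\<dots> = (\<Sum>n. t * (t ^ n / qpoch cq cq n))"
    proof (rule suminf_cong)
      fix n
      have nz: "1 - cq * cq ^ n \<noteq> (0::'a)" by (rule factor_nonzero) (simp add: q_less_1)
      have "t ^ Suc n / qpoch cq cq (Suc n) - (t * cq) ^ Suc n / qpoch cq cq (Suc n)
          = t ^ Suc n * (1 - cq * cq ^ n) / (qpoch cq cq n * (1 - cq * cq ^ n))"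
        by (simp add: qpoch_Suc power_mult_distrib diff_divide_distrib algebra_simps)
      then show "t ^ Suc n / qpoch cq cq (Suc n) - (t * cq) ^ Suc n / qpoch cq cq (Suc n)
          = t * (t ^ n / qpoch cq cq n)" using nz by simp
    qed
    also have "\<dots> = t * F t" unfolding F_def by (rule suminf_mult[OF sm[OF t]])
    finally show ?thesis by (simp add: algebra_simps)
  qed
  have iter: "F (s * cq ^ N) = qpoch s cq N * F s" for N
  proof (induction N)
    case (Suc N)
    have "F (s * cq ^ Suc N) = (1 - s * cq ^ N) * F (s * cq ^ N)"
      using step[OF small[OF s, of N]] by (simp add: mult_ac)
    with Suc show ?case by (simp add: qpoch_Suc)
  qed simp
  have F0: "F 0 = 1"
    unfolding F_def using suminf_finite[of "{0}" "\<lambda>n. (0::'a) ^ n / qpoch cq cq n"]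
    by (simp add: power_0_left)
  have "isCont F 0"
  proof -
    have sm2: "summable (\<lambda>n. (1 / qpoch cq cq n) * (of_real (1/2) :: 'a) ^ n)"
      using sm[of "of_real (1/2)"] by simp
    show ?thesis
      unfolding F_def using isCont_powser[OF sm2, of 0] by simp
  qed
  moreover have "(\<lambda>N. s * cq ^ N) \<longlonglongrightarrow> 0"
    using LIMSEQ_power_zero[of "cq :: 'a"] q_less_1 by (auto intro: tendsto_mult_right_zero)
  ultimately have "(\<lambda>N. F (s * cq ^ N)) \<longlonglongrightarrow> F 0"
    by (rule isCont_tendsto_compose)
  moreover have "(\<lambda>N. F (s * cq ^ N)) \<longlonglongrightarrow> qpoch_inf s cq * F s"
    unfolding iter by (intro tendsto_mult_right qpoch_tendsto)
  ultimately have "qpoch_inf s cq * F s = 1" using F0 LIMSEQ_unique by metis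
  then have "F s = 1 / qpoch_inf s cq"
    using qpoch_inf_nonzero[OF s] by (simp add: field_simps)
  then show ?thesis using sm[OF s] unfolding F_def by (metis summable_sums)
qed

end

section \<open>Al-Salam--Chihara polynomials\<close>

context q_parameter begin

abbreviation Q :: complex where "Q \<equiv> of_real q"

text \<open>For \<open>u = e\<^sup>i\<^sup>\<theta>\<close>, \<open>asc a b u n\<close> is \<open>Q\<^sub>n(cos \<theta>; a, b | q) / ((ab, q; q)\<^sub>n)\<close>, written as the
  \<open>n\<close>-th coefficient of the generating function that is the kernel \<open>\<T>\<close>. Unlike the defining
  formula it makes sense for \<open>a = 0\<close> and is visibly bounded on the unit circle.\<close>

definition asc :: "complex \<Rightarrow> complex \<Rightarrow> complex \<Rightarrow> nat \<Rightarrow> complex" where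
  "asc a b u n = (\<Sum>k\<le>n. qpoch (a / u) Q k * qpoch (b / u) Q k / (qpoch (a * b) Q k * qpoch Q Q k) * u ^ k
     * (1 / (u ^ (n - k) * qpoch Q Q (n - k))))"

lemma asc_0 [simp]: "asc a b u 0 = 1"
  by (simp add: asc_def)

lemma Q_power_neq_1: "1 - Q ^ Suc n \<noteq> 0"
  using factor_nonzero[of Q n] q_less_1 by simp

lemma Q_power_nonzero [simp]: "Q ^ n \<noteq> 0"
  by simp

lemma asc_1:
  assumes "u \<noteq> 0" "norm (a * b) < 1"
  shows "(1 - a * b) * (1 - Q) * asc a b u (Suc 0) = u + 1 / u - (a + b)"
proof -
  have "1 - a * b \<noteq> 0" using factor_nonzero[OF assms(2), of 0] by simp
  moreover have "1 - Q \<noteq> 0" using Q_power_neq_1[of 0] by simp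
  moreover have "asc a b u (Suc 0) = 1 / (u * (1 - Q)) + ((1 - a / u) * (1 - b / u) * u) / ((1 - a * b) * (1 - Q))"
    by (simp add: asc_def qpoch_Suc)
  ultimately have "(1 - a * b) * (1 - Q) * asc a b u (Suc 0) = (1 - a * b) / u + (1 - a / u) * (1 - b / u) * u"
    by (simp add: distrib_left)
  also have "\<dots> = u + 1 / u - (a + b)" using assms(1) by (simp add: field_simps)
  finally show ?thesis .
qed

text \<open>\<open>S n f\<close> is the convolution sum weighted by \<open>f (q\<^sup>k) (q\<^sup>n\<^sup>-\<^sup>k)\<close>. A factor \<open>1 - y\<close> or
  \<open>(1 - x) * (1 - a * b * x / q)\<close> in \<open>f\<close> lowers \<open>n\<close> by one; after two such reductions the
  recurrence becomes a difference of two sums that reduce to the same one.\<close>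

lemma asc_recurrence:
  assumes u: "u \<noteq> 0" and ab: "norm (a * b) < 1"
  shows "(1 - a * b * Q ^ Suc n) * (1 - Q ^ Suc (Suc n)) * asc a b u (Suc (Suc n))
    + ((a + b) * Q ^ Suc n - u - 1 / u) * asc a b u (Suc n) + asc a b u n = 0"
proof -
  define G where "G k = qpoch (a / u) Q k * qpoch (b / u) Q k / (qpoch (a * b) Q k * qpoch Q Q k) * u ^ k" for k
  define E where "E k = 1 / (u ^ k * qpoch Q Q k)" for k
  define S where "S n f = (\<Sum>k\<le>n. f (Q ^ k) (Q ^ (n - k)) * (G k * E (n - k)))" for n and f :: "complex \<Rightarrow> complex \<Rightarrow> complex"
  have asc_S: "asc a b u n = S n (\<lambda>_ _. 1)" for n
    by (simp add: asc_def S_def G_def E_def)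
  have E_Suc: "(1 - Q ^ Suc k) * E (Suc k) = E k / u" for k
    using Q_power_neq_1[of k] u by (simp add: E_def qpoch_Suc)
  have G_Suc: "(1 - Q ^ Suc k) * (1 - a * b * Q ^ k) * G (Suc k)
      = u * (1 - a / u * Q ^ k) * (1 - b / u * Q ^ k) * G k" for k
    using Q_power_neq_1[of k] factor_nonzero[OF ab, of k] u by (simp add: G_def qpoch_Suc)
  have S_add: "S n (\<lambda>x y. f x y + g x y) = S n f + S n g" for n f g
    by (simp add: S_def algebra_simps sum.distrib)
  have S_diff: "S n (\<lambda>x y. f x y - g x y) = S n f - S n g" for n f g
    by (simp add: S_def algebra_simps sum_subtractf)
  have S_cmult: "S n (\<lambda>x y. c * f x y) = c * S n f" for n f c
    by (simp add: S_def sum_distrib_left mult.assoc)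
  have S_N: "S (Suc n) (\<lambda>x y. (1 - y) * f x y) = S n (\<lambda>x y. f x (Q * y)) / u" for n f
  proof -
    have "S (Suc n) (\<lambda>x y. (1 - y) * f x y)
        = (\<Sum>k\<le>n. (1 - Q ^ (Suc n - k)) * f (Q ^ k) (Q ^ (Suc n - k)) * (G k * E (Suc n - k)))"
      by (simp add: S_def)
    also have "\<dots> = (\<Sum>k\<le>n. f (Q ^ k) (Q * Q ^ (n - k)) * (G k * E (n - k)) / u)"
    proof (rule sum.cong)
      fix k assume "k \<in> {..n}"
      then have k: "Suc n - k = Suc (n - k)" by (simp add: Suc_diff_le)
      have "(1 - Q ^ Suc (n - k)) * f (Q ^ k) (Q ^ Suc (n - k)) * (G k * E (Suc (n - k)))
          = f (Q ^ k) (Q ^ Suc (n - k)) * G k * ((1 - Q ^ Suc (n - k)) * E (Suc (n - k)))"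
        by (simp add: mult_ac)
      then show "(1 - Q ^ (Suc n - k)) * f (Q ^ k) (Q ^ (Suc n - k)) * (G k * E (Suc n - k))
          = f (Q ^ k) (Q * Q ^ (n - k)) * (G k * E (n - k)) / u"
        unfolding E_Suc k by (simp add: mult_ac)
    qed simp
    finally show ?thesis by (simp add: S_def sum_divide_distrib)
  qed
  have S_Q: "S (Suc n) (\<lambda>x y. (1 - x) * (1 - a * b * x / Q) * f x y)
      = S n (\<lambda>x y. u * ((1 - a / u * x) * (1 - b / u * x)) * f (Q * x) y)" for n f
  proof -
    have "S (Suc n) (\<lambda>x y. (1 - x) * (1 - a * b * x / Q) * f x y)
        = (\<Sum>k\<le>n. (1 - Q ^ Suc k) * (1 - a * b * Q ^ Suc k / Q) * f (Q ^ Suc k) (Q ^ (n - k)) * (G (Suc k) * E (n - k)))"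
      unfolding S_def by (subst sum.atMost_Suc_shift) simp
    also have "\<dots> = (\<Sum>k\<le>n. u * ((1 - a / u * Q ^ k) * (1 - b / u * Q ^ k)) * f (Q * Q ^ k) (Q ^ (n - k)) * (G k * E (n - k)))"
    proof (rule sum.cong)
      fix k
      have "(1 - Q ^ Suc k) * (1 - a * b * Q ^ Suc k / Q) * f (Q ^ Suc k) (Q ^ (n - k)) * (G (Suc k) * E (n - k))
          = ((1 - Q ^ Suc k) * (1 - a * b * Q ^ k) * G (Suc k)) * f (Q ^ Suc k) (Q ^ (n - k)) * E (n - k)"
        by (simp add: mult_ac)
      then show "(1 - Q ^ Suc k) * (1 - a * b * Q ^ Suc k / Q) * f (Q ^ Suc k) (Q ^ (n - k)) * (G (Suc k) * E (n - k))
          = u * ((1 - a / u * Q ^ k) * (1 - b / u * Q ^ k)) * f (Q * Q ^ k) (Q ^ (n - k)) * (G k * E (n - k))"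
        unfolding G_Suc by (simp add: mult_ac)
    qed simp
    finally show ?thesis by (simp add: S_def)
  qed
  define C where "C = a * b"
  \<comment> \<open>In a sum of order \<open>n + 2\<close> the product \<open>x y\<close> is the
    constant \<open>q^(n+2)\<close>, so the prefactor is a polynomial in \<open>x\<close> and
    \<open>y\<close>. Its value at \<open>y = 1\<close> is the first summand; the remainder is
    divisible by \<open>1 - y\<close>.\<close>
  have "(1 - C * Q ^ Suc n) * (1 - Q ^ Suc (Suc n)) * S (Suc (Suc n)) (\<lambda>_ _. 1)
      = S (Suc (Suc n)) (\<lambda>x y. (1 - x) * (1 - C * x / Q) * 1 + (1 - y) * ((C / Q + 1) * x - C / Q * x\<^sup>2 * (y + 1)))"
    unfolding S_def sum_distrib_left
  proof (rule sum.cong)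
    fix k assume "k \<in> {..Suc (Suc n)}"
    then have "Q ^ Suc (Suc n) = Q ^ k * Q ^ (Suc (Suc n) - k)" by (simp flip: power_add)
    moreover from this have "Q ^ Suc n = Q ^ k * Q ^ (Suc (Suc n) - k) / Q"
      by (metis Q_power_nonzero nonzero_mult_div_cancel_left power_Suc power_one_right)
    ultimately have "(1 - C * Q ^ Suc n) * (1 - Q ^ Suc (Suc n))
        = (1 - Q ^ k) * (1 - C * Q ^ k / Q) * 1 + (1 - Q ^ (Suc (Suc n) - k)) *
        ((C / Q + 1) * Q ^ k - C / Q * (Q ^ k)\<^sup>2 * (Q ^ (Suc (Suc n) - k) + 1))"
      by (simp only:) (simp add: field_simps power2_eq_square)
    then show "(1 - C * Q ^ Suc n) * (1 - Q ^ Suc (Suc n)) * (1 * (G k * E (Suc (Suc n) - k)))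
        = ((1 - Q ^ k) * (1 - C * Q ^ k / Q) * 1 + (1 - Q ^ (Suc (Suc n) - k)) *
        ((C / Q + 1) * Q ^ k - C / Q * (Q ^ k)\<^sup>2 * (Q ^ (Suc (Suc n) - k) + 1))) * (G k * E (Suc (Suc n) - k))"
      by simp
  qed simp
  also have "\<dots> = S (Suc n) (\<lambda>x y. u * ((1 - a / u * x) * (1 - b / u * x)) * 1)
      + S (Suc n) (\<lambda>x y. (1 / u) * ((C / Q + 1) * x - C / Q * x\<^sup>2 * (Q * y + 1)))"
    unfolding C_def S_add S_Q S_N S_cmult[of _ "1 / u"] by simp
  finally have top: "(1 - C * Q ^ Suc n) * (1 - Q ^ Suc (Suc n)) * asc a b u (Suc (Suc n)) = \<dots>"
    by (simp only: asc_S)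
  have mid: "((a + b) * Q ^ Suc n - u - 1 / u) * asc a b u (Suc n)
      = S (Suc n) (\<lambda>x y. (a + b) * (x * y) - u - 1 / u)"
    unfolding asc_S S_def sum_distrib_left
  proof (rule sum.cong)
    fix k assume "k \<in> {..Suc n}"
    then have "Q ^ Suc n = Q ^ k * Q ^ (Suc n - k)" by (simp flip: power_add)
    then show "((a + b) * Q ^ Suc n - u - 1 / u) * (1 * (G k * E (Suc n - k)))
        = ((a + b) * (Q ^ k * Q ^ (Suc n - k)) - u - 1 / u) * (G k * E (Suc n - k))" by simp
  qed simp
  \<comment> \<open>Here \<open>S_N\<close> is read backwards: inserting the factor
    \<open>1 - y\<close> raises the order from \<open>n\<close> to \<open>n + 1\<close>, where all
    three terms can be added.\<close>
  have bot: "asc a b u n = S (Suc n) (\<lambda>x y. u * ((1 - y) * 1))"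
    unfolding asc_S S_cmult S_N using u by simp
  have "(1 - C * Q ^ Suc n) * (1 - Q ^ Suc (Suc n)) * asc a b u (Suc (Suc n))
    + ((a + b) * Q ^ Suc n - u - 1 / u) * asc a b u (Suc n) + asc a b u n
    = S (Suc n) (\<lambda>x y. u * ((1 - y) * ((1 - a / u * x) * (1 - b / u * x))) - (1 / u) * ((1 - x) * (1 - C * x / Q) * 1))"
    unfolding top mid bot S_add[symmetric]
    by (rule arg_cong[of _ _ "S (Suc n)"], intro ext)
       (use u in \<open>simp add: C_def power2_eq_square field_simps\<close>)
  also have "\<dots> = 0"
    unfolding S_diff S_cmult[of _ u] S_cmult[of _ "1 / u"] S_N C_def S_Q
    using S_cmult[of n u "\<lambda>x y. (1 - a / u * x) * (1 - b / u * x)"] u by simp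
  finally show ?thesis by (simp add: C_def)
qed

text \<open>The leading coefficient of the recurrence never vanishes because
  \<open>|a b| < 1\<close>, so two initial values fix the solution. This is how the terminating
  series is identified.\<close>

lemma asc_unique:
  assumes u: "u \<noteq> 0" and ab: "norm (a * b) < 1"
    and 0: "d 0 = 1" and 1: "(1 - a * b) * (1 - Q) * d (Suc 0) = u + 1 / u - (a + b)"
    and rec: "\<And>n. (1 - a * b * Q ^ Suc n) * (1 - Q ^ Suc (Suc n)) * d (Suc (Suc n))
      + ((a + b) * Q ^ Suc n - u - 1 / u) * d (Suc n) + d n = 0"
  shows "d n = asc a b u n"
proof (induction n rule: less_induct)
  case (less n)
  consider "n = 0" | "n = Suc 0" | m where "n = Suc (Suc m)" by (metis not0_implies_Suc)
  then show ?case
  proof cases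
    case 2
    have "(1 - a * b) * (1 - Q) \<noteq> 0"
      using Q_power_neq_1[of 0] factor_nonzero[OF ab, of 0] by simp
    with 1 asc_1[OF u ab] 2 show ?thesis by (metis mult_left_cancel)
  next
    case 3
    have "(1 - a * b * Q ^ Suc m) * (1 - Q ^ Suc (Suc m)) \<noteq> 0"
      using Q_power_neq_1[of "Suc m"] factor_nonzero[OF ab, of "Suc m"] by simp
    moreover have "d m = asc a b u m" "d (Suc m) = asc a b u (Suc m)" using less 3 by simp_all
    then have "(1 - a * b * Q ^ Suc m) * (1 - Q ^ Suc (Suc m)) * d (Suc (Suc m))
        = (1 - a * b * Q ^ Suc m) * (1 - Q ^ Suc (Suc m)) * asc a b u (Suc (Suc m))"
      using rec[of m] asc_recurrence[OF u ab, of m] by (simp only: add.assoc) (metis add_right_cancel)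
    ultimately show ?thesis unfolding 3 by (rule mult_left_cancel[THEN iffD1])
  qed (simp add: 0)
qed

text \<open>One factor of \<open>(Y; q)_(k+1)\<close> is split off at the front or at the back. This
  expresses the symbol with \<open>q^-n\<close> through the one with
  \<open>q^-(n+1)\<close>.\<close>

lemma qpoch_neg_power:
  fixes n :: nat
  defines "Y \<equiv> 1 / Q ^ Suc n"
  shows "qpoch (1 / Q ^ n) Q k * (1 - Y) = qpoch Y Q k * (1 - Y * Q ^ k)"
    and "qpoch (1 / Q ^ n) Q k * (1 - Y) = qpoch Y Q (Suc k)"
proof -
  have "1 / Q ^ n = Y * Q" by (simp add: Y_def)
  then show "qpoch (1 / Q ^ n) Q k * (1 - Y) = qpoch Y Q (Suc k)"
    using qpoch_Suc_shift[of Y Q k] by (simp add: mult_ac)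
  then show "qpoch (1 / Q ^ n) Q k * (1 - Y) = qpoch Y Q k * (1 - Y * Q ^ k)"
    by (simp add: qpoch_Suc)
qed

lemma qpoch_neg_power_zero: "n < k \<Longrightarrow> qpoch (1 / Q ^ n) Q k = 0"
  by (auto simp: qpoch_def intro!: bexI[of _ n])

text \<open>The left side satisfies the same recurrence. Its coefficients with respect to
  \<open>(au, a/u; q)\<^sub>k\<close> are compared after writing every \<open>(q\<^sup>-\<^sup>m; q)\<^sub>k\<close> that occurs as a multiple of the one
  with the largest \<open>m\<close>, so that no division by a vanishing factor occurs.\<close>

lemma terminating_asc:
  assumes a: "a \<noteq> 0" and u: "u \<noteq> 0" and ab: "norm (a * b) < 1"
  shows "(\<Sum>k\<le>n. qpoch (1 / Q ^ n) Q k * qpoch (a * u) Q k * qpoch (a / u) Q k / qpoch (a * b) Q k * (Q ^ k / qpoch Q Q k))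
      = a ^ n * qpoch Q Q n * asc a b u n"
proof -
  define r where "r k = qpoch (a * u) Q k * qpoch (a / u) Q k / qpoch (a * b) Q k * (Q ^ k / qpoch Q Q k)" for k
  define w where "w n = 1 / (a ^ n * qpoch Q Q n)" for n
  define X where "X n k = qpoch (1 / Q ^ n) Q k" for n k
  define d where "d n = w n * (\<Sum>k\<le>n. X n k * r k)" for n
  define x where "x = u + 1 / u"
  \<comment> \<open>\<open>(q^-n; q)_k\<close> vanishes for \<open>k > n\<close>, so the upper limit
    may be raised; the three degrees in the recurrence then share one range of summation.\<close>
  have ext: "d n = w n * (\<Sum>k\<le>M. X n k * r k)" if "n \<le> M" for n M
    unfolding d_def using that
    by (intro arg_cong[of _ _ "(*) (w n)"] sum.mono_neutral_left) (auto simp: X_def qpoch_neg_power_zero)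
  have r_Suc: "r (Suc k) * ((1 - a * b * Q ^ k) * (1 - Q ^ Suc k)) = Q * (1 + a\<^sup>2 * (Q ^ k)\<^sup>2 - a * Q ^ k * x) * r k" for k
  proof -
    have "(1 - a * u * Q ^ k) * (1 - a / u * Q ^ k) = 1 + a\<^sup>2 * (Q ^ k)\<^sup>2 - a * Q ^ k * x"
      using u by (simp add: x_def field_simps power2_eq_square)
    moreover have "r (Suc k) * ((1 - a * b * Q ^ k) * (1 - Q ^ Suc k))
       = Q * ((1 - a * u * Q ^ k) * (1 - a / u * Q ^ k)) * r k"
      using Q_power_neq_1[of k] factor_nonzero[OF ab, of k] by (simp add: r_def qpoch_Suc)
    ultimately show ?thesis by simp
  qed
  \<comment> \<open>Multiplication by \<open>x = 2 cos \<theta>\<close> in the basis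
    \<open>r k\<close>: the two factors that lead from \<open>r k\<close> to
    \<open>r (Suc k)\<close> multiply to \<open>1 + a^2 q^(2k) - a q^k x\<close>, which is solved
    for \<open>x\<close>.\<close>
  have xr: "x * r k = (1 / (a * Q ^ k) + a * Q ^ k) * r k
      - 1 / (a * Q ^ Suc k) * ((1 - a * b * Q ^ k) * (1 - Q ^ Suc k)) * r (Suc k)" for k
  proof -
    have "1 / (a * Q ^ Suc k) * ((1 - a * b * Q ^ k) * (1 - Q ^ Suc k)) * r (Suc k)
        = 1 / (a * Q ^ Suc k) * (Q * (1 + a\<^sup>2 * (Q ^ k)\<^sup>2 - a * Q ^ k * x) * r k)"
      unfolding r_Suc[symmetric] by (simp only: mult_ac)
    also have "\<dots> = (1 / (a * Q ^ k) + a * Q ^ k - x) * r k"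
      using a by (simp add: field_simps power2_eq_square)
    finally show ?thesis by (simp add: algebra_simps)
  qed
  have w_Suc: "w n = a * (1 - Q ^ Suc n) * w (Suc n)" for n
    using a Q_power_neq_1[of n] by (simp add: w_def qpoch_Suc)
  have X0: "X n 0 = 1" for n by (simp add: X_def)
  have Y1: "1 - 1 / Q ^ Suc n \<noteq> 0" for n
    using Q_power_neq_1[of n] by (simp add: divide_simps)
  have "d n = asc a b u n"
  proof (rule asc_unique[OF u ab])
    show "d 0 = 1" by (simp add: d_def w_def X_def r_def)
    have nz: "1 - a * b \<noteq> 0" "1 - Q \<noteq> 0" using factor_nonzero[OF ab, of 0] Q_power_neq_1[of 0] by simp_all
    show "(1 - a * b) * (1 - Q) * d (Suc 0) = u + 1 / u - (a + b)"
    proof -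
      have cancel: "(1 - 1 / Q) * (t * (Q / (1 - Q))) = - t" for t
        using nz by (simp add: divide_simps) (simp add: algebra_simps)
      have "d (Suc 0) = 1 / (a * (1 - Q)) * (1 + (1 - 1 / Q) * ((1 - a * u) * (1 - a / u) / (1 - a * b) * (Q / (1 - Q))))"
        by (simp add: d_def w_def X_def r_def qpoch_Suc)
      also have "\<dots> = 1 / (a * (1 - Q)) * (1 - (1 - a * u) * (1 - a / u) / (1 - a * b))"
        unfolding cancel by simp
      finally have d1: "d (Suc 0) = \<dots>" .
      have frac: "c * e * (1 / (a * e) * (1 - w / c)) = (c - w) / a" if "c \<noteq> 0" "e \<noteq> 0" for c e w
        using that by (simp add: right_diff_distrib diff_divide_distrib)
      have "(1 - a * b) * (1 - Q) * d (Suc 0) = ((1 - a * b) - (1 - a * u) * (1 - a / u)) / a"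
        unfolding d1 by (rule frac[OF nz])
      also have "\<dots> = u + 1 / u - (a + b)" using a u by (simp add: field_simps)
      finally show ?thesis .
    qed
  next
    fix n
    let ?n = "Suc n" and ?m = "Suc (Suc n)"
    define N where "N = Q ^ ?n"
    define Y where "Y = 1 / Q ^ ?m"
    have Y: "Y = 1 / (Q * N)" "N \<noteq> 0" by (simp_all add: Y_def N_def)
    have YN: "1 - Y \<noteq> 0" using Y1[of ?n] by (simp add: Y_def)
    have Xn: "X ?n k * (1 - Y) = X ?m k * (1 - Y * Q ^ k)" for k
      using qpoch_neg_power(1)[of ?n k] by (simp only: X_def Y_def)
    have Xs: "X ?n k * (1 - Y) = X ?m (Suc k)" for k
      using qpoch_neg_power(2)[of ?n k] by (simp only: X_def Y_def)
    have Xp: "X n k * (1 - 1 / N) = X ?n k * (1 - Q ^ k / N)" for k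
      using qpoch_neg_power(1)[of n k] by (simp add: X_def N_def)
    have wn: "w ?m * (a * (1 - Q * N)) = w ?n" "w n = a * (1 - N) * w ?n"
      using w_Suc[of ?n] w_Suc[of n] by (simp_all add: N_def mult_ac)
    have low: "w n * X n k = - a * (N - Q ^ k) * (w ?n * X ?n k)" for k
    proof -
      have "w n * X n k = - a * N * w ?n * (X n k * (1 - 1 / N))"
        unfolding wn(2) using \<open>N \<noteq> 0\<close> by (simp add: field_simps)
      also have "\<dots> = - a * (N - Q ^ k) * (w ?n * X ?n k)"
        unfolding Xp using \<open>N \<noteq> 0\<close> by (simp add: field_simps)
      finally show ?thesis .
    qed
    \<comment> \<open>Up to sign, \<open>c (Suc k)\<close> is the coefficient of
      \<open>r (Suc k)\<close> in \<open>xr\<close>; since \<open>c 0 = 0\<close>, the reindexed sum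
      may start at 0.\<close>
    define c where "c k = (1 / (a * Q ^ k)) * ((1 - a * b * Q ^ k / Q) * (1 - Q ^ k))" for k
    have shift: "(\<Sum>k\<le>?n. X ?n k * (1 / (a * Q ^ Suc k) * ((1 - a * b * Q ^ k) * (1 - Q ^ Suc k)) * r (Suc k)))
       = (\<Sum>k\<le>?m. X ?m k / (1 - Y) * c k * r k)"
    proof -
      have "(\<Sum>k\<le>?m. X ?m k / (1 - Y) * c k * r k) = (\<Sum>k\<le>?n. X ?m (Suc k) / (1 - Y) * c (Suc k) * r (Suc k))"
        by (subst sum.atMost_Suc_shift) (simp add: c_def)
      also have "\<dots> = (\<Sum>k\<le>?n. X ?n k * (1 / (a * Q ^ Suc k) * ((1 - a * b * Q ^ k) * (1 - Q ^ Suc k)) * r (Suc k)))"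
        using YN by (intro sum.cong refl) (simp add: c_def Xs[symmetric])
      finally show ?thesis by simp
    qed
    have X_ext: "(\<Sum>k\<le>?n. X ?n k * f k) = (\<Sum>k\<le>?m. X ?n k * f k)" for f
      using qpoch_neg_power_zero[of ?n ?m] by (simp add: X_def)
    have xd: "x * d ?n = w ?n * (\<Sum>k\<le>?m. (X ?n k * (1 / (a * Q ^ k) + a * Q ^ k) - X ?m k / (1 - Y) * c k) * r k)"
    proof -
      have "x * d ?n = w ?n * (\<Sum>k\<le>?n. X ?n k * (x * r k))"
        by (simp add: d_def sum_distrib_left mult_ac del: sum.atMost_Suc)
      also have "(\<Sum>k\<le>?n. X ?n k * (x * r k)) = (\<Sum>k\<le>?n. X ?n k * ((1 / (a * Q ^ k) + a * Q ^ k) * r k))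
          - (\<Sum>k\<le>?n. X ?n k * (1 / (a * Q ^ Suc k) * ((1 - a * b * Q ^ k) * (1 - Q ^ Suc k)) * r (Suc k)))"
        unfolding xr by (simp only: right_diff_distrib sum_subtractf)
      also have "\<dots> = (\<Sum>k\<le>?m. (X ?n k * (1 / (a * Q ^ k) + a * Q ^ k) - X ?m k / (1 - Y) * c k) * r k)"
        unfolding shift X_ext by (simp only: left_diff_distrib sum_subtractf mult.assoc)
      finally show ?thesis .
    qed
    have "(1 - a * b * N) * (1 - Q * N) * d ?m + (a + b) * N * d ?n - x * d ?n + d n
      = (\<Sum>k\<le>?m. w ?n * (((1 - a * b * N) / a * X ?m k + (a + b) * N * X ?n k
            - (X ?n k * (1 / (a * Q ^ k) + a * Q ^ k) - X ?m k / (1 - Y) * c k)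
            - a * (N - Q ^ k) * X ?n k) * r k))"
    proof -
      have lin: "v * (A * z) + v * (B * z) - v * (C * z) + v * (- a * D * E * z) = v * ((A + B - C - a * D * E) * z)"
        for v A B C D E z by (simp add: algebra_simps)
      have t1: "(1 - a * b * N) * (1 - Q * N) * d ?m = (\<Sum>k\<le>?m. w ?n * ((1 - a * b * N) / a * X ?m k * r k))"
        unfolding d_def sum_distrib_left wn(1)[symmetric] using a
        by (intro sum.cong refl) simp
      have t2: "(a + b) * N * d ?n = (\<Sum>k\<le>?m. w ?n * ((a + b) * N * X ?n k * r k))"
        using ext[of ?n ?m] by (simp add: sum_distrib_left mult_ac del: sum.atMost_Suc)
      have t3: "d n = (\<Sum>k\<le>?m. w ?n * (- a * (N - Q ^ k) * X ?n k * r k))"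
      proof -
        have "d n = (\<Sum>k\<le>?m. w n * X n k * r k)"
          using ext[of n ?m] by (simp add: sum_distrib_left mult.assoc del: sum.atMost_Suc)
        then show ?thesis unfolding low by (simp add: mult_ac del: sum.atMost_Suc)
      qed
      show ?thesis
        unfolding t1 t2 t3 xd sum_distrib_left sum.distrib[symmetric] sum_subtractf[symmetric]
        by (simp only: lin)
    qed
    also have "\<dots> = 0"
    proof (rule sum.neutral, intro ballI)
      fix k
      define z where "z = Q ^ k"
      have z: "z \<noteq> 0" by (simp add: z_def)
      have Xnk: "X ?n k = X ?m k * ((1 - Y * z) / (1 - Y))"
        using Xn[of k] YN by (simp add: z_def field_simps)
      \<comment> \<open>With the common factor \<open>X ?m k\<close> taken out, a rational identity
        in \<open>z = q^k\<close> is left. Its numerator is a multiple of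
        \<open>N * Y - 1 / Q\<close>, which is 0 by the definition of \<open>Y\<close>.\<close>
      have key: "(1 - a * b * N) / a + ((a + b) * N - (1 / (a * z) + a * z) - a * (N - z)) * ((1 - Y * z) / (1 - Y))
         + (1 / (a * z)) * ((1 - a * b * z / Q) * (1 - z)) / (1 - Y) = 0"
      proof -
        have frac: "A / a + B / (a * z) * (D / y) + 1 / (a * z) * E / y = (A * z * y + B * D + E) / (a * z * y)"
          if "y \<noteq> 0" for A B D E y
          using a z that by (simp add: add_divide_distrib)
        have NY: "N * Y = 1 / Q" using \<open>N \<noteq> 0\<close> by (simp add: Y(1))
        have "(a + b) * N - (1 / (a * z) + a * z) - a * (N - z) = b * N - 1 / (a * z)"
          by (simp add: algebra_simps)
        also have "\<dots> = (a * b * N * z - 1) / (a * z)" using a z by (simp add: diff_divide_distrib)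
        finally have mid: "(a + b) * N - (1 / (a * z) + a * z) - a * (N - z) = (a * b * N * z - 1) / (a * z)" .
        have "(1 - a * b * N) * z * (1 - Y) + (a * b * N * z - 1) * (1 - Y * z) + (1 - a * b * z / Q) * (1 - z)
            = a * b * z * (1 - z) * (N * Y - 1 / Q)"
          by (simp add: algebra_simps diff_divide_distrib)
        then show ?thesis unfolding mid frac[OF YN] by (simp add: NY)
      qed
      have "(1 - a * b * N) / a * X ?m k + (a + b) * N * X ?n k
            - (X ?n k * (1 / (a * Q ^ k) + a * Q ^ k) - X ?m k / (1 - Y) * c k)
            - a * (N - Q ^ k) * X ?n k
          = X ?m k * ((1 - a * b * N) / a + ((a + b) * N - (1 / (a * z) + a * z) - a * (N - z)) * ((1 - Y * z) / (1 - Y))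
         + (1 / (a * z)) * ((1 - a * b * z / Q) * (1 - z)) / (1 - Y))"
      proof -
        have "A * v + B * (v * h) - (v * h * C - v / e * c) - D * (v * h) = v * (A + (B - C - D) * h + c / e)"
          for A B C D v h c e :: complex by (simp add: algebra_simps)
        then show ?thesis unfolding Xnk c_def z_def[symmetric] .
      qed
      also have "\<dots> = 0" unfolding key by simp
      finally show "w ?n * (((1 - a * b * N) / a * X ?m k + (a + b) * N * X ?n k
            - (X ?n k * (1 / (a * Q ^ k) + a * Q ^ k) - X ?m k / (1 - Y) * c k)
            - a * (N - Q ^ k) * X ?n k) * r k) = 0" by simp
    qed
    finally show "(1 - a * b * Q ^ Suc n) * (1 - Q ^ Suc (Suc n)) * d (Suc (Suc n))
      + ((a + b) * Q ^ Suc n - u - 1 / u) * d (Suc n) + d n = 0"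
      by (simp add: N_def x_def algebra_simps)
  qed
  moreover have "(\<Sum>k\<le>n. qpoch (1 / Q ^ n) Q k * qpoch (a * u) Q k * qpoch (a / u) Q k / qpoch (a * b) Q k * (Q ^ k / qpoch Q Q k))
      = a ^ n * qpoch Q Q n * d n"
    using a by (simp add: d_def w_def X_def r_def mult_ac)
  ultimately show ?thesis by simp
qed


text \<open>For \<open>a \<noteq> 0\<close> the definition is the terminating series just evaluated;
  for \<open>a = b = 0\<close> it is the \<open>q\<close>-Hermite sum, which is already a
  convolution. The second hypothesis excludes \<open>a = 0 \<noteq> b\<close>, where the definition
  has no meaning.\<close>

lemma al_salam_chihara_conv_asc:
  assumes ab: "norm (a * b) < 1" and "a = 0 \<Longrightarrow> b = 0"
  shows "al_salam_chihara n \<xi> a b q = qpoch (a * b) Q n * qpoch Q Q n * asc a b (cis (arccos \<xi>)) n"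
proof (cases "a = 0")
  case False
  let ?u = "cis (arccos \<xi>)"
  have "al_salam_chihara n \<xi> a b q = qpoch (a * b) Q n / a ^ n *
      (\<Sum>k\<le>n. qpoch (1 / Q ^ n) Q k * qpoch (a * ?u) Q k * qpoch (a / ?u) Q k / qpoch (a * b) Q k * (Q ^ k / qpoch Q Q k))"
    using False by (simp add: al_salam_chihara_def Let_def power_int_minus divide_inverse)
  also have "\<dots> = qpoch (a * b) Q n / a ^ n * (a ^ n * qpoch Q Q n * asc a b ?u n)"
    by (subst terminating_asc[OF False _ ab]) simp_all
  finally show ?thesis using False by simp
next
  case True
  then have b: "b = 0" using assms by simp
  let ?\<theta> = "arccos \<xi>"
  have "al_salam_chihara n \<xi> a b q = (\<Sum>k\<le>n. of_real (qbinom q n k) * cis ((real n - 2 * real k) * ?\<theta>))"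
    by (simp add: al_salam_chihara_def continuous_q_Hermite_def True b)
  \<comment> \<open>The exponent \<open>n - 2 k\<close> of the definition decreases with
    \<open>k\<close>, while in \<open>asc\<close> it is \<open>2 k - n\<close>; hence the
    reversal.\<close>
  also have "\<dots> = (\<Sum>k\<le>n. of_real (qbinom q n (n - k)) * cis ((real n - 2 * real (n - k)) * ?\<theta>))"
    by (rule sum.reindex_bij_witness[of _ "\<lambda>k. n - k" "\<lambda>k. n - k"]) auto
  also have "\<dots> = (\<Sum>k\<le>n. qpoch Q Q n * (1 / qpoch Q Q k * cis ?\<theta> ^ k * (1 / (cis ?\<theta> ^ (n - k) * qpoch Q Q (n - k)))))"
  proof (rule sum.cong)
    fix k assume k: "k \<in> {..n}"
    have "cis ((real n - 2 * real (n - k)) * ?\<theta>) = cis (real k * ?\<theta>) / cis (real (n - k) * ?\<theta>)"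
      unfolding cis_divide by (rule arg_cong[of _ _ cis]) (use k in \<open>simp add: of_nat_diff algebra_simps\<close>)
    also have "\<dots> = cis ?\<theta> ^ k / cis ?\<theta> ^ (n - k)" by (simp add: Complex.DeMoivre)
    finally show "of_real (qbinom q n (n - k)) * cis ((real n - 2 * real (n - k)) * ?\<theta>)
       = qpoch Q Q n * (1 / qpoch Q Q k * cis ?\<theta> ^ k * (1 / (cis ?\<theta> ^ (n - k) * qpoch Q Q (n - k))))"
      using k by (simp add: qbinom_def qpoch_of_real[symmetric])
  qed simp
  finally show ?thesis by (simp add: True b asc_def sum_distrib_left)
qed

section \<open>Bounds on the unit circle and the generating function\<close>

text \<open>Bounds one summand of \<open>asc\<close> for \<open>|u| = 1\<close>: the numerators
  contribute \<open>(-1; q)_\<infinity>\<close> twice, the denominators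
  \<open>(|c|; q)_\<infinity>\<close> with \<open>c = a b\<close> and
  \<open>(q; q)_\<infinity>\<close> twice. A polynomial of degree \<open>n\<close> then grows at
  most linearly in \<open>n\<close>.\<close>

definition asc_const :: "complex \<Rightarrow> real" where
  "asc_const c = qpoch_inf (- 1) q ^ 2 / (qpoch_inf (cmod c) q * qpoch_inf q q ^ 2)"

lemma asc_coeff_bound:
  assumes u: "norm u = 1" and a: "norm a \<le> 1" and b: "norm b \<le> 1" and ab: "norm (a * b) < 1"
  shows "norm (qpoch (a / u) Q k * qpoch (b / u) Q k / (qpoch (a * b) Q k * qpoch Q Q k))
     \<le> qpoch_inf (- 1) q ^ 2 / (qpoch_inf (norm (a * b)) q * qpoch_inf q q)"
proof -
  have "norm (qpoch (a / u) Q k) \<le> qpoch_inf (- 1) q" "norm (qpoch (b / u) Q k) \<le> qpoch_inf (- 1) q"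
    by (intro norm_qpoch_le; simp add: norm_divide u a b)+
  then have num: "norm (qpoch (a / u) Q k * qpoch (b / u) Q k) \<le> qpoch_inf (- 1) q ^ 2"
    unfolding norm_mult power2_eq_square
    by (intro mult_mono) (auto intro!: less_imp_le[OF qpoch_inf_real_pos])
  have den: "qpoch_inf (norm (a * b)) q * qpoch_inf q q \<le> norm (qpoch (a * b) Q k * qpoch Q Q k)"
    unfolding norm_mult[of "qpoch _ _ _"]
    by (intro mult_mono norm_qpoch_ge less_imp_le[OF qpoch_inf_real_pos]) (use ab q_less_1 in auto)
  have pos: "0 < qpoch_inf (norm (a * b)) q * qpoch_inf q q"
    using ab q_less_1 by (intro mult_pos_pos qpoch_inf_real_pos) auto
  show ?thesis unfolding norm_divide
    by (intro frac_le num den pos) simp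
qed

lemma asc_bound:
  assumes u: "norm u = 1" and a: "norm a \<le> 1" and b: "norm b \<le> 1" and ab: "norm (a * b) < 1"
  shows "norm (asc a b u n) \<le> (real n + 1) * asc_const (a * b)"
proof -
  have qi: "0 < qpoch_inf q q" by (rule qpoch_inf_real_pos[OF q_less_1])
  have qc: "0 < qpoch_inf (norm (a * b)) q" using ab by (rule qpoch_inf_real_pos)
  have "norm (asc a b u n) \<le> (\<Sum>k\<le>n. asc_const (a * b))"
    unfolding asc_def
  proof (rule sum_norm_le)
    fix k
    have "qpoch_inf q q \<le> norm (qpoch Q Q (n - k))"
      by (rule norm_qpoch_ge) (simp_all add: q_less_1)
    then have "norm (1 / (u ^ (n - k) * qpoch Q Q (n - k))) \<le> 1 / qpoch_inf q q"
      using qi by (simp add: norm_divide norm_mult norm_power u frac_le)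
    then have "norm (qpoch (a / u) Q k * qpoch (b / u) Q k / (qpoch (a * b) Q k * qpoch Q Q k)) * norm (u ^ k) *
        norm (1 / (u ^ (n - k) * qpoch Q Q (n - k)))
        \<le> (qpoch_inf (- 1) q ^ 2 / (qpoch_inf (norm (a * b)) q * qpoch_inf q q)) * 1 * (1 / qpoch_inf q q)"
      using qi qc by (intro mult_mono asc_coeff_bound assms) (auto simp: norm_power u)
    then show "norm (qpoch (a / u) Q k * qpoch (b / u) Q k / (qpoch (a * b) Q k * qpoch Q Q k) * u ^ k *
        (1 / (u ^ (n - k) * qpoch Q Q (n - k)))) \<le> asc_const (a * b)"
      unfolding norm_mult[symmetric] by (simp add: asc_const_def power2_eq_square)
  qed
  then show ?thesis by (simp add: add.commute)
qed

lemma summable_of_nat_geometric: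
  fixes t :: real assumes "0 \<le> t" "t < 1" shows "summable (\<lambda>n. (real n + 1) * t ^ n)"
proof -
  have "summable (\<lambda>n. diffs (\<lambda>_. 1 :: real) n * t ^ n)"
    by (rule termdiff_converges[of t 1]) (use assms in \<open>auto intro: summable_geometric\<close>)
  then show ?thesis by (simp add: diffs_def add.commute)
qed

text \<open>Cauchy product of the basic hypergeometric series in \<open>t u\<close> with Euler's
  series for \<open>1 / (t / u; q)_\<infinity>\<close>. Both converge absolutely, the first because
  its coefficients are bounded in \<open>k\<close>.\<close>

lemma asc_sums:
  assumes u: "norm u = 1" and a: "norm a \<le> 1" and b: "norm b \<le> 1" and ab: "norm (a * b) < 1" and t: "norm t < 1"
  shows "(\<lambda>n. asc a b u n * t ^ n) sums (1 / qpoch_inf (t / u) Q * phi21 (a / u) (b / u) (a * b) Q (t * u))"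
proof -
  define g where "g k = qpoch (a / u) Q k * qpoch (b / u) Q k / qpoch (a * b) Q k * ((t * u) ^ k / qpoch Q Q k)" for k
  define e where "e k = (t / u) ^ k / qpoch Q Q k" for k
  have tu: "norm (t / u) < 1" using t u by (simp add: norm_divide)
  have sg: "summable (\<lambda>k. norm (g k))"
  proof (rule summable_comparison_test_ev)
    let ?B = "qpoch_inf (- 1) q ^ 2 / (qpoch_inf (norm (a * b)) q * qpoch_inf q q)"
    show "summable (\<lambda>k. ?B * norm t ^ k)" using t by (intro summable_mult summable_geometric) simp
    have "norm (norm (g k)) \<le> ?B * norm t ^ k" for k
    proof -
      have "norm (g k) = norm (qpoch (a / u) Q k * qpoch (b / u) Q k / (qpoch (a * b) Q k * qpoch Q Q k)) * norm t ^ k"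
        by (simp add: g_def norm_mult norm_divide norm_power u)
      also have "\<dots> \<le> ?B * norm t ^ k" by (intro mult_right_mono asc_coeff_bound assms) simp
      finally show ?thesis by simp
    qed
    then show "\<forall>\<^sub>F k in sequentially. norm (norm (g k)) \<le> ?B * norm t ^ k" by simp
  qed
  have "(\<lambda>n. \<Sum>k\<le>n. g k * e (n - k)) sums ((\<Sum>k. g k) * (\<Sum>k. e k))"
    using sg summable_euler[OF tu] unfolding e_def by (rule Cauchy_product_sums)
  moreover have "(\<Sum>k\<le>n. g k * e (n - k)) = asc a b u n * t ^ n" for n
    unfolding asc_def sum_distrib_right
  proof (rule sum.cong)
    fix k assume "k \<in> {..n}"
    then have "t ^ n = t ^ k * t ^ (n - k)" by (simp flip: power_add)
    then show "g k * e (n - k) = qpoch (a / u) Q k * qpoch (b / u) Q k / (qpoch (a * b) Q k * qpoch Q Q k) * u ^ k *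
        (1 / (u ^ (n - k) * qpoch Q Q (n - k))) * t ^ n"
      by (simp add: g_def e_def power_mult_distrib power_divide)
  qed simp
  moreover have "(\<Sum>k. e k) = 1 / qpoch_inf (t / u) Q"
    using euler_sums[OF tu] sums_unique unfolding e_def by metis
  moreover have "(\<Sum>k. g k) = phi21 (a / u) (b / u) (a * b) Q (t * u)"
    by (simp add: g_def phi21_def)
  ultimately show ?thesis by (simp add: mult.commute)
qed

section \<open>The \<open>q\<close>-binomial theorem and the finite Jacobi triple product\<close>

definition qb :: "nat \<Rightarrow> nat \<Rightarrow> complex" where
  "qb n k = qpoch Q Q n / (qpoch Q Q k * qpoch Q Q (n - k))"

text \<open>The \<open>q\<close>-Pascal rule in the form that matches multiplication by the last
  factor \<open>1 - y q^n\<close>. The bound on \<open>k\<close> is strict because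
  \<open>qb n (Suc n)\<close> is not 0: its truncated difference \<open>n - Suc n\<close> is
  0.\<close>

lemma qb_Suc_Suc:
  assumes "k < n" shows "qb (Suc n) (Suc k) = qb n (Suc k) + Q ^ (n - k) * qb n k"
proof -
  obtain m where n: "n = Suc (k + m)" using assms less_imp_Suc_add by blast
  have nz: "1 - Q ^ Suc j \<noteq> 0" for j by (rule Q_power_neq_1)
  define x y P A B where "x = Q ^ Suc k" and "y = Q ^ Suc m" and "P = qpoch Q Q n" and "A = qpoch Q Q k" and "B = qpoch Q Q m"
  have *: "1 - x \<noteq> 0" "1 - y \<noteq> 0" "A \<noteq> 0" "B \<noteq> 0" using nz by (simp_all add: x_def y_def A_def B_def)
  have "qb (Suc n) (Suc k) = P * (1 - x * y) / ((A * (1 - x)) * (B * (1 - y)))"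
    unfolding qb_def by (simp add: qpoch_Suc n x_def y_def P_def A_def B_def power_add)
  moreover have "qb n (Suc k) = P / ((A * (1 - x)) * B)"
    unfolding qb_def by (simp add: qpoch_Suc n x_def y_def P_def A_def B_def power_add)
  moreover have "qb n k = P / (A * (B * (1 - y)))"
    unfolding qb_def by (simp add: qpoch_Suc n x_def y_def P_def A_def B_def power_add)
  moreover have "Q ^ (n - k) = y" by (simp add: n y_def)
  moreover have "P * (1 - x * y) / ((A * (1 - x)) * (B * (1 - y))) = P / ((A * (1 - x)) * B) + y * (P / (A * (B * (1 - y))))"
  proof -
    have "P / ((A * (1 - x)) * B) = P * (1 - y) / ((A * (1 - x)) * (B * (1 - y)))" using * by simp
    moreover have "y * (P / (A * (B * (1 - y)))) = P * (y * (1 - x)) / ((A * (1 - x)) * (B * (1 - y)))" using * by simp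
    ultimately show ?thesis by (simp add: add_divide_distrib[symmetric] algebra_simps)
  qed
  ultimately show ?thesis by simp
qed

lemma qb_edge [simp]: "qb n 0 = 1" "qb n n = 1"
  by (simp_all add: qb_def)

lemma choose_two_Suc: "Suc n choose 2 = n + (n choose 2)"
  by (simp add: numeral_2_eq_2)

lemma q_binomial_theorem:
  "qpoch y Q n = (\<Sum>j\<le>n. qb n j * (- 1) ^ j * Q ^ (j choose 2) * y ^ j)"
proof (induction n)
  case (Suc n)
  define c where "c j = (- 1) ^ j * Q ^ (j choose 2) * y ^ j" for j
  have c_Suc: "c (Suc j) = - (Q ^ j * y * c j)" for j
    by (simp add: c_def choose_two_Suc power_add)
  have "qpoch y Q (Suc n) = (\<Sum>j\<le>n. qb n j * c j) * (1 - y * Q ^ n)"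
    using Suc by (simp add: qpoch_Suc c_def mult_ac)
  also have "\<dots> = (\<Sum>j\<le>n. qb n j * c j) + (\<Sum>j\<le>n. Q ^ (n - j) * qb n j * c (Suc j))"
  proof -
    have "(\<Sum>j\<le>n. Q ^ (n - j) * qb n j * c (Suc j)) = (\<Sum>j\<le>n. - (y * Q ^ n) * (qb n j * c j))"
    proof (rule sum.cong)
      fix j assume "j \<in> {..n}"
      then have "Q ^ n = Q ^ (n - j) * Q ^ j" by (simp flip: power_add)
      then show "Q ^ (n - j) * qb n j * c (Suc j) = - (y * Q ^ n) * (qb n j * c j)"
        by (simp add: c_Suc)
    qed simp
    also have "\<dots> = - (y * Q ^ n) * (\<Sum>j\<le>n. qb n j * c j)" by (simp only: sum_distrib_left)
    finally show ?thesis by (simp only:) (simp add: right_diff_distrib)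
  qed
  \<comment> \<open>The end terms are separated first, since the \<open>q\<close>-Pascal rule fails
    at \<open>j = n\<close>.\<close>
  also have "(\<Sum>j\<le>n. qb n j * c j) = 1 + (\<Sum>j<n. qb n (Suc j) * c (Suc j))"
    by (subst lessThan_Suc_atMost[symmetric], subst sum.lessThan_Suc_shift) (simp add: c_def numeral_2_eq_2)
  also have "(\<Sum>j\<le>n. Q ^ (n - j) * qb n j * c (Suc j)) = (\<Sum>j<n. Q ^ (n - j) * qb n j * c (Suc j)) + c (Suc n)"
    by (subst lessThan_Suc_atMost[symmetric], subst sum.lessThan_Suc) simp
  also have "1 + (\<Sum>j<n. qb n (Suc j) * c (Suc j)) + ((\<Sum>j<n. Q ^ (n - j) * qb n j * c (Suc j)) + c (Suc n))
      = 1 + (\<Sum>j<n. qb (Suc n) (Suc j) * c (Suc j)) + c (Suc n)"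
    by (simp add: qb_Suc_Suc distrib_right sum.distrib)
  also have "\<dots> = (\<Sum>j\<le>Suc n. qb (Suc n) j * c j)"
    by (subst sum.atMost_Suc_shift, subst lessThan_Suc_atMost[symmetric], subst sum.lessThan_Suc) (simp add: c_def numeral_2_eq_2)
  finally show ?case by (simp add: c_def mult_ac)
qed (simp add: numeral_2_eq_2)

text \<open>The triangular number of an integer. It is nonnegative for negative \<open>k\<close>
  too, so it can be a natural exponent of \<open>Q\<close>.\<close>

definition tri :: "int \<Rightarrow> nat" where
  "tri k = nat (k * (k + 1) div 2)"

lemma tri_real: "real (tri k) = real_of_int (k * (k + 1)) / 2"
proof -
  have "0 \<le> k * (k + 1)" by (cases "0 \<le> k") (auto intro: mult_nonneg_nonneg mult_nonpos_nonpos)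
  then show ?thesis by (simp add: tri_def real_of_int_div)
qed

lemma tri_reflect: "tri (- k - 1) = tri k"
  by (simp add: tri_def algebra_simps)

text \<open>Used to compare exponents as real numbers, where the halves in \<open>tri\<close> and in
  the binomial coefficients are ordinary divisions.\<close>

lemma power_eqI: "real m = real n \<Longrightarrow> x ^ m = x ^ n"
  by simp

definition parity_sign :: "int \<Rightarrow> complex" where
  "parity_sign k = (if even k then 1 else - 1)"

text \<open>The \<open>q\<close>-binomial theorem with \<open>2 N\<close> factors at
  \<open>y = x q^(1-N)\<close>. The last \<open>N\<close> factors form \<open>(q x; q)_N\<close>;
  the first \<open>N\<close>, in reverse order, are
  \<open>1 - x / q^i = - (x / q^i) (1 - q^i / x)\<close> and give \<open>(1 / x; q)_N\<close> up to
  a power.\<close>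

lemma jacobi_triple_product_finite:
  assumes x: "x \<noteq> 0"
  shows "qpoch (Q * x) Q N * qpoch (1 / x) Q N
    = (\<Sum>j\<le>2 * N. qb (2 * N) j * parity_sign (int j - int N) * Q ^ tri (int j - int N) * (x ^ j / x ^ N))"
proof -
  define y where "y = x * Q / Q ^ N"
  have rev: "qpoch y Q N * Q ^ (N choose 2) = (- x) ^ N * qpoch (1 / x) Q N"
  proof -
    have "qpoch y Q N = (\<Prod>i<N. 1 - y * Q ^ (N - Suc i))"
      unfolding qpoch_def by (rule prod.nat_diff_reindex[symmetric])
    also have "\<dots> = (\<Prod>i<N. 1 - x / Q ^ i)"
    proof (rule prod.cong)
      fix i assume "i \<in> {..<N}"
      then have "Q ^ N = Q ^ (N - Suc i) * Q * Q ^ i"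
        by (simp flip: power_add power_Suc power_Suc2)
      then show "1 - y * Q ^ (N - Suc i) = 1 - x / Q ^ i" by (simp add: y_def)
    qed simp
    also have "\<dots> * Q ^ (N choose 2) = (- x) ^ N * qpoch (1 / x) Q N"
    proof (induction N)
      case (Suc N)
      have "(1 - x / Q ^ N) * Q ^ N = - x * (1 - 1 / x * Q ^ N)" using x by (simp add: field_simps)
      moreover have "(\<Prod>i<Suc N. 1 - x / Q ^ i) * Q ^ (Suc N choose 2)
          = ((\<Prod>i<N. 1 - x / Q ^ i) * Q ^ (N choose 2)) * ((1 - x / Q ^ N) * Q ^ N)"
        by (simp add: choose_two_Suc power_add)
      ultimately show ?case using Suc by (simp add: qpoch_Suc)
    qed (simp add: numeral_2_eq_2)
    finally show ?thesis .
  qed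
  have "qpoch y Q (2 * N) = qpoch y Q N * qpoch (Q * x) Q N"
    using qpoch_add[of y Q N N] by (simp add: y_def mult_2[symmetric] mult.commute)
  then have "qpoch y Q (2 * N) * Q ^ (N choose 2) = (- x) ^ N * (qpoch (Q * x) Q N * qpoch (1 / x) Q N)"
    using rev by (simp add: mult_ac)
  then have "qpoch (Q * x) Q N * qpoch (1 / x) Q N = qpoch y Q (2 * N) * Q ^ (N choose 2) / (- x) ^ N"
    using x by simp
  also have "\<dots> = (\<Sum>j\<le>2 * N. qb (2 * N) j * (- 1) ^ j * Q ^ (j choose 2) * y ^ j * Q ^ (N choose 2) / (- x) ^ N)"
    unfolding q_binomial_theorem by (simp add: sum_distrib_right sum_divide_distrib)
  also have "\<dots> = (\<Sum>j\<le>2 * N. qb (2 * N) j * parity_sign (int j - int N) * Q ^ tri (int j - int N) * (x ^ j / x ^ N))"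
  proof (rule sum.cong)
    fix j
    have eq: "Q ^ ((j choose 2) + j + (N choose 2)) = Q ^ (tri (int j - int N) + N * j)"
    proof (rule power_eqI)
      have ch: "real (n choose 2) = real n * (real n - 1) / 2" for n
        by (induction n) (simp_all add: choose_two_Suc field_simps numeral_2_eq_2)
      have "x * (x - 1) / 2 + x + y * (y - 1) / 2 = (x - y) * (x - y + 1) / 2 + y * x" for x y :: real
        by (simp add: field_simps)
      from this[of "real j" "real N"]
      show "real ((j choose 2) + j + (N choose 2)) = real (tri (int j - int N) + N * j)"
        by (simp only: of_nat_add of_nat_mult ch tri_real of_int_mult of_int_diff of_int_add of_int_of_nat_eq of_int_1)
    qed
    have exps: "Q ^ (j choose 2) * y ^ j * Q ^ (N choose 2) = Q ^ tri (int j - int N) * x ^ j"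
    proof -
      have "Q ^ (j choose 2) * y ^ j * Q ^ (N choose 2) = Q ^ ((j choose 2) + j + (N choose 2)) * x ^ j / Q ^ (N * j)"
        by (simp add: y_def power_divide power_mult_distrib power_add power_mult)
      also have "\<dots> = Q ^ tri (int j - int N) * x ^ j" unfolding eq by (simp add: power_add)
      finally show ?thesis .
    qed
    have "(- 1) ^ j / (- x) ^ N = parity_sign (int j - int N) / x ^ N"
      by (auto simp: parity_sign_def power_minus[of x] minus_one_power_iff)
    moreover have "qb (2 * N) j * (- 1) ^ j * Q ^ (j choose 2) * y ^ j * Q ^ (N choose 2) / (- x) ^ N
        = qb (2 * N) j * (Q ^ (j choose 2) * y ^ j * Q ^ (N choose 2)) * ((- 1) ^ j / (- x) ^ N)"
      by (simp only: mult_ac times_divide_eq_right times_divide_eq_left)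
    ultimately show "qb (2 * N) j * (- 1) ^ j * Q ^ (j choose 2) * y ^ j * Q ^ (N choose 2) / (- x) ^ N
       = qb (2 * N) j * parity_sign (int j - int N) * Q ^ tri (int j - int N) * (x ^ j / x ^ N)"
      unfolding exps by simp
  qed simp
  finally show ?thesis .
qed

end

section \<open>Orthogonality\<close>

lemma integral_cis_of_int:
  "integral {-pi..pi} (\<lambda>\<theta>. cis (of_int p * \<theta>)) = (if p = 0 then of_real (2 * pi) else 0)"
proof (cases "p = 0")
  case False
  define F where "F \<theta> = cis (of_int p * \<theta>) / (\<i> * of_int p)" for \<theta>
  have "((\<lambda>\<theta>. cis (of_int p * \<theta>)) has_integral F pi - F (- pi)) {-pi..pi}"
  proof (rule fundamental_theorem_of_calculus)
    fix x
    have "((\<lambda>\<theta>. cis (of_int p * \<theta>)) has_vector_derivative (of_int p *\<^sub>R (\<i> * cis (of_int p * x)))) (at x within {-pi..pi})"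
      unfolding has_vector_derivative_def
      by (auto intro!: derivative_eq_intros ext simp: scaleR_conv_of_real)
    from has_vector_derivative_divide[OF this, of "\<i> * of_int p"]
    show "(F has_vector_derivative cis (of_int p * x)) (at x within {-pi..pi})"
      using False by (simp add: F_def[abs_def] scaleR_conv_of_real)
  qed simp
  moreover have "F pi = F (- pi)"
    by (simp add: F_def cis.code sin_integer_2pi complex_eq_iff) (simp add: mult.commute)
  ultimately show ?thesis using False by (simp add: integral_unique)
qed (simp add: scaleR_conv_of_real)

context q_parameter begin

section \<open>Moments of the continuous \<open>q\<close>-Hermite weight\<close>

text \<open>The triple product at \<open>x = e^(2 i \<theta>)\<close>. The Hermite weight,
  \<open>|(e^(2 i \<theta>); q)_\<infinity>|^2\<close>, has one more factor
  \<open>1 - e^(2 i \<theta>)\<close>, so its Fourier coefficients are differences of those of this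
  theta product.\<close>

definition theta_part :: "real \<Rightarrow> complex" where
  "theta_part \<theta> = qpoch_inf (Q * cis (2 * \<theta>)) Q * qpoch_inf (cis (- 2 * \<theta>)) Q"

definition hermite_weight :: "real \<Rightarrow> complex" where
  "hermite_weight \<theta> = qpoch_inf (cis (2 * \<theta>)) Q * qpoch_inf (cis (- 2 * \<theta>)) Q"

lemma hermite_weight_theta_part: "hermite_weight \<theta> = (1 - cis (2 * \<theta>)) * theta_part \<theta>"
  using qpoch_inf_split[of "cis (2 * \<theta>)" 1]
  by (simp add: hermite_weight_def theta_part_def qpoch_Suc mult_ac)

lemma continuous_theta_part [continuous_intros]: "continuous_on S theta_part"
  unfolding theta_part_def by (intro continuous_intros)

lemma continuous_hermite_weight [continuous_intros]: "continuous_on S hermite_weight"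
  unfolding hermite_weight_def by (intro continuous_intros)

lemma qb_tendsto: "(\<lambda>N. qb (2 * N) (nat (int N - m))) \<longlonglongrightarrow> 1 / qpoch_inf Q Q"
proof -
  have lim: "filterlim (\<lambda>N. nat (int N + k)) sequentially sequentially" for k
  proof (rule filterlim_at_top[THEN iffD2], intro allI)
    fix Z :: nat
    show "\<forall>\<^sub>F N in sequentially. Z \<le> nat (int N + k)"
      using eventually_ge_at_top[of "Z + nat \<bar>k\<bar>"] by eventually_elim (simp add: le_nat_iff)
  qed
  have T: "(\<lambda>N. qpoch Q Q (nat (int N + k))) \<longlonglongrightarrow> qpoch_inf Q Q" for k
    by (rule filterlim_compose[OF qpoch_tendsto lim])
  have T2: "(\<lambda>N. qpoch Q Q (2 * N)) \<longlonglongrightarrow> qpoch_inf Q Q"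
    by (rule filterlim_compose[OF qpoch_tendsto]) (rule filterlim_subseq, auto simp: strict_mono_def)
  have nz: "qpoch_inf Q Q \<noteq> 0" by (rule qpoch_inf_nonzero) (simp add: q_less_1)
  have "(\<lambda>N. qpoch Q Q (2 * N) / (qpoch Q Q (nat (int N + (- m))) * qpoch Q Q (nat (int N + m))))
     \<longlonglongrightarrow> qpoch_inf Q Q / (qpoch_inf Q Q * qpoch_inf Q Q)"
    by (rule tendsto_divide[OF T2 tendsto_mult[OF T T]]) (simp add: nz)
  moreover have "\<forall>\<^sub>F N in sequentially. qpoch Q Q (2 * N) / (qpoch Q Q (nat (int N + (- m))) * qpoch Q Q (nat (int N + m)))
      = qb (2 * N) (nat (int N - m))"
    using eventually_ge_at_top[of "nat \<bar>m\<bar>"]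
  proof eventually_elim
    case (elim N)
    have "0 \<le> int N - m" "0 \<le> int N + m" using elim by (simp_all add: nat_le_iff)
    then obtain A B where AB: "int N - m = int A" "int N + m = int B"
      by (metis nonneg_int_cases)
    then have "int (2 * N) = int (A + B)" by simp
    then have "2 * N = A + B" by (simp only: of_nat_eq_iff)
    moreover have "nat (int N - m) = A" "nat (int N + m) = B" by (simp_all only: AB nat_int)
    ultimately show ?case by (simp add: qb_def)
  qed
  ultimately have "(\<lambda>N. qb (2 * N) (nat (int N - m))) \<longlonglongrightarrow> qpoch_inf Q Q / (qpoch_inf Q Q * qpoch_inf Q Q)"
    by (rule Lim_transform_eventually)
  then show ?thesis using nz by simp
qed

text \<open>The finite triple product is a trigonometric polynomial, of which integration keeps only
  the term with \<open>p + 2 (j - N) = 0\<close>. The passage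
  \<open>N \<rightarrow> \<infinity>\<close> is done after integrating, so no infinite Fourier
  series has to be summed.\<close>

lemma integral_cis_theta_part:
  "integral {-pi..pi} (\<lambda>\<theta>. cis (of_int p * \<theta>) * theta_part \<theta>) =
    (if even p then of_real (2 * pi) * parity_sign (p div 2) * Q ^ tri (- (p div 2)) / qpoch_inf Q Q else 0)"
    (is "?I = ?R")
proof -
  define V where "V N \<theta> = qpoch (Q * cis (2 * \<theta>)) Q N * qpoch (1 / cis (2 * \<theta>)) Q N" for N \<theta>
  define \<kappa> where "\<kappa> N j = qb (2 * N) j * parity_sign (int j - int N) * Q ^ tri (int j - int N)" for N j
  have V: "V N \<theta> = (\<Sum>j\<le>2 * N. \<kappa> N j * cis (of_int (2 * (int j - int N)) * \<theta>))" for N \<theta>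
  proof -
    have "cis (2 * \<theta>) ^ j / cis (2 * \<theta>) ^ N = cis (of_int (2 * (int j - int N)) * \<theta>)" for j
      by (simp add: Complex.DeMoivre cis_divide algebra_simps)
    then show ?thesis unfolding V_def \<kappa>_def by (subst jacobi_triple_product_finite) simp_all
  qed
  have int: "integral {-pi..pi} (\<lambda>\<theta>. cis (of_int p * \<theta>) * V N \<theta>)
     = (\<Sum>j\<le>2 * N. if p + 2 * (int j - int N) = 0 then of_real (2 * pi) * \<kappa> N j else 0)" for N
  proof -
    have "integral {-pi..pi} (\<lambda>\<theta>. cis (of_int p * \<theta>) * V N \<theta>)
        = integral {-pi..pi} (\<lambda>\<theta>. \<Sum>j\<le>2 * N. \<kappa> N j * cis (of_int (p + 2 * (int j - int N)) * \<theta>))"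
      unfolding V sum_distrib_left
      by (intro integral_cong sum.cong refl) (simp add: cis_mult algebra_simps)
    also have "\<dots> = (\<Sum>j\<le>2 * N. integral {-pi..pi} (\<lambda>\<theta>. \<kappa> N j * cis (of_int (p + 2 * (int j - int N)) * \<theta>)))"
      by (rule integral_sum) (auto intro!: integrable_continuous_interval continuous_intros)
    finally show ?thesis
      by (simp only: integral_mult_right integral_cis_of_int) (simp add: if_distrib mult.commute cong: if_cong)
  qed
  have lim: "(\<lambda>N. integral {-pi..pi} (\<lambda>\<theta>. cis (of_int p * \<theta>) * V N \<theta>)) \<longlonglongrightarrow> ?I"
  proof (rule dominated_convergence(2))
    show "(\<lambda>\<theta>. cis (of_int p * \<theta>) * V N \<theta>) integrable_on {-pi..pi}" for N
      unfolding V by (intro integrable_continuous_interval continuous_intros)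
    show "(\<lambda>_. qpoch_inf (- 1) q * qpoch_inf (- 1) q) integrable_on {-pi..pi}" by (rule integrable_const_ivl)
    show "norm (cis (of_int p * \<theta>) * V N \<theta>) \<le> qpoch_inf (- 1) q * qpoch_inf (- 1) q" for N \<theta>
      unfolding V_def norm_mult
      using q_less_1 by (simp, intro mult_mono norm_qpoch_le)
        (auto simp: norm_mult norm_divide intro!: less_imp_le[OF qpoch_inf_real_pos])
    show "(\<lambda>N. cis (of_int p * \<theta>) * V N \<theta>) \<longlonglongrightarrow> cis (of_int p * \<theta>) * theta_part \<theta>" for \<theta>
      unfolding V_def theta_part_def using cis_divide[of 0 "2 * \<theta>"]
      by (intro tendsto_intros) (use qpoch_tendsto in \<open>auto simp: \<close>)
  qed
  have "(\<lambda>N. integral {-pi..pi} (\<lambda>\<theta>. cis (of_int p * \<theta>) * V N \<theta>)) \<longlonglongrightarrow> ?R"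
  proof (cases "even p")
    case False
    then have "(p + 2 * k = 0) = False" for k by presburger
    then show ?thesis using False by (simp only: int if_False sum.neutral_const tendsto_const)
  next
    case True
    then obtain m where m: "p = 2 * m" by blast
    have "\<forall>\<^sub>F N in sequentially. of_real (2 * pi) * (qb (2 * N) (nat (int N - m)) * parity_sign m * Q ^ tri (- m))
        = integral {-pi..pi} (\<lambda>\<theta>. cis (of_int p * \<theta>) * V N \<theta>)"
      using eventually_ge_at_top[of "nat \<bar>m\<bar>"]
    proof eventually_elim
      case (elim N)
      define j where "j = nat (int N - m)"
      have j: "int j = int N - m" "j \<le> 2 * N" using elim by (auto simp: j_def)
      have eq: "p + 2 * (int i - int N) = 0 \<longleftrightarrow> i = j" for i
        using j(1) by (auto simp: m)
      have "parity_sign (int j - int N) = parity_sign m" by (simp add: j parity_sign_def)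
      then show ?case unfolding int eq using j(2) by (simp add: \<kappa>_def j(1)) (simp add: j_def)
    qed
    moreover have "(\<lambda>N. of_real (2 * pi) * (qb (2 * N) (nat (int N - m)) * parity_sign m * Q ^ tri (- m)))
        \<longlonglongrightarrow> of_real (2 * pi) * (1 / qpoch_inf Q Q * parity_sign m * Q ^ tri (- m))"
      by (intro tendsto_intros qb_tendsto)
    ultimately have "(\<lambda>N. integral {-pi..pi} (\<lambda>\<theta>. cis (of_int p * \<theta>) * V N \<theta>))
        \<longlonglongrightarrow> of_real (2 * pi) * (1 / qpoch_inf Q Q * parity_sign m * Q ^ tri (- m))"
      by (rule Lim_transform_eventually[rotated])
    then show ?thesis by (simp add: m mult.assoc)
  qed
  then show ?thesis using lim LIMSEQ_unique by blast
qed

definition hermite_moment :: "int \<Rightarrow> complex" where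
  "hermite_moment p = integral {-pi..pi} (\<lambda>\<theta>. cis (of_int p * \<theta>) * hermite_weight \<theta>)"

text \<open>Difference of the theta coefficients at \<open>p\<close> and \<open>p + 2\<close>. Their
  signs are opposite, so the two powers add, and \<open>tri (- m - 1) = tri m\<close> gives the
  symmetric form.\<close>

lemma hermite_moment_even:
  "hermite_moment (2 * m) = of_real (2 * pi) * parity_sign m * (Q ^ tri (- m) + Q ^ tri m) / qpoch_inf Q Q"
  and hermite_moment_odd: "odd p \<Longrightarrow> hermite_moment p = 0"
proof -
  have split: "hermite_moment p = integral {-pi..pi} (\<lambda>\<theta>. cis (of_int p * \<theta>) * theta_part \<theta>)
     - integral {-pi..pi} (\<lambda>\<theta>. cis (of_int (p + 2) * \<theta>) * theta_part \<theta>)" for p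
  proof -
    have cis2: "cis (of_int (p + 2) * \<theta>) = cis (of_int p * \<theta>) * cis (2 * \<theta>)" for \<theta>
      by (simp add: cis_mult distrib_right)
    have "hermite_moment p = integral {-pi..pi} (\<lambda>\<theta>. cis (of_int p * \<theta>) * theta_part \<theta> - cis (of_int (p + 2) * \<theta>) * theta_part \<theta>)"
      unfolding hermite_moment_def hermite_weight_theta_part cis2
      by (intro integral_cong) (simp add: right_diff_distrib left_diff_distrib mult.assoc)
    also have "\<dots> = integral {-pi..pi} (\<lambda>\<theta>. cis (of_int p * \<theta>) * theta_part \<theta>)
     - integral {-pi..pi} (\<lambda>\<theta>. cis (of_int (p + 2) * \<theta>) * theta_part \<theta>)"
      by (intro integral_diff integrable_continuous_interval continuous_intros)
    finally show ?thesis .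
  qed
  have div: "2 * m + 2 = 2 * (m + 1)" "(2 * k) div 2 = k" for k :: int by simp_all
  have tri: "tri (- (m + 1)) = tri m" using tri_reflect[of m] by (simp only: minus_add_distrib diff_conv_add_uminus)
  have sign: "parity_sign (m + 1) = - parity_sign m" by (simp add: parity_sign_def)
  have "c * s * x / d - c * - s * y / d = c * s * (x + y) / d" for c s x y d :: complex
    by (simp add: add_divide_distrib distrib_left)
  then show "hermite_moment (2 * m) = of_real (2 * pi) * parity_sign m * (Q ^ tri (- m) + Q ^ tri m) / qpoch_inf Q Q"
    unfolding split integral_cis_theta_part div tri sign if_P[OF dvd_triv_left] by this
  show "odd p \<Longrightarrow> hermite_moment p = 0"
    unfolding split integral_cis_theta_part by simp
qed

lemma asc_continuous [continuous_intros]: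
  "continuous_on S (\<lambda>\<theta>. asc a b (cis \<theta>) n)"
proof -
  have "continuous_on S (\<lambda>\<theta>. qpoch (c / cis \<theta>) Q k)" for c k
    unfolding qpoch_def
    by (intro continuous_on_prod continuous_on_diff continuous_on_mult continuous_on_divide
      continuous_on_const continuous_on_cis continuous_on_id) simp
  moreover have "(\<lambda>\<theta>. asc a b (cis \<theta>) n) = (\<lambda>\<theta>. \<Sum>k\<le>n. qpoch (a / cis \<theta>) Q k * qpoch (b / cis \<theta>) Q k *
      (1 / (qpoch (a * b) Q k * qpoch Q Q k)) * cis \<theta> ^ k * (1 / (cis \<theta> ^ (n - k) * qpoch Q Q (n - k))))"
    by (simp add: asc_def)
  ultimately show ?thesis
    by (simp only:) (intro continuous_on_sum continuous_on_mult continuous_on_divide continuous_on_power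
      continuous_on_const continuous_on_cis continuous_on_id; simp)
qed

text \<open>Odd \<open>n\<close> involves only odd moments. For even \<open>n = 2 M > 0\<close> the
  two powers in each moment give two sums that are finite triple products, at \<open>x = 1\<close>
  and at \<open>x = 1 / q\<close>; both contain \<open>(1; q)_M = 0\<close>.\<close>

lemma hermite_integral:
  "integral {-pi..pi} (\<lambda>\<theta>. asc 0 0 (cis \<theta>) n * hermite_weight \<theta>)
    = (if n = 0 then of_real (4 * pi) / qpoch_inf Q Q else 0)"
proof -
  have "asc 0 0 (cis \<theta>) n = (\<Sum>k\<le>n. 1 / (qpoch Q Q k * qpoch Q Q (n - k)) * cis (of_int (2 * int k - int n) * \<theta>))" for \<theta>
    unfolding asc_def
  proof (rule sum.cong)
    fix k assume "k \<in> {..n}"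
    then have "cis \<theta> ^ k / cis \<theta> ^ (n - k) = cis (of_int (2 * int k - int n) * \<theta>)"
      by (simp add: Complex.DeMoivre cis_divide of_nat_diff algebra_simps)
    from this[symmetric] show "qpoch (0 / cis \<theta>) Q k * qpoch (0 / cis \<theta>) Q k / (qpoch (0 * 0) Q k * qpoch Q Q k) * cis \<theta> ^ k *
        (1 / (cis \<theta> ^ (n - k) * qpoch Q Q (n - k)))
        = 1 / (qpoch Q Q k * qpoch Q Q (n - k)) * cis (of_int (2 * int k - int n) * \<theta>)"
      by (simp only:) simp
  qed simp
  then have "integral {-pi..pi} (\<lambda>\<theta>. asc 0 0 (cis \<theta>) n * hermite_weight \<theta>)
     = integral {-pi..pi} (\<lambda>\<theta>. \<Sum>k\<le>n. 1 / (qpoch Q Q k * qpoch Q Q (n - k)) * (cis (of_int (2 * int k - int n) * \<theta>) * hermite_weight \<theta>))"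
    by (simp add: sum_distrib_right mult.assoc)
  also have "\<dots> = (\<Sum>k\<le>n. integral {-pi..pi} (\<lambda>\<theta>. 1 / (qpoch Q Q k * qpoch Q Q (n - k)) * (cis (of_int (2 * int k - int n) * \<theta>) * hermite_weight \<theta>)))"
    by (rule integral_sum) (auto intro!: integrable_continuous_interval continuous_intros)
  also have "\<dots> = (\<Sum>k\<le>n. 1 / (qpoch Q Q k * qpoch Q Q (n - k)) * hermite_moment (2 * int k - int n))"
    by (simp only: integral_mult_right hermite_moment_def)
  finally have eq: "integral {-pi..pi} (\<lambda>\<theta>. asc 0 0 (cis \<theta>) n * hermite_weight \<theta>) = \<dots>" .
  consider "odd n" | "n = 0" | m where "n = 2 * Suc m"
  proof (cases "even n")
    case True
    then obtain k where "n = 2 * k" by blast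
    with that show thesis by (cases k) auto
  qed (rule that(1))
  then show ?thesis
  proof cases
    case 1
    then have "hermite_moment (2 * int k - int n) = 0" for k by (intro hermite_moment_odd) simp
    then show ?thesis using 1 unfolding eq by (cases "n = 0") simp_all
  next
    case 2
    then show ?thesis unfolding eq using hermite_moment_even[of 0] by (simp add: parity_sign_def tri_def)
  next
    case 3
    define M where "M = Suc m"
    have M: "n = 2 * M" using 3 by (simp add: M_def)
    have van: "qpoch 1 Q M = 0" using qpoch_Suc_shift[of 1 Q m] by (simp add: M_def)
    have s1: "(\<Sum>j\<le>n. qb n j * parity_sign (int j - int M) * Q ^ tri (int j - int M)) = 0"
      using jacobi_triple_product_finite[of 1 M] van by (simp add: M)
    have "(\<Sum>j\<le>n. qb n j * parity_sign (int j - int M) * Q ^ tri (int j - int M) * ((1 / Q) ^ j / (1 / Q) ^ M)) = 0"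
      using jacobi_triple_product_finite[of "1 / Q" M] van by (simp add: M)
    \<comment> \<open>Since \<open>tri k - k = tri (- k)\<close>, putting \<open>x = 1 / q\<close>
      reflects the exponent and yields the second family of powers.\<close>
    moreover have "Q ^ tri (int j - int M) * ((1 / Q) ^ j / (1 / Q) ^ M) = Q ^ tri (- (int j - int M))" for j
    proof -
      have "Q ^ (tri (int j - int M) + M) = Q ^ (tri (- (int j - int M)) + j)"
      proof (rule power_eqI)
        have "(x - y) * (x - y + 1) / 2 + y = (y - x) * (y - x + 1) / 2 + x" for x y :: real
          by (simp add: field_simps)
        from this[of "real j" "real M"] show "real (tri (int j - int M) + M) = real (tri (- (int j - int M)) + j)"
          by (simp only: of_nat_add tri_real of_int_mult of_int_diff of_int_add of_int_of_nat_eq of_int_1 of_int_minus minus_diff_eq)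
      qed
      then show ?thesis by (simp add: power_add power_divide divide_simps)
    qed
    ultimately have s2: "(\<Sum>j\<le>n. qb n j * parity_sign (int j - int M) * Q ^ tri (- (int j - int M))) = 0"
      by (simp only: mult.assoc)
    have "(\<Sum>k\<le>n. 1 / (qpoch Q Q k * qpoch Q Q (n - k)) * hermite_moment (2 * int k - int n))
        = (\<Sum>k\<le>n. of_real (2 * pi) / (qpoch Q Q n * qpoch_inf Q Q) *
           (qb n k * parity_sign (int k - int M) * Q ^ tri (- (int k - int M)) + qb n k * parity_sign (int k - int M) * Q ^ tri (int k - int M)))"
    proof (rule sum.cong)
      fix k
      have idx: "2 * int k - int n = 2 * (int k - int M)" by (simp add: M)
      show "1 / (qpoch Q Q k * qpoch Q Q (n - k)) * hermite_moment (2 * int k - int n)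
        = of_real (2 * pi) / (qpoch Q Q n * qpoch_inf Q Q) *
           (qb n k * parity_sign (int k - int M) * Q ^ tri (- (int k - int M)) + qb n k * parity_sign (int k - int M) * Q ^ tri (int k - int M))"
        unfolding idx hermite_moment_even distrib_left[symmetric] by (simp add: qb_def mult_ac)
    qed simp
    also have "\<dots> = 0"
      unfolding sum_distrib_left[symmetric] sum.distrib s1 s2 by simp
    finally show ?thesis using 3 unfolding eq by simp
  qed
qed

section \<open>From the recurrence to orthogonality\<close>

text \<open>With \<open>b = -a\<close> the term in \<open>a + b\<close> vanishes, so multiplication
  by \<open>u + 1 / u\<close> couples index \<open>n\<close> only to \<open>n + 1\<close> and
  \<open>n - 1\<close>. The case \<open>n = 0\<close> is the degree-one formula.\<close>

lemma asc_symmetric_recurrence: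
  assumes u: "u \<noteq> 0" and a: "norm (a\<^sup>2) < 1"
  shows "(u + 1 / u) * asc a (- a) u n = (1 + a\<^sup>2 * Q ^ n) * (1 - Q ^ Suc n) * asc a (- a) u (Suc n)
    + (if n = 0 then 0 else asc a (- a) u (n - 1))"
proof (cases n)
  case 0
  then show ?thesis using asc_1[OF u, of a "- a"] a by (simp add: power2_eq_square)
next
  case (Suc m)
  have "norm (a * - a) < 1" using a by (simp add: power2_eq_square norm_mult)
  from asc_recurrence[OF u this, of m] show ?thesis
    by (simp add: Suc power2_eq_square add_eq_0_iff) (simp add: algebra_simps)
qed

text \<open>\<open>M m n\<close> stands for the integral of the product of the \<open>m\<close>-th and \<open>n\<close>-th polynomial; the
  hypothesis says that multiplication by \<open>2x\<close> may be moved from one factor to the other.\<close>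

lemma orthogonality_from_recurrence:
  fixes M :: "nat \<Rightarrow> nat \<Rightarrow> 'a::field"
  assumes rec: "\<And>m n. \<gamma> m * M (Suc m) n + (if m = 0 then 0 else M (m - 1) n)
      = \<gamma> n * M m (Suc n) + (if n = 0 then 0 else M m (n - 1))"
    and base: "\<And>n. M 0 n = (if n = 0 then c else 0)" and nz: "\<And>n. \<gamma> n \<noteq> 0"
  shows "M m n = (if m = n then c / (\<Prod>i<n. \<gamma> i) else 0)"
proof (induction m arbitrary: n rule: less_induct)
  case (less m)
  show ?case
  proof (cases m)
    case 0
    then show ?thesis by (simp add: base)
  next
    case (Suc k)
    have IH: "M k n = (if k = n then c / (\<Prod>i<n. \<gamma> i) else 0)" for n using less Suc by simp
    have IH': "M (k - 1) n = (if k - 1 = n then c / (\<Prod>i<n. \<gamma> i) else 0)" for n using less Suc by simp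
    have nzp: "(\<Prod>i<j. \<gamma> i) \<noteq> 0" for j using nz by simp
    have "\<gamma> k * M (Suc k) n = \<gamma> n * M k (Suc n) + (if n = 0 then 0 else M k (n - 1)) - (if k = 0 then 0 else M (k - 1) n)"
      using rec[of k n] by (simp add: algebra_simps)
    also have "\<dots> = (if Suc k = n then c / (\<Prod>i<k. \<gamma> i) else 0)"
    proof (cases "k = Suc n")
      case True
      then show ?thesis using nz nzp unfolding IH IH' by simp
    next
      case False
      then show ?thesis unfolding IH IH' by (cases n) auto
    qed
    finally have *: "\<gamma> k * M (Suc k) n = \<dots>" .
    have "M (Suc k) n = (if Suc k = n then c / (\<Prod>i<k. \<gamma> i) else 0) / \<gamma> k"
      using * nz[of k] by (metis nonzero_mult_div_cancel_left)
    then show ?thesis unfolding Suc by (auto simp: mult.commute)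
  qed
qed

text \<open>The weight is left open because the lemma is used twice: with the Hermite weight, on the
  way to the two-parameter integral, and with the final weight, whose single integrals come from
  that integral.\<close>

lemma asc_orthogonality:
  assumes a: "norm (a\<^sup>2) < 1" and w: "continuous_on {-pi..pi} w"
    and base: "\<And>n. integral {-pi..pi} (\<lambda>\<theta>. asc a (- a) (cis \<theta>) n * w \<theta>) = (if n = 0 then c else 0)"
  shows "integral {-pi..pi} (\<lambda>\<theta>. asc a (- a) (cis \<theta>) m * asc a (- a) (cis \<theta>) n * w \<theta>)
    = (if m = n then c / (qpoch (- (a\<^sup>2)) Q n * qpoch Q Q n) else 0)"
proof -
  define K where "K n \<theta> = asc a (- a) (cis \<theta>) n" for n \<theta>
  define M where "M m n = integral {-pi..pi} (\<lambda>\<theta>. K m \<theta> * K n \<theta> * w \<theta>)" for m n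
  define \<gamma> where "\<gamma> n = (1 + a\<^sup>2 * Q ^ n) * (1 - Q ^ Suc n)" for n
  have Kc: "continuous_on {-pi..pi} (K n)" for n unfolding K_def by (rule asc_continuous)
  have Kr: "(cis \<theta> + 1 / cis \<theta>) * K n \<theta> = \<gamma> n * K (Suc n) \<theta> + (if n = 0 then 0 else K (n - 1) \<theta>)" for n \<theta>
    unfolding K_def \<gamma>_def by (rule asc_symmetric_recurrence[OF _ a]) simp
  have ii: "f integrable_on {-pi..pi}" if "continuous_on {-pi..pi} f" for f :: "real \<Rightarrow> complex"
    using that by (rule integrable_continuous_interval)
  have xM: "integral {-pi..pi} (\<lambda>\<theta>. (cis \<theta> + 1 / cis \<theta>) * K m \<theta> * K n \<theta> * w \<theta>)
     = \<gamma> m * M (Suc m) n + (if m = 0 then 0 else M (m - 1) n)" for m n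
  proof -
    have "integral {-pi..pi} (\<lambda>\<theta>. (cis \<theta> + 1 / cis \<theta>) * K m \<theta> * K n \<theta> * w \<theta>)
        = integral {-pi..pi} (\<lambda>\<theta>. \<gamma> m * (K (Suc m) \<theta> * K n \<theta> * w \<theta>) + (if m = 0 then 0 else 1) * (K (m - 1) \<theta> * K n \<theta> * w \<theta>))"
      unfolding Kr by (intro integral_cong) (simp add: algebra_simps)
    also have "\<dots> = \<gamma> m * M (Suc m) n + (if m = 0 then 0 else 1) * M (m - 1) n"
      unfolding M_def integral_mult_right[symmetric]
      by (intro integral_add ii continuous_intros Kc w)
    finally show ?thesis by simp
  qed
  have sym: "M m n = M n m" for m n
    unfolding M_def by (simp add: mult_ac)
  have "M m n = (if m = n then c / (\<Prod>i<n. \<gamma> i) else 0)"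
  proof (rule orthogonality_from_recurrence)
    fix m n
    show "\<gamma> m * M (Suc m) n + (if m = 0 then 0 else M (m - 1) n) = \<gamma> n * M m (Suc n) + (if n = 0 then 0 else M m (n - 1))"
      using xM[of m n] xM[of n m] by (simp add: sym[of _ m] mult_ac)
    show "M 0 n = (if n = 0 then c else 0)"
      using base by (simp add: M_def K_def)
    show "\<gamma> n \<noteq> 0"
      using factor_nonzero[of "- (a\<^sup>2)" n] a Q_power_neq_1[of n] by (simp add: \<gamma>_def)
  qed
  moreover have "(\<Prod>i<n. \<gamma> i) = qpoch (- (a\<^sup>2)) Q n * qpoch Q Q n" for n
    by (simp add: \<gamma>_def qpoch_def prod.distrib)
  ultimately show ?thesis by (simp add: M_def K_def)
qed

lemma hermite_orthogonality:
  "integral {-pi..pi} (\<lambda>\<theta>. asc 0 0 (cis \<theta>) m * asc 0 0 (cis \<theta>) n * hermite_weight \<theta>)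
    = (if m = n then of_real (4 * pi) / qpoch_inf Q Q / qpoch Q Q n else 0)"
  using asc_orthogonality[of 0 hermite_weight "of_real (4 * pi) / qpoch_inf Q Q" m n] hermite_integral
  by (simp add: continuous_hermite_weight)

section \<open>The two-parameter integral and the final weight\<close>

definition pair_inf :: "complex \<Rightarrow> real \<Rightarrow> complex" where
  "pair_inf a \<theta> = qpoch_inf (a * cis \<theta>) Q * qpoch_inf (a * cis (- \<theta>)) Q"

lemma pair_inf_continuous [continuous_intros]: "continuous_on S (pair_inf a)"
  unfolding pair_inf_def by (intro continuous_intros)

lemma pair_inf_nonzero: "norm a < 1 \<Longrightarrow> pair_inf a \<theta> \<noteq> 0"
  by (simp add: pair_inf_def qpoch_inf_nonzero norm_mult)

text \<open>Multiplying a weight with denominator \<open>pair_inf a\<close> by the basis function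
  \<open>(a u, a / u; q)_k\<close> of the terminating series therefore only replaces
  \<open>a\<close> by \<open>a q^k\<close>.\<close>

lemma pair_inf_shift:
  "pair_inf a \<theta> = qpoch (a * cis \<theta>) Q k * qpoch (a / cis \<theta>) Q k * pair_inf (a * Q ^ k) \<theta>"
  unfolding pair_inf_def using cis_divide[of 0 \<theta>]
  by (subst (1 2) qpoch_inf_split[of _ k]) (simp add: mult_ac divide_inverse)

lemma hermite_generating_function:
  assumes "norm a < 1"
  shows "(\<lambda>n. asc 0 0 (cis \<theta>) n * a ^ n) sums (1 / pair_inf a \<theta>)"
proof -
  have "phi21 0 0 0 Q (a * cis \<theta>) = 1 / qpoch_inf (a * cis \<theta>) Q"
    unfolding phi21_def using sums_unique[OF euler_sums[of "a * cis \<theta>"]] assms by (simp add: norm_mult)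
  then show ?thesis
    using asc_sums[of "cis \<theta>" 0 0 a] assms cis_divide[of 0 \<theta>]
    by (simp add: pair_inf_def divide_inverse mult_ac)
qed

text \<open>Expands \<open>1 / pair_inf a\<close> in \<open>q\<close>-Hermite polynomials under the
  integral. Dominated convergence applies: \<open>F\<close> is bounded on the compact interval, and
  the linear growth of the polynomials is absorbed by \<open>|a|^n\<close>.\<close>

lemma integral_div_pair_inf:
  assumes F: "continuous_on {-pi..pi} F" and a: "norm a < 1"
  shows "(\<lambda>n. a ^ n * integral {-pi..pi} (\<lambda>\<theta>. F \<theta> * asc 0 0 (cis \<theta>) n)) sums
    integral {-pi..pi} (\<lambda>\<theta>. F \<theta> / pair_inf a \<theta>)"
proof -
  define S where "S N \<theta> = (\<Sum>n<N. F \<theta> * (asc 0 0 (cis \<theta>) n * a ^ n))" for N \<theta>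
  have "compact (F ` {-pi..pi})" by (intro compact_continuous_image F) auto
  then obtain B where B: "\<And>\<theta>. \<theta> \<in> {-pi..pi} \<Longrightarrow> norm (F \<theta>) \<le> B"
    using compact_imp_bounded bounded_iff by (metis imageI)
  have sm: "summable (\<lambda>n. (real n + 1) * norm a ^ n)" using a by (intro summable_of_nat_geometric) auto
  have c0: "0 \<le> asc_const 0" using q_less_1
    by (auto simp: asc_const_def intro!: divide_nonneg_nonneg mult_nonneg_nonneg less_imp_le[OF qpoch_inf_real_pos])
  define T where "T = (\<Sum>n. (real n + 1) * norm a ^ n)"
  have "(\<lambda>N. integral {-pi..pi} (S N)) \<longlonglongrightarrow> integral {-pi..pi} (\<lambda>\<theta>. F \<theta> / pair_inf a \<theta>)"
  proof (rule dominated_convergence(2))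
    show "S N integrable_on {-pi..pi}" for N
      unfolding S_def by (intro integrable_continuous_interval continuous_intros F)
    show "(\<lambda>_. B * (asc_const 0 * T)) integrable_on {-pi..pi}" by (rule integrable_const_ivl)
    show "norm (S N \<theta>) \<le> B * (asc_const 0 * T)" if \<theta>: "\<theta> \<in> {-pi..pi}" for N \<theta>
    proof -
      have "norm (S N \<theta>) \<le> (\<Sum>n<N. B * (asc_const 0 * ((real n + 1) * norm a ^ n)))"
        unfolding S_def
      proof (rule sum_norm_le)
        fix n
        have "norm (asc 0 0 (cis \<theta>) n) \<le> (real n + 1) * asc_const 0"
          using asc_bound[of "cis \<theta>" 0 0 n] by simp
        then have "norm (asc 0 0 (cis \<theta>) n) * norm a ^ n \<le> ((real n + 1) * asc_const 0) * norm a ^ n"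
          by (intro mult_right_mono) auto
        then have "norm (F \<theta>) * (norm (asc 0 0 (cis \<theta>) n) * norm a ^ n) \<le> B * (((real n + 1) * asc_const 0) * norm a ^ n)"
          using B[OF \<theta>] order_trans[OF norm_ge_zero B[OF \<theta>]] by (intro mult_mono[of "norm (F \<theta>)"]) auto
        then show "norm (F \<theta> * (asc 0 0 (cis \<theta>) n * a ^ n)) \<le> B * (asc_const 0 * ((real n + 1) * norm a ^ n))"
          by (simp add: norm_mult norm_power mult_ac)
      qed
      also have "\<dots> = B * (asc_const 0 * (\<Sum>n<N. (real n + 1) * norm a ^ n))"
        by (simp add: sum_distrib_left)
      also have "\<dots> \<le> B * (asc_const 0 * T)"
        unfolding T_def using order_trans[OF norm_ge_zero B[OF \<theta>]] c0
        by (intro mult_left_mono sum_le_suminf sm) auto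
      finally show ?thesis .
    qed
    show "(\<lambda>N. S N \<theta>) \<longlonglongrightarrow> F \<theta> / pair_inf a \<theta>" for \<theta>
      using sums_mult[OF hermite_generating_function[OF a, of \<theta>], of "F \<theta>"]
      unfolding S_def sums_def by simp
  qed
  moreover have "integral {-pi..pi} (S N) = (\<Sum>n<N. a ^ n * integral {-pi..pi} (\<lambda>\<theta>. F \<theta> * asc 0 0 (cis \<theta>) n))" for N
  proof -
    have "integral {-pi..pi} (S N) = (\<Sum>n<N. integral {-pi..pi} (\<lambda>\<theta>. a ^ n * (F \<theta> * asc 0 0 (cis \<theta>) n)))"
      unfolding S_def
      by (subst integral_sum) (auto intro!: integrable_continuous_interval continuous_intros F simp: mult_ac)
    then show ?thesis by (simp only: integral_mult_right)
  qed
  ultimately show ?thesis by (simp add: sums_def)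
qed

text \<open>Both reciprocals are expanded in \<open>q\<close>-Hermite polynomials. Orthogonality
  leaves the diagonal sum over \<open>(a b)^n / (q; q)_n\<close>, which is Euler's series.\<close>

lemma two_parameter_integral:
  assumes a: "norm a < 1" and b: "norm b < 1"
  shows "integral {-pi..pi} (\<lambda>\<theta>. hermite_weight \<theta> / (pair_inf a \<theta> * pair_inf b \<theta>))
    = of_real (4 * pi) / (qpoch_inf Q Q * qpoch_inf (a * b) Q)"
proof -
  have ab: "norm (a * b) < 1" using mult_strict_mono'[OF a b] by (simp add: norm_mult)
  have inner: "integral {-pi..pi} (\<lambda>\<theta>. hermite_weight \<theta> / pair_inf b \<theta> * asc 0 0 (cis \<theta>) n)
     = b ^ n * (of_real (4 * pi) / qpoch_inf Q Q / qpoch Q Q n)" for n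
  proof -
    have "(\<lambda>m. b ^ m * integral {-pi..pi} (\<lambda>\<theta>. asc 0 0 (cis \<theta>) n * hermite_weight \<theta> * asc 0 0 (cis \<theta>) m)) sums
      integral {-pi..pi} (\<lambda>\<theta>. asc 0 0 (cis \<theta>) n * hermite_weight \<theta> / pair_inf b \<theta>)"
      by (intro integral_div_pair_inf b continuous_intros)
    moreover have "integral {-pi..pi} (\<lambda>\<theta>. asc 0 0 (cis \<theta>) n * hermite_weight \<theta> * asc 0 0 (cis \<theta>) m)
        = (if m = n then of_real (4 * pi) / qpoch_inf Q Q / qpoch Q Q n else 0)" for m
      using hermite_orthogonality[of m n] by (simp add: mult_ac)
    ultimately have "(\<lambda>m. if m = n then b ^ m * (of_real (4 * pi) / qpoch_inf Q Q / qpoch Q Q n) else 0) sums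
      integral {-pi..pi} (\<lambda>\<theta>. asc 0 0 (cis \<theta>) n * hermite_weight \<theta> / pair_inf b \<theta>)"
      by (simp add: if_distrib cong: if_cong)
    then have "integral {-pi..pi} (\<lambda>\<theta>. asc 0 0 (cis \<theta>) n * hermite_weight \<theta> / pair_inf b \<theta>)
       = b ^ n * (of_real (4 * pi) / qpoch_inf Q Q / qpoch Q Q n)"
      using sums_single[of n "\<lambda>m. b ^ m * (of_real (4 * pi) / qpoch_inf Q Q / qpoch Q Q n)"] sums_unique2 by blast
    then show ?thesis by (simp add: mult_ac)
  qed
  have "(\<lambda>n. a ^ n * integral {-pi..pi} (\<lambda>\<theta>. hermite_weight \<theta> / pair_inf b \<theta> * asc 0 0 (cis \<theta>) n)) sums
      integral {-pi..pi} (\<lambda>\<theta>. hermite_weight \<theta> / pair_inf b \<theta> / pair_inf a \<theta>)"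
    by (intro integral_div_pair_inf a continuous_intros) (use pair_inf_nonzero b in auto)
  then have "(\<lambda>n. of_real (4 * pi) / qpoch_inf Q Q * ((a * b) ^ n / qpoch Q Q n)) sums
      integral {-pi..pi} (\<lambda>\<theta>. hermite_weight \<theta> / pair_inf b \<theta> / pair_inf a \<theta>)"
    unfolding inner by (simp add: power_mult_distrib mult_ac)
  moreover have "(\<lambda>n. of_real (4 * pi) / qpoch_inf Q Q * ((a * b) ^ n / qpoch Q Q n)) sums
      (of_real (4 * pi) / qpoch_inf Q Q * (1 / qpoch_inf (a * b) Q))"
    by (intro sums_mult euler_sums ab)
  ultimately show ?thesis using sums_unique2 by (fastforce simp: mult_ac)
qed

text \<open>At \<open>y = q^-n\<close> and \<open>m = n > 0\<close> the right side contains a zero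
  factor; this is what annihilates the single integrals of positive degree.\<close>

lemma terminating_sum: "(\<Sum>k\<le>m. qpoch y Q k * (Q ^ k / qpoch Q Q k)) = qpoch (y * Q) Q m / qpoch Q Q m"
proof (induction m)
  case (Suc m)
  have nz: "1 - Q * Q ^ m \<noteq> 0" using Q_power_neq_1[of m] by simp
  have "qpoch (y * Q) Q m / qpoch Q Q m + qpoch y Q (Suc m) * (Q ^ Suc m / qpoch Q Q (Suc m))
      = qpoch (y * Q) Q m * ((1 - Q * Q ^ m) + (1 - y) * (Q * Q ^ m)) / qpoch Q Q (Suc m)"
    using nz unfolding qpoch_Suc_shift[of y] qpoch_Suc[of Q]
    by (simp add: add_divide_distrib distrib_left)
  also have "(1 - Q * Q ^ m) + (1 - y) * (Q * Q ^ m) = 1 - y * Q * Q ^ m"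
    by (simp add: algebra_simps)
  finally show ?case using Suc by (simp add: qpoch_Suc)
qed simp

text \<open>Each basis function shifts \<open>a\<close> to \<open>a q^k\<close>, so its integral is
  a constant times \<open>(a b; q)_k\<close> and cancels the denominator of the terminating series.
  The series has the factor \<open>a^n\<close> in front, hence \<open>a \<noteq> 0\<close>.\<close>

lemma asc_integral:
  assumes a: "norm a < 1" and b: "norm b < 1" and a0: "a \<noteq> 0"
  shows "integral {-pi..pi} (\<lambda>\<theta>. asc a b (cis \<theta>) n * (hermite_weight \<theta> / (pair_inf a \<theta> * pair_inf b \<theta>)))
    = (if n = 0 then of_real (4 * pi) / (qpoch_inf Q Q * qpoch_inf (a * b) Q) else 0)"
proof -
  have ab: "norm (a * b) < 1" using mult_strict_mono'[OF a b] by (simp add: norm_mult)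
  define c where "c = of_real (4 * pi) / (qpoch_inf Q Q * qpoch_inf (a * b) Q)"
  define \<omega> where "\<omega> \<theta> = hermite_weight \<theta> / (pair_inf a \<theta> * pair_inf b \<theta>)" for \<theta>
  define p where "p k \<theta> = qpoch (a * cis \<theta>) Q k * qpoch (a / cis \<theta>) Q k" for k \<theta>
  have pw: "p k \<theta> * \<omega> \<theta> = hermite_weight \<theta> / (pair_inf (a * Q ^ k) \<theta> * pair_inf b \<theta>)" for k \<theta>
  proof -
    have "p k \<theta> \<noteq> 0"
      using qpoch_nonzero[of "a * cis \<theta>" k] qpoch_nonzero[of "a / cis \<theta>" k] a
      by (simp add: p_def norm_mult norm_divide)
    moreover have "pair_inf a \<theta> = p k \<theta> * pair_inf (a * Q ^ k) \<theta>"
      unfolding p_def by (rule pair_inf_shift)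
    ultimately show ?thesis by (simp add: \<omega>_def)
  qed
  have small: "norm (a * Q ^ k) < 1" for k
  proof -
    have "norm (a * Q ^ k) \<le> norm a * 1"
      unfolding norm_mult norm_power norm_cq by (intro mult_left_mono qpow_le_1) auto
    with a show ?thesis by simp
  qed
  have pint: "integral {-pi..pi} (\<lambda>\<theta>. p k \<theta> * \<omega> \<theta>) = c * qpoch (a * b) Q k" for k
  proof -
    have comm: "a * Q ^ k * b = a * b * Q ^ k" by simp
    show ?thesis
      unfolding pw two_parameter_integral[OF small b] comm c_def qpoch_inf_split[of "a * b" k]
      using qpoch_nonzero[OF ab, of k] by simp
  qed
  have \<omega>c: "continuous_on {-pi..pi} \<omega>"
    unfolding \<omega>_def by (intro continuous_intros) (use pair_inf_nonzero a b in auto)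
  have pc: "continuous_on {-pi..pi} (p k)" for k
    unfolding p_def qpoch_def
    by (intro continuous_on_prod continuous_on_diff continuous_on_mult continuous_on_divide
      continuous_on_const continuous_on_cis continuous_on_id) simp
  define e where "e k = qpoch (1 / Q ^ n) Q k / qpoch (a * b) Q k * (Q ^ k / qpoch Q Q k)" for k
  have "a ^ n * qpoch Q Q n * asc a b (cis \<theta>) n = (\<Sum>k\<le>n. e k * p k \<theta>)" for \<theta>
    unfolding e_def p_def by (subst terminating_asc[OF a0 _ ab, symmetric]) (simp_all add: mult_ac)
  then have "a ^ n * qpoch Q Q n * integral {-pi..pi} (\<lambda>\<theta>. asc a b (cis \<theta>) n * \<omega> \<theta>)
      = integral {-pi..pi} (\<lambda>\<theta>. \<Sum>k\<le>n. e k * (p k \<theta> * \<omega> \<theta>))"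
    unfolding integral_mult_right[symmetric] by (simp add: sum_distrib_right mult.assoc[symmetric])
  also have "\<dots> = (\<Sum>k\<le>n. integral {-pi..pi} (\<lambda>\<theta>. e k * (p k \<theta> * \<omega> \<theta>)))"
    by (rule integral_sum) (auto intro!: integrable_continuous_interval continuous_intros \<omega>c pc)
  also have "\<dots> = c * (\<Sum>k\<le>n. qpoch (1 / Q ^ n) Q k * (Q ^ k / qpoch Q Q k))"
    unfolding integral_mult_right pint sum_distrib_left
    using qpoch_nonzero[OF ab] by (intro sum.cong refl) (simp add: e_def)
  also have "\<dots> = (if n = 0 then c else 0)"
  proof (cases n)
    case (Suc m)
    have "qpoch (1 / Q ^ n * Q) Q n = 0"
      unfolding qpoch_def by (auto simp: Suc intro!: bexI[of _ m])
    then show ?thesis unfolding terminating_sum using Suc by simp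
  qed simp
  finally have "a ^ n * qpoch Q Q n * integral {-pi..pi} (\<lambda>\<theta>. asc a b (cis \<theta>) n * \<omega> \<theta>) = (if n = 0 then c else 0)" .
  then show ?thesis using a0 by (cases n) (auto simp: \<omega>_def c_def)
qed

text \<open>For \<open>a = 0\<close> both denominators are 1, and the single integrals are those of
  the \<open>q\<close>-Hermite polynomials.\<close>

lemma asc_orthogonality_weight:
  assumes a: "norm a < 1"
  shows "integral {-pi..pi} (\<lambda>\<theta>. asc a (- a) (cis \<theta>) m * asc a (- a) (cis \<theta>) n *
      (hermite_weight \<theta> / (pair_inf a \<theta> * pair_inf (- a) \<theta>)))
    = (if m = n then of_real (4 * pi) / (qpoch_inf Q Q * qpoch_inf (- (a\<^sup>2)) Q) / (qpoch (- (a\<^sup>2)) Q n * qpoch Q Q n) else 0)"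
proof (rule asc_orthogonality)
  show "norm (a\<^sup>2) < 1" using mult_strict_mono'[OF a a] by (simp add: norm_mult power2_eq_square)
  show "continuous_on {-pi..pi} (\<lambda>\<theta>. hermite_weight \<theta> / (pair_inf a \<theta> * pair_inf (- a) \<theta>))"
    by (intro continuous_intros) (use pair_inf_nonzero a in auto)
  show "integral {-pi..pi} (\<lambda>\<theta>. asc a (- a) (cis \<theta>) n * (hermite_weight \<theta> / (pair_inf a \<theta> * pair_inf (- a) \<theta>)))
    = (if n = 0 then of_real (4 * pi) / (qpoch_inf Q Q * qpoch_inf (- (a\<^sup>2)) Q) else 0)" for n
  proof (cases "a = 0")
    case True
    then show ?thesis using hermite_integral[of n] qpoch_inf_of_real[of 0, where 'a = complex]
      by (simp add: pair_inf_def qpoch_inf_def)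
  next
    case False
    show ?thesis using asc_integral[OF a _ False, of "- a" n] a by (simp add: power2_eq_square)
  qed
qed

end

section \<open>Orthonormal sequences in \<open>L\<^sup>2\<close>\<close>

definition sqnorm :: "'a measure \<Rightarrow> ('a \<Rightarrow> complex) \<Rightarrow> real" where
  "sqnorm M f = (LINT x|M. (cmod (f x))\<^sup>2)"

lemma L2_norm_sqnorm: "L2_norm M f = sqrt (sqnorm M f)"
  by (simp add: L2_norm_def sqnorm_def)

lemma sqnorm_nonneg [simp]: "0 \<le> sqnorm M f"
  by (simp add: sqnorm_def)

lemma L2_measurable: "f \<in> L2 M \<Longrightarrow> f \<in> borel_measurable M"
  and L2_integrable: "f \<in> L2 M \<Longrightarrow> integrable M (\<lambda>x. (cmod (f x))\<^sup>2)"
  by (simp_all add: L2_def)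

lemma cmod_add_square_le: "(cmod (x + y))\<^sup>2 \<le> 2 * (cmod x)\<^sup>2 + 2 * (cmod y)\<^sup>2"
proof -
  have "(cmod (x + y))\<^sup>2 \<le> (cmod x + cmod y)\<^sup>2"
    by (intro power_mono norm_triangle_ineq) simp
  also have "\<dots> \<le> 2 * (cmod x)\<^sup>2 + 2 * (cmod y)\<^sup>2"
    using zero_le_power2[of "cmod x - cmod y"] by (simp add: power2_eq_square algebra_simps)
  finally show ?thesis .
qed

lemma borel_measurable_cnj [measurable (raw)]:
  "f \<in> borel_measurable M \<Longrightarrow> (\<lambda>x. cnj (f x)) \<in> borel_measurable M"
  by (rule borel_measurable_continuous_on[OF continuous_on_cnj[OF continuous_on_id]])

lemma L2_zero [simp]: "(\<lambda>x. 0) \<in> L2 M"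
  by (simp add: L2_def)

lemma L2_add:
  assumes "f \<in> L2 M" "g \<in> L2 M" shows "(\<lambda>x. f x + g x) \<in> L2 M"
  unfolding L2_def
proof safe
  note [measurable] = assms[THEN L2_measurable]
  show "(\<lambda>x. f x + g x) \<in> borel_measurable M" by measurable
  show "integrable M (\<lambda>x. (cmod (f x + g x))\<^sup>2)"
  proof (rule Bochner_Integration.integrable_bound)
    show "integrable M (\<lambda>x. 2 * (cmod (f x))\<^sup>2 + 2 * (cmod (g x))\<^sup>2)"
      using assms by (intro Bochner_Integration.integrable_add integrable_mult_right) (auto dest: L2_integrable)
    show "AE x in M. norm ((cmod (f x + g x))\<^sup>2) \<le> norm (2 * (cmod (f x))\<^sup>2 + 2 * (cmod (g x))\<^sup>2)"
      using cmod_add_square_le by (auto intro!: AE_I2)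
  qed measurable
qed

lemma L2_cmult: "f \<in> L2 M \<Longrightarrow> (\<lambda>x. c * f x) \<in> L2 M"
  by (auto simp: L2_def norm_mult power_mult_distrib)

lemma L2_diff: "f \<in> L2 M \<Longrightarrow> g \<in> L2 M \<Longrightarrow> (\<lambda>x. f x - g x) \<in> L2 M"
  using L2_add[of f M "\<lambda>x. - 1 * g x"] L2_cmult[of g M "- 1"] by simp

lemma L2_sum: "(\<And>i. i \<in> I \<Longrightarrow> f i \<in> L2 M) \<Longrightarrow> (\<lambda>x. \<Sum>i\<in>I. f i x) \<in> L2 M"
  by (induction I rule: infinite_finite_induct) (auto intro: L2_add)

lemma L2_inner_integrable:
  assumes "f \<in> L2 M" "g \<in> L2 M" shows "integrable M (\<lambda>x. f x * cnj (g x))"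
proof (rule Bochner_Integration.integrable_bound)
  note [measurable] = assms[THEN L2_measurable]
  show "integrable M (\<lambda>x. (cmod (f x))\<^sup>2 + (cmod (g x))\<^sup>2)"
    using assms by (intro Bochner_Integration.integrable_add) (auto dest: L2_integrable)
  show "(\<lambda>x. f x * cnj (g x)) \<in> borel_measurable M" by measurable
  have "cmod x * cmod y \<le> (cmod x)\<^sup>2 + (cmod y)\<^sup>2" for x y
  proof -
    have "0 \<le> cmod x * cmod y" by simp
    then show ?thesis using sum_squares_bound[of "cmod x" "cmod y"] unfolding mult.assoc by linarith
  qed
  then show "AE x in M. norm (f x * cnj (g x)) \<le> norm ((cmod (f x))\<^sup>2 + (cmod (g x))\<^sup>2)"
    by (auto simp: norm_mult intro!: AE_I2)
qed

lemma L2_inner_diff_left: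
  assumes "f \<in> L2 M" "g \<in> L2 M" "h \<in> L2 M"
  shows "L2_inner M (\<lambda>x. f x - g x) h = L2_inner M f h - L2_inner M g h"
  using assms by (simp add: L2_inner_def left_diff_distrib L2_inner_integrable)

lemma L2_inner_cmult_left: "L2_inner M (\<lambda>x. c * f x) h = c * L2_inner M f h"
  by (simp add: L2_inner_def mult.assoc)

lemma L2_inner_sum_left:
  assumes "\<And>i. i \<in> I \<Longrightarrow> f i \<in> L2 M" "h \<in> L2 M"
  shows "L2_inner M (\<lambda>x. \<Sum>i\<in>I. f i x) h = (\<Sum>i\<in>I. L2_inner M (f i) h)"
  unfolding L2_inner_def sum_distrib_right
  using assms by (intro Bochner_Integration.integral_sum L2_inner_integrable)

lemma L2_inner_commute: "L2_inner M f g = cnj (L2_inner M g f)"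
  unfolding L2_inner_def Bochner_Integration.integral_cnj[symmetric] by (simp add: mult.commute)

lemma L2_inner_self: "L2_inner M f f = of_real (sqnorm M f)"
  unfolding L2_inner_def sqnorm_def integral_complex_of_real[symmetric]
  by (simp only: complex_norm_square)

lemma sqnorm_diff:
  assumes "f \<in> L2 M" "g \<in> L2 M"
  shows "sqnorm M (\<lambda>x. f x - g x) = sqnorm M f + sqnorm M g - 2 * Re (L2_inner M f g)"
proof -
  let ?i = "L2_inner M"
  have d: "(\<lambda>x. f x - g x) \<in> L2 M" using assms by (rule L2_diff)
  have "?i (\<lambda>x. f x - g x) (\<lambda>x. f x - g x) = ?i f (\<lambda>x. f x - g x) - ?i g (\<lambda>x. f x - g x)"
    using assms d by (simp add: L2_inner_diff_left)
  also have "\<dots> = cnj (?i f f - ?i g f) - cnj (?i f g - ?i g g)"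
    using assms L2_inner_commute[of M f "\<lambda>x. f x - g x"] L2_inner_commute[of M g "\<lambda>x. f x - g x"]
    by (simp add: L2_inner_diff_left)
  also have "\<dots> = ?i f f + ?i g g - (?i f g + cnj (?i f g))"
    using L2_inner_commute[of M g f] by (simp add: L2_inner_self)
  finally have "Re (?i (\<lambda>x. f x - g x) (\<lambda>x. f x - g x)) = Re (?i f f + ?i g g - (?i f g + cnj (?i f g)))"
    by simp
  then show ?thesis by (simp add: L2_inner_self)
qed

lemma sqnorm_add_le:
  assumes "f \<in> L2 M" "g \<in> L2 M"
  shows "sqnorm M (\<lambda>x. f x + g x) \<le> 2 * sqnorm M f + 2 * sqnorm M g"
proof -
  have "sqnorm M (\<lambda>x. f x + g x) \<le> (LINT x|M. 2 * (cmod (f x))\<^sup>2 + 2 * (cmod (g x))\<^sup>2)"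
    unfolding sqnorm_def
  proof (rule integral_mono)
    show "integrable M (\<lambda>x. (cmod (f x + g x))\<^sup>2)" using L2_add[OF assms] by (rule L2_integrable)
    show "integrable M (\<lambda>x. 2 * (cmod (f x))\<^sup>2 + 2 * (cmod (g x))\<^sup>2)"
      using assms by (intro Bochner_Integration.integrable_add integrable_mult_right) (auto dest: L2_integrable)
  qed (rule cmod_add_square_le)
  also have "\<dots> = 2 * sqnorm M f + 2 * sqnorm M g"
    unfolding sqnorm_def using assms by (simp add: L2_integrable)
  finally show ?thesis .
qed

lemma sqnorm_cmult: "sqnorm M (\<lambda>x. c * f x) = (cmod c)\<^sup>2 * sqnorm M f"
  by (simp add: sqnorm_def norm_mult power_mult_distrib)

lemma sqnorm_eq_0_AE:
  assumes "f \<in> L2 M" "sqnorm M f = 0" shows "AE x in M. f x = 0"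
proof -
  have "AE x in M. (cmod (f x))\<^sup>2 = 0"
    using integral_nonneg_eq_0_iff_AE[OF L2_integrable[OF assms(1)]] assms(2)
    by (simp add: sqnorm_def)
  then show ?thesis by simp
qed

lemma sqnorm_cong_AE:
  assumes "f \<in> borel_measurable M" "g \<in> borel_measurable M" "AE x in M. f x = g x"
  shows "sqnorm M f = sqnorm M g"
proof -
  note [measurable] = assms(1,2)
  show ?thesis unfolding sqnorm_def using assms(3) by (intro integral_cong_AE) auto
qed

lemma L2_cong_AE:
  assumes "f \<in> L2 M" "g \<in> borel_measurable M" "AE x in M. f x = g x"
  shows "g \<in> L2 M"
proof -
  note [measurable] = L2_measurable[OF assms(1)] assms(2)
  have "integrable M (\<lambda>x. (cmod (f x))\<^sup>2) \<longleftrightarrow> integrable M (\<lambda>x. (cmod (g x))\<^sup>2)"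
    using assms(3) by (intro integrable_cong_AE) auto
  then show ?thesis using assms by (simp add: L2_def)
qed

section \<open>Expansions with respect to an orthonormal sequence\<close>

text \<open>In both applications the function with index 0 is constantly 1, so its normalization
  says that the measure is a probability measure. Total mass 1 bounds the \<open>L1\<close> norm by
  the \<open>L2\<close> norm.\<close>

locale orthonormal_sequence = finite_measure M for M :: "'a measure" +
  fixes e :: "nat \<Rightarrow> 'a \<Rightarrow> complex"
  assumes total: "measure M (space M) = 1"
    and e_L2: "\<And>n. e n \<in> L2 M"
    and orthonormal: "\<And>m n. L2_inner M (e m) (e n) = (if m = n then 1 else 0)"
begin

definition partial :: "(nat \<Rightarrow> complex) \<Rightarrow> nat \<Rightarrow> 'a \<Rightarrow> complex" where
  "partial c N x = (\<Sum>n<N. c n * e n x)"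

definition coeff :: "('a \<Rightarrow> complex) \<Rightarrow> nat \<Rightarrow> complex" where
  "coeff f n = L2_inner M f (e n)"

text \<open>Mean-square convergence with a prescribed sequence \<open>c\<close>; that
  \<open>c\<close> must consist of the Fourier coefficients of \<open>f\<close> is a
  consequence.\<close>

definition expands :: "(nat \<Rightarrow> complex) \<Rightarrow> ('a \<Rightarrow> complex) \<Rightarrow> bool" where
  "expands c f \<longleftrightarrow> f \<in> L2 M \<and> (\<lambda>N. sqnorm M (\<lambda>x. f x - partial c N x)) \<longlonglongrightarrow> 0"

text \<open>The variance of \<open>|f|\<close> is nonnegative; integrability follows from
  \<open>x \<le> 1 + x^2\<close>.\<close>

lemma integral_norm_square_le:
  assumes "f \<in> L2 M" shows "integrable M f" "(LINT x|M. cmod (f x))\<^sup>2 \<le> sqnorm M f"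
proof -
  note [measurable] = L2_measurable[OF assms]
  have "integrable M (\<lambda>x. 1 + (cmod (f x))\<^sup>2)"
    using assms by (intro Bochner_Integration.integrable_add) (auto dest: L2_integrable)
  then show int: "integrable M f"
  proof (rule Bochner_Integration.integrable_bound)
    have "x \<le> 1 + x\<^sup>2" for x :: real
      using zero_le_power2[of "x - 1/2"] by (simp add: power2_eq_square algebra_simps)
    then show "AE x in M. norm (f x) \<le> norm (1 + (cmod (f x))\<^sup>2)"
      by (intro AE_I2) (simp add: add_nonneg_nonneg)
  qed measurable
  define m where "m = (LINT x|M. cmod (f x))"
  have "0 \<le> (LINT x|M. (cmod (f x) - m)\<^sup>2)" by simp
  also have "\<dots> = (LINT x|M. (cmod (f x))\<^sup>2 - 2 * m * cmod (f x) + m\<^sup>2)"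
    by (simp add: power2_diff algebra_simps)
  also have "\<dots> = sqnorm M f - 2 * m * m + m\<^sup>2"
    using int assms total by (simp add: sqnorm_def m_def L2_integrable)
  finally show "(LINT x|M. cmod (f x))\<^sup>2 \<le> sqnorm M f"
    by (simp add: m_def power2_eq_square)
qed

lemma partial_L2 [simp]: "partial c N \<in> L2 M"
  unfolding partial_def[abs_def] by (intro L2_sum L2_cmult e_L2)

lemma coeff_partial: "coeff (partial c N) k = (if k < N then c k else 0)"
proof -
  have "coeff (partial c N) k = (\<Sum>n<N. c n * (if n = k then 1 else 0))"
    unfolding coeff_def partial_def[abs_def]
    by (subst L2_inner_sum_left) (simp_all add: L2_cmult e_L2 L2_inner_cmult_left orthonormal)
  also have "\<dots> = (\<Sum>n<N. if n = k then c k else 0)" by (intro sum.cong) auto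
  finally show ?thesis by simp
qed

lemma inner_partial:
  assumes "f \<in> L2 M" shows "L2_inner M f (partial c N) = (\<Sum>n<N. cnj (c n) * coeff f n)"
proof -
  have "L2_inner M (partial c N) f = (\<Sum>n<N. c n * L2_inner M (e n) f)"
    unfolding partial_def[abs_def]
    by (subst L2_inner_sum_left) (simp_all add: assms L2_cmult e_L2 L2_inner_cmult_left)
  then have "L2_inner M f (partial c N) = cnj (\<Sum>n<N. c n * L2_inner M (e n) f)"
    using L2_inner_commute[of M f] by simp
  also have "\<dots> = (\<Sum>n<N. cnj (c n) * coeff f n)"
    using L2_inner_commute[of M f] by (simp add: coeff_def)
  finally show ?thesis .
qed

lemma sqnorm_partial: "sqnorm M (partial c N) = (\<Sum>n<N. (cmod (c n))\<^sup>2)"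
proof -
  have "of_real (sqnorm M (partial c N)) = (\<Sum>n<N. cnj (c n) * coeff (partial c N) n)"
    unfolding L2_inner_self[symmetric] by (rule inner_partial) simp
  also have "\<dots> = (\<Sum>n<N. complex_of_real ((cmod (c n))\<^sup>2))"
    by (intro sum.cong) (simp_all add: coeff_partial complex_norm_square mult.commute del: of_real_power)
  finally show ?thesis by (simp only: of_real_sum[symmetric] of_real_eq_iff)
qed

text \<open>Completing the square: Fourier coefficients give the best approximation. Bessel,
  Parseval, uniqueness of coefficients and the description of the closed span are all read off from
  this identity.\<close>

lemma sqnorm_diff_partial:
  assumes "f \<in> L2 M"
  shows "sqnorm M (\<lambda>x. f x - partial c N x)
    = sqnorm M f - (\<Sum>n<N. (cmod (coeff f n))\<^sup>2) + (\<Sum>n<N. (cmod (c n - coeff f n))\<^sup>2)"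
proof -
  have "(cmod (z - w))\<^sup>2 = (cmod z)\<^sup>2 + (cmod w)\<^sup>2 - 2 * Re (cnj z * w)" for z w
    unfolding cmod_power2 by (simp add: power2_eq_square algebra_simps)
  then have "(\<Sum>n<N. (cmod (c n - coeff f n))\<^sup>2)
     = (\<Sum>n<N. (cmod (c n))\<^sup>2) + (\<Sum>n<N. (cmod (coeff f n))\<^sup>2) - 2 * Re (\<Sum>n<N. cnj (c n) * coeff f n)"
    by (simp only: sum.distrib sum_subtractf Re_sum sum_distrib_left)
  then show ?thesis
    using assms by (simp add: sqnorm_diff inner_partial sqnorm_partial)
qed

lemma bessel:
  assumes "f \<in> L2 M" shows "summable (\<lambda>n. (cmod (coeff f n))\<^sup>2)"
proof (rule bounded_imp_summable)
  fix N
  have "0 \<le> sqnorm M f - (\<Sum>n<Suc N. (cmod (coeff f n))\<^sup>2)"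
    using sqnorm_diff_partial[OF assms, of "coeff f" "Suc N"]
      sqnorm_nonneg[of M "\<lambda>x. f x - partial (coeff f) (Suc N) x"] by (simp del: sqnorm_nonneg)
  then show "(\<Sum>n\<le>N. (cmod (coeff f n))\<^sup>2) \<le> sqnorm M f"
    by (simp only: lessThan_Suc_atMost)
qed simp

lemma expands_coeff:
  assumes "expands c f" shows "coeff f = c"
proof
  fix n
  have f: "f \<in> L2 M" and lim: "(\<lambda>N. sqnorm M (\<lambda>x. f x - partial c N x)) \<longlonglongrightarrow> 0"
    using assms by (auto simp: expands_def)
  have "(cmod (c n - coeff f n))\<^sup>2 \<le> sqnorm M (\<lambda>x. f x - partial c N x)" if "n < N" for N
  proof -
    have "0 \<le> sqnorm M f - (\<Sum>n<N. (cmod (coeff f n))\<^sup>2)"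
      using sqnorm_diff_partial[OF f, of "coeff f" N]
        sqnorm_nonneg[of M "\<lambda>x. f x - partial (coeff f) N x"] by (simp del: sqnorm_nonneg)
    moreover have "(cmod (c n - coeff f n))\<^sup>2 \<le> (\<Sum>n<N. (cmod (c n - coeff f n))\<^sup>2)"
      using that by (intro member_le_sum) auto
    ultimately show ?thesis unfolding sqnorm_diff_partial[OF f] by linarith
  qed
  then have "(cmod (c n - coeff f n))\<^sup>2 \<le> 0"
    by (intro LIMSEQ_le_const[OF lim]) (auto intro!: exI[of _ "Suc n"])
  then show "coeff f n = c n" by simp
qed

lemma expands_parseval:
  assumes "expands c f" shows "(\<lambda>n. (cmod (c n))\<^sup>2) sums sqnorm M f"
proof -
  have f: "f \<in> L2 M" and lim: "(\<lambda>N. sqnorm M (\<lambda>x. f x - partial c N x)) \<longlonglongrightarrow> 0"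
    using assms by (auto simp: expands_def)
  have "(\<lambda>N. sqnorm M f - sqnorm M (\<lambda>x. f x - partial c N x)) \<longlonglongrightarrow> sqnorm M f - 0"
    by (intro tendsto_intros lim)
  then show ?thesis
    by (simp add: sqnorm_diff_partial[OF f] expands_coeff[OF assms] sums_def)
qed

text \<open>A Fourier partial sum is at least as close to \<open>f\<close> as any combination of no
  more terms, so one good approximation controls all later partial sums.\<close>

lemma closure_span_expands:
  assumes f: "f \<in> L2 M"
    and approx: "\<And>\<epsilon>. 0 < \<epsilon> \<Longrightarrow> \<exists>c N. sqnorm M (\<lambda>x. f x - partial c N x) < \<epsilon>"
  shows "expands (coeff f) f"
  unfolding expands_def
proof (intro conjI f LIMSEQ_I)
  fix \<epsilon> :: real assume "0 < \<epsilon>"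
  then obtain c K where K: "sqnorm M (\<lambda>x. f x - partial c K x) < \<epsilon>" using approx by blast
  have "sqnorm M (\<lambda>x. f x - partial (coeff f) N x) < \<epsilon>" if "K \<le> N" for N
  proof -
    have "(\<Sum>n<K. (cmod (coeff f n))\<^sup>2) \<le> (\<Sum>n<N. (cmod (coeff f n))\<^sup>2)"
      using that by (intro sum_mono2) auto
    moreover have "0 \<le> (\<Sum>n<K. (cmod (c n - coeff f n))\<^sup>2)" by (intro sum_nonneg) auto
    ultimately show ?thesis using K unfolding sqnorm_diff_partial[OF f] by simp
  qed
  then show "\<exists>no. \<forall>n\<ge>no. norm (sqnorm M (\<lambda>x. f x - partial (coeff f) n x) - 0) < \<epsilon>"
    by auto
qed

lemma expands_AE_unique:
  assumes "expands c f" "expands c g" shows "AE x in M. f x = g x"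
proof -
  have fg: "f \<in> L2 M" "g \<in> L2 M" using assms by (auto simp: expands_def)
  have "(\<lambda>N. 2 * sqnorm M (\<lambda>x. f x - partial c N x) + 2 * sqnorm M (\<lambda>x. g x - partial c N x)) \<longlonglongrightarrow> 2 * 0 + 2 * 0"
    using assms unfolding expands_def by (intro tendsto_intros) auto
  moreover have "sqnorm M (\<lambda>x. f x - g x) \<le> 2 * sqnorm M (\<lambda>x. f x - partial c N x) + 2 * sqnorm M (\<lambda>x. g x - partial c N x)" for N
    using sqnorm_add_le[of "\<lambda>x. f x - partial c N x" M "\<lambda>x. - 1 * (g x - partial c N x)"] fg
      sqnorm_cmult[of M "- 1" "\<lambda>x. g x - partial c N x"]
    by (simp add: L2_diff L2_cmult del: mult_minus1)
  ultimately have "sqnorm M (\<lambda>x. f x - g x) \<le> 2 * 0 + 2 * 0"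
    by (intro LIMSEQ_le_const) auto
  then have "AE x in M. f x - g x = 0"
    using fg by (intro sqnorm_eq_0_AE L2_diff) (auto intro: antisym)
  then show ?thesis by simp
qed

lemma expands_cong_AE:
  assumes "expands c f" "g \<in> borel_measurable M" "AE x in M. f x = g x" shows "expands c g"
proof -
  have f: "f \<in> L2 M" using assms by (simp add: expands_def)
  have g: "g \<in> L2 M" using L2_cong_AE[OF f assms(2,3)] .
  have "sqnorm M (\<lambda>x. f x - partial c N x) = sqnorm M (\<lambda>x. g x - partial c N x)" for N
    using assms(3) by (intro sqnorm_cong_AE L2_measurable L2_diff f g partial_L2) auto
  then show ?thesis using assms g by (simp add: expands_def)
qed

lemma expands_linear:
  assumes "expands c f" "expands d g"
  shows "expands (\<lambda>n. a * c n + b * d n) (\<lambda>x. a * f x + b * g x)"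
proof -
  have fg: "f \<in> L2 M" "g \<in> L2 M" using assms by (auto simp: expands_def)
  let ?f = "\<lambda>N x. f x - partial c N x" and ?g = "\<lambda>N x. g x - partial d N x"
  have "(\<lambda>N. 2 * ((cmod a)\<^sup>2 * sqnorm M (?f N)) + 2 * ((cmod b)\<^sup>2 * sqnorm M (?g N))) \<longlonglongrightarrow> 2 * ((cmod a)\<^sup>2 * 0) + 2 * ((cmod b)\<^sup>2 * 0)"
    using assms unfolding expands_def by (intro tendsto_intros) auto
  then have lim: "(\<lambda>N. 2 * ((cmod a)\<^sup>2 * sqnorm M (?f N)) + 2 * ((cmod b)\<^sup>2 * sqnorm M (?g N))) \<longlonglongrightarrow> 0" by simp
  have eq: "(\<lambda>x. a * f x + b * g x - partial (\<lambda>n. a * c n + b * d n) N x) = (\<lambda>x. a * ?f N x + b * ?g N x)" for N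
    by (rule ext) (simp add: partial_def sum.distrib sum_distrib_left algebra_simps)
  have "sqnorm M (\<lambda>x. a * f x + b * g x - partial (\<lambda>n. a * c n + b * d n) N x)
      \<le> 2 * ((cmod a)\<^sup>2 * sqnorm M (?f N)) + 2 * ((cmod b)\<^sup>2 * sqnorm M (?g N))" for N
    using sqnorm_add_le[of "\<lambda>x. a * ?f N x" M "\<lambda>x. b * ?g N x"] fg unfolding eq
    by (simp add: L2_cmult L2_diff sqnorm_cmult)
  then have "(\<lambda>N. sqnorm M (\<lambda>x. a * f x + b * g x - partial (\<lambda>n. a * c n + b * d n) N x)) \<longlonglongrightarrow> 0"
    by (intro tendsto_sandwich[OF _ _ tendsto_const lim]) auto
  then show ?thesis using fg by (simp add: expands_def L2_add L2_cmult)
qed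

text \<open>Mean-square convergence gives \<open>L1\<close> convergence and hence an almost
  everywhere convergent subsequence, whose limit on \<open>A\<close> can only be \<open>g\<close>.
  This identifies an abstract limit with a power series inside the disc.\<close>

lemma expands_pointwise_AE:
  assumes ex: "expands c f" and A: "\<And>x. x \<in> A \<Longrightarrow> (\<lambda>N. partial c N x) \<longlonglongrightarrow> g x"
  shows "AE x in M. x \<in> A \<longrightarrow> f x = g x"
proof -
  let ?h = "\<lambda>N x. f x - partial c N x"
  have f: "f \<in> L2 M" and lim: "(\<lambda>N. sqnorm M (?h N)) \<longlonglongrightarrow> 0"
    using ex by (auto simp: expands_def)
  have h: "?h N \<in> L2 M" for N using f by (intro L2_diff) auto
  have "(\<lambda>N. LINT x|M. norm (?h N x)) \<longlonglongrightarrow> 0"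
  proof (rule tendsto_sandwich[OF _ _ tendsto_const])
    show "(\<lambda>N. sqrt (sqnorm M (?h N))) \<longlonglongrightarrow> 0" using tendsto_real_sqrt[OF lim] by simp
    have "(LINT x|M. norm (?h N x)) \<le> sqrt (sqnorm M (?h N))" for N
      using integral_norm_square_le(2)[OF h[of N]] by (intro real_le_rsqrt) simp
    then show "\<forall>\<^sub>F N in sequentially. (LINT x|M. norm (?h N x)) \<le> sqrt (sqnorm M (?h N))" by simp
  qed (simp add: always_eventually)
  then obtain r where r: "strict_mono r" "AE x in M. (\<lambda>n. ?h (r n) x) \<longlonglongrightarrow> 0"
    using tendsto_L1_AE_subseq[of M ?h] integral_norm_square_le(1)[OF h] by blast
  from r(2) show ?thesis
  proof eventually_elim
    case (elim x)
    show ?case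
    proof
      assume "x \<in> A"
      then have "(\<lambda>n. partial c (r n) x) \<longlonglongrightarrow> g x"
        using LIMSEQ_subseq_LIMSEQ[OF A r(1)] by (simp add: o_def)
      then have "(\<lambda>n. f x - partial c (r n) x) \<longlonglongrightarrow> f x - g x" by (intro tendsto_intros)
      then have "f x - g x = 0" using elim LIMSEQ_unique by blast
      then show "f x = g x" by simp
    qed
  qed
qed

theorem riesz_fischer:
  assumes c: "summable (\<lambda>n. (cmod (c n))\<^sup>2)" shows "\<exists>f. expands c f"
proof -
  \<comment> \<open>Along \<open>r\<close> the tails decay like \<open>4\<^sup>-\<^sup>k\<close>, which makes the partial sums converge almost everywhere.\<close>
  define tail where "tail N = (\<Sum>n. (cmod (c (n + N)))\<^sup>2)" for N
  have tail0: "tail \<longlonglongrightarrow> 0" unfolding tail_def using suminf_exist_split2[OF c] by simp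
  have ex: "\<exists>N>m. tail N \<le> (1/4) ^ k" for m k :: nat
  proof -
    have "\<forall>\<^sub>F N in sequentially. tail N < (1/4) ^ k"
      using order_tendstoD(2)[OF tail0] by simp
    then have "\<forall>\<^sub>F N in sequentially. tail N < (1/4) ^ k \<and> N > m"
      using eventually_gt_at_top[of m] by eventually_elim simp
    then obtain N where "tail N < (1/4) ^ k \<and> N > m" using eventually_happens'[OF sequentially_bot] by blast
    then show ?thesis by (intro exI[of _ N]) simp
  qed
  define r where "r = rec_nat (SOME N. tail N \<le> (1/4) ^ 0) (\<lambda>k m. SOME N. N > m \<and> tail N \<le> (1/4) ^ Suc k)"
  have r_Suc: "r (Suc k) > r k \<and> tail (r (Suc k)) \<le> (1/4) ^ Suc k" for k
    unfolding r_def by (simp del: power_Suc) (rule someI_ex, use ex[of _ "Suc k"] in blast)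
  have r_0: "tail (r 0) \<le> (1/4) ^ 0"
    unfolding r_def by (simp del: power_0) (rule someI_ex, use ex[of 0 0] in blast)
  have r_tail: "tail (r k) \<le> (1/4) ^ k" for k using r_0 r_Suc by (cases k) auto
  have r_mono: "strict_mono r" using r_Suc by (simp add: strict_mono_Suc_iff)
  have block: "(\<Sum>n=K..<N. (cmod (c n))\<^sup>2) \<le> tail K" for K N
  proof -
    have "(\<Sum>n=K..<N. (cmod (c n))\<^sup>2) \<le> (\<Sum>n<N. (cmod (c (n + K)))\<^sup>2)"
    proof -
      have "(\<Sum>n=K..<N. (cmod (c n))\<^sup>2) \<le> (\<Sum>n=K..<N + K. (cmod (c n))\<^sup>2)" by (intro sum_mono2) auto
      also have "\<dots> = (\<Sum>n<N. (cmod (c (n + K)))\<^sup>2)"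
        using sum.shift_bounds_nat_ivl[of "\<lambda>n. (cmod (c n))\<^sup>2" 0 K N] by (simp add: atLeast0LessThan)
      finally show ?thesis .
    qed
    also have "\<dots> \<le> tail K"
      unfolding tail_def using c by (intro sum_le_suminf summable_ignore_initial_segment) auto
    finally show ?thesis .
  qed
  have diff: "sqnorm M (\<lambda>x. partial c N x - partial c K x) \<le> tail K" if "K \<le> N" for K N
  proof -
    have "partial c N x - partial c K x = partial (\<lambda>n. if K \<le> n then c n else 0) N x" for x
    proof -
      have "partial c N x = (\<Sum>n<N. (if K \<le> n then c n else 0) * e n x + (if n < K then c n * e n x else 0))"
        unfolding partial_def by (intro sum.cong) auto
      also have "\<dots> = partial (\<lambda>n. if K \<le> n then c n else 0) N x + (\<Sum>n<N. if n < K then c n * e n x else 0)"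
        by (simp add: sum.distrib partial_def)
      also have "(\<Sum>n<N. if n < K then c n * e n x else 0) = partial c K x"
        unfolding partial_def using that by (intro sum.mono_neutral_cong_right) auto
      finally show ?thesis by simp
    qed
    then have "sqnorm M (\<lambda>x. partial c N x - partial c K x) = (\<Sum>n<N. (cmod (if K \<le> n then c n else 0))\<^sup>2)"
      by (simp add: sqnorm_partial[unfolded partial_def[abs_def]] partial_def)
    also have "\<dots> = (\<Sum>n=K..<N. (cmod (c n))\<^sup>2)"
      by (intro sum.mono_neutral_cong_right) auto
    also have "\<dots> \<le> tail K" by (rule block)
    finally show ?thesis .
  qed
  define D where "D k x = partial c (r (Suc k)) x - partial c (r k) x" for k x
  have D_L2: "D k \<in> L2 M" for k unfolding D_def[abs_def] by (intro L2_diff) auto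
  have D_int: "integrable M (D k)" "(LINT x|M. norm (D k x)) \<le> (1/2) ^ k" for k
  proof -
    show "integrable M (D k)" by (rule integral_norm_square_le(1)[OF D_L2])
    have "(LINT x|M. norm (D k x))\<^sup>2 \<le> sqnorm M (D k)" by (rule integral_norm_square_le(2)[OF D_L2])
    also have "\<dots> \<le> tail (r k)" unfolding D_def[abs_def] using r_Suc[of k] by (intro diff) simp
    also have "\<dots> \<le> ((1/2) ^ k)\<^sup>2" using r_tail[of k] by (simp add: power2_eq_square power_mult_distrib[symmetric])
    finally show "(LINT x|M. norm (D k x)) \<le> (1/2) ^ k" by (rule power2_le_imp_le) simp
  qed
  note [measurable] = L2_measurable[OF D_L2] L2_measurable[OF partial_L2]
  have AE_sm: "AE x in M. summable (\<lambda>k. norm (D k x))"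
  proof -
    have nn: "(\<integral>\<^sup>+x. ennreal (norm (D k x)) \<partial>M) \<le> ennreal ((1/2) ^ k)" for k
      using D_int[of k] by (subst nn_integral_eq_integral) (auto intro: ennreal_leI)
    have "(\<integral>\<^sup>+x. (\<Sum>k. ennreal (norm (D k x))) \<partial>M) = (\<Sum>k. \<integral>\<^sup>+x. ennreal (norm (D k x)) \<partial>M)"
      by (rule nn_integral_suminf) measurable
    also have "\<dots> \<le> (\<Sum>k. ennreal ((1/2) ^ k))" by (intro suminf_le nn) auto
    also have "\<dots> = ennreal (\<Sum>k. (1/2) ^ k)" by (rule suminf_ennreal2) (auto intro: summable_geometric)
    finally have "(\<integral>\<^sup>+x. (\<Sum>k. ennreal (norm (D k x))) \<partial>M) \<noteq> \<infinity>"
      by (auto simp: top_unique)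
    then have "AE x in M. (\<Sum>k. ennreal (norm (D k x))) \<noteq> \<infinity>"
      by (intro nn_integral_PInf_AE) auto
    then show ?thesis by eventually_elim (auto intro!: summable_suminf_not_top)
  qed
  \<comment> \<open>\<open>lim\<close> is total: the values where the sequence diverges are
    arbitrary, but the function is measurable everywhere.\<close>
  define f where "f x = lim (\<lambda>k. partial c (r k) x)" for x
  have f_meas [measurable]: "f \<in> borel_measurable M"
    unfolding f_def by (rule borel_measurable_lim_metric) measurable
  have f_lim: "AE x in M. (\<lambda>k. partial c (r k) x) \<longlonglongrightarrow> f x"
    using AE_sm
  proof eventually_elim
    case (elim x)
    then have "summable (\<lambda>k. D k x)" by (rule summable_norm_cancel)
    then have "(\<lambda>K. \<Sum>k<K. D k x) \<longlonglongrightarrow> (\<Sum>k. D k x)" by (rule summable_LIMSEQ)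
    moreover have "(\<Sum>k<K. D k x) = partial c (r K) x - partial c (r 0) x" for K
      unfolding D_def by (rule sum_lessThan_telescope)
    ultimately have "(\<lambda>K. partial c (r K) x - partial c (r 0) x + partial c (r 0) x) \<longlonglongrightarrow> (\<Sum>k. D k x) + partial c (r 0) x"
      by (intro tendsto_add tendsto_const) simp
    then have "convergent (\<lambda>K. partial c (r K) x)" by (simp add: convergent_def) blast
    then show ?case unfolding f_def by (simp add: convergent_LIMSEQ_iff)
  qed
  \<comment> \<open>Fatou's lemma along the subsequence bounds the distance to every partial sum,
    not only to those with an index in the range of \<open>r\<close>.\<close>
  have nn_bound: "(\<integral>\<^sup>+x. ennreal ((cmod (f x - partial c N x))\<^sup>2) \<partial>M) \<le> ennreal (tail N)" for N
  proof -
    have "(\<integral>\<^sup>+x. ennreal ((cmod (f x - partial c N x))\<^sup>2) \<partial>M)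
        = (\<integral>\<^sup>+x. liminf (\<lambda>k. ennreal ((cmod (partial c (r k) x - partial c N x))\<^sup>2)) \<partial>M)"
    proof (rule nn_integral_cong_AE)
      show "AE x in M. ennreal ((cmod (f x - partial c N x))\<^sup>2)
          = liminf (\<lambda>k. ennreal ((cmod (partial c (r k) x - partial c N x))\<^sup>2))"
        using f_lim
      proof eventually_elim
        case (elim x)
        then have "(\<lambda>k. ennreal ((cmod (partial c (r k) x - partial c N x))\<^sup>2)) \<longlonglongrightarrow> ennreal ((cmod (f x - partial c N x))\<^sup>2)"
          by (intro tendsto_intros)
        then show ?case by (intro lim_imp_Liminf[symmetric]) auto
      qed
    qed
    also have "\<dots> \<le> liminf (\<lambda>k. \<integral>\<^sup>+x. ennreal ((cmod (partial c (r k) x - partial c N x))\<^sup>2) \<partial>M)"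
      by (rule nn_integral_liminf) measurable
    also have "\<dots> \<le> liminf (\<lambda>k. ennreal (tail N))"
    proof (rule Liminf_mono)
      show "\<forall>\<^sub>F k in sequentially. (\<integral>\<^sup>+x. ennreal ((cmod (partial c (r k) x - partial c N x))\<^sup>2) \<partial>M) \<le> ennreal (tail N)"
        using eventually_ge_at_top[of N]
      proof eventually_elim
        case (elim k)
        then have "N \<le> r k" using r_mono seq_suble le_trans by blast
        have "(\<lambda>x. partial c (r k) x - partial c N x) \<in> L2 M" by (intro L2_diff) auto
        then have "(\<integral>\<^sup>+x. ennreal ((cmod (partial c (r k) x - partial c N x))\<^sup>2) \<partial>M)
            = ennreal (sqnorm M (\<lambda>x. partial c (r k) x - partial c N x))"
          unfolding sqnorm_def by (intro nn_integral_eq_integral L2_integrable) auto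
        then show ?case using diff[OF \<open>N \<le> r k\<close>] by (simp add: ennreal_leI)
      qed
    qed
    also have "\<dots> = ennreal (tail N)" by (simp add: Liminf_const)
    finally show ?thesis .
  qed
  have dL2: "(\<lambda>x. f x - partial c N x) \<in> L2 M" for N
    unfolding L2_def
  proof safe
    show "integrable M (\<lambda>x. (cmod (f x - partial c N x))\<^sup>2)"
      using nn_bound[of N] by (intro integrableI_bounded) (auto simp: top_unique less_top[symmetric])
  qed measurable
  have "f \<in> L2 M" using dL2[of 0] by (simp add: partial_def)
  moreover have "(\<lambda>N. sqnorm M (\<lambda>x. f x - partial c N x)) \<longlonglongrightarrow> 0"
  proof (rule tendsto_sandwich[OF _ _ tendsto_const tail0])
    have "sqnorm M (\<lambda>x. f x - partial c N x) \<le> tail N" for N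
    proof -
      have "ennreal (sqnorm M (\<lambda>x. f x - partial c N x)) \<le> ennreal (tail N)"
        using nn_bound[of N] L2_integrable[OF dL2[of N]] unfolding sqnorm_def
        by (subst (asm) nn_integral_eq_integral) auto
      moreover have "0 \<le> tail N" using block[of N 0] by simp
      ultimately show ?thesis by (simp add: ennreal_le_iff)
    qed
    then show "\<forall>\<^sub>F N in sequentially. sqnorm M (\<lambda>x. f x - partial c N x) \<le> tail N" by simp
  qed simp
  ultimately show ?thesis unfolding expands_def by blast
qed

end

section \<open>The weighted space on the interval\<close>

locale bargmann_parameters = q_parameter +
  fixes \<alpha> :: real
  assumes alpha_gt: "- 1 < \<alpha>" and alpha_less: "\<alpha> < q"
begin

definition sqrt_alpha :: complex where "sqrt_alpha = csqrt (of_real \<alpha>)"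

lemma sqrt_alpha_square: "sqrt_alpha\<^sup>2 = of_real \<alpha>" "sqrt_alpha * - sqrt_alpha = - of_real \<alpha>" "sqrt_alpha * sqrt_alpha = of_real \<alpha>"
  by (simp_all add: sqrt_alpha_def flip: power2_eq_square)

lemma norm_sqrt_alpha: "norm sqrt_alpha < 1"
proof -
  have "norm sqrt_alpha ^ 2 = \<bar>\<alpha>\<bar>" by (simp add: norm_power[symmetric] sqrt_alpha_square)
  then have "norm sqrt_alpha ^ 2 < 1 ^ 2" using alpha_gt alpha_less q_less_1 by simp
  then show ?thesis by (rule power_less_imp_less_base) simp
qed

text \<open>The root is real or purely imaginary according to the sign of \<open>\<alpha>\<close>.
  In both cases the pair of parameters is closed under conjugation, which is the source of the
  reality and positivity of the weight.\<close>

lemma cnj_sqrt_alpha: "cnj sqrt_alpha = sqrt_alpha \<or> cnj sqrt_alpha = - sqrt_alpha"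
proof -
  have "(cnj sqrt_alpha)\<^sup>2 = sqrt_alpha\<^sup>2" using sqrt_alpha_square(1) by (metis complex_cnj_complex_of_real complex_cnj_power)
  then show ?thesis by (simp add: power2_eq_iff)
qed

definition rec_coeff :: "nat \<Rightarrow> real" where
  "rec_coeff n = (1 + \<alpha> * q ^ n) * (1 - q ^ Suc n)"

definition asc_angle :: "nat \<Rightarrow> real \<Rightarrow> complex" where
  "asc_angle n \<theta> = asc sqrt_alpha (- sqrt_alpha) (cis \<theta>) n"

text \<open>The reciprocal of the squared norm of \<open>asc_angle n\<close>: the coefficients
  \<open>asc\<close> are the polynomials \<open>Q_n\<close> divided by exactly this product.\<close>

definition asc_norm :: "nat \<Rightarrow> real" where
  "asc_norm n = qpoch (- \<alpha>) q n * qpoch q q n"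

lemma asc_norm_pos: "0 < asc_norm n"
  unfolding asc_norm_def using alpha_gt q_less_1 by (intro mult_pos_pos qpoch_real_pos) auto

lemma norm_sqrt_alpha_square: "norm (sqrt_alpha * - sqrt_alpha) < 1" "norm (sqrt_alpha\<^sup>2) < 1"
  using mult_strict_mono'[OF norm_sqrt_alpha norm_sqrt_alpha] by (simp_all add: norm_mult power2_eq_square)

lemma rec_coeff_nonzero: "rec_coeff n \<noteq> 0"
proof -
  have "qpoch (- \<alpha>) q (Suc n) \<noteq> 0" using qpoch_real_pos[of "- \<alpha>" "Suc n"] alpha_gt by simp
  moreover have "q ^ Suc n < 1" by (rule qpow_less_1)
  ultimately show ?thesis by (simp add: rec_coeff_def qpoch_Suc)
qed

lemma two_cos: "cis \<theta> + 1 / cis \<theta> = of_real (2 * cos \<theta>)"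
  using cis_divide[of 0 \<theta>] by (simp add: complex_eq_iff)

lemma asc_angle_0 [simp]: "asc_angle 0 \<theta> = 1"
  by (simp add: asc_angle_def)

lemma asc_angle_recurrence:
  "of_real (2 * cos \<theta>) * asc_angle n \<theta> = of_real (rec_coeff n) * asc_angle (Suc n) \<theta> + (if n = 0 then 0 else asc_angle (n - 1) \<theta>)"
  using asc_symmetric_recurrence[of "cis \<theta>" sqrt_alpha n] norm_sqrt_alpha_square(2)
  by (simp add: asc_angle_def two_cos sqrt_alpha_square rec_coeff_def)

lemma asc_angle_Suc: "asc_angle (Suc n) \<theta> = (of_real (2 * cos \<theta>) * asc_angle n \<theta> - (if n = 0 then 0 else asc_angle (n - 1) \<theta>)) / of_real (rec_coeff n)"
  using asc_angle_recurrence[of \<theta> n] rec_coeff_nonzero[of n] by (simp add: field_simps)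

text \<open>Neither property is visible in the convolution, where the root may be imaginary and
  \<open>u\<close> and \<open>1 / u\<close> play different roles; the recurrence, however, has real
  coefficients and contains the angle only through its cosine.\<close>

lemma asc_angle_even_real: "asc_angle n (- \<theta>) = asc_angle n \<theta> \<and> cnj (asc_angle n \<theta>) = asc_angle n \<theta>"
proof (induction n rule: less_induct)
  case (less n)
  show ?case
  proof (cases n)
    case (Suc m)
    have "asc_angle m (- \<theta>) = asc_angle m \<theta>" "cnj (asc_angle m \<theta>) = asc_angle m \<theta>" "asc_angle (m - 1) (- \<theta>) = asc_angle (m - 1) \<theta>" "cnj (asc_angle (m - 1) \<theta>) = asc_angle (m - 1) \<theta>"
      using less[of m] less[of "m - 1"] Suc by auto
    then show ?thesis unfolding Suc asc_angle_Suc[of m] by simp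
  qed simp
qed

lemma asc_angle_continuous [continuous_intros]: "continuous_on S (asc_angle n)"
  unfolding asc_angle_def by (rule asc_continuous)

lemma asc_angle_bound: "norm (asc_angle n \<theta>) \<le> (real n + 1) * asc_const (sqrt_alpha * - sqrt_alpha)"
  unfolding asc_angle_def using norm_sqrt_alpha norm_sqrt_alpha_square by (intro asc_bound) auto

definition angle :: "real \<Rightarrow> real" where
  "angle x = arccos (x * sqrt (1 - q) / 2)"

lemma sqrt_pos: "0 < sqrt (1 - q)"
  using q_less_1 by simp

lemma Iq_iff: "x \<in> Iq q \<longleftrightarrow> x * sqrt (1 - q) / 2 \<in> {-1<..<1}"
  using sqrt_pos by (auto simp: Iq_def field_simps)

lemma cos_angle: "x \<in> Iq q \<Longrightarrow> 2 * cos (angle x) = x * sqrt (1 - q)"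
  unfolding Iq_iff angle_def by (subst cos_arccos) auto

lemma angle_bounds: "x \<in> Iq q \<Longrightarrow> angle x \<in> {0<..<pi}"
  unfolding Iq_iff angle_def using arccos_lt_bounded by auto

lemma phi_fun_asc_angle: "phi_fun q \<alpha> n x = of_real (sqrt (asc_norm n)) * asc_angle n (angle x)"
proof -
  have "al_salam_chihara n (x * sqrt (1 - q) / 2) sqrt_alpha (- sqrt_alpha) q = qpoch (sqrt_alpha * - sqrt_alpha) Q n * qpoch Q Q n * asc_angle n (angle x)"
    unfolding asc_angle_def angle_def using norm_sqrt_alpha_square(1) by (intro al_salam_chihara_conv_asc) auto
  also have "qpoch (sqrt_alpha * - sqrt_alpha) Q n * qpoch Q Q n = of_real (asc_norm n)"
    by (simp add: sqrt_alpha_square asc_norm_def qpoch_of_real of_real_minus[symmetric] del: of_real_minus)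
  finally have "phi_fun q \<alpha> n x = of_real (1 / sqrt (asc_norm n) * asc_norm n) * asc_angle n (angle x)"
    by (simp add: phi_fun_def sqrt_alpha_def asc_norm_def)
  also have "1 / sqrt (asc_norm n) * asc_norm n = sqrt (asc_norm n)"
    using asc_norm_pos[of n] by (simp add: real_div_sqrt)
  finally show ?thesis .
qed

lemma cnj_phi_fun: "cnj (phi_fun q \<alpha> n x) = phi_fun q \<alpha> n x"
  by (simp add: phi_fun_asc_angle asc_angle_even_real)

subsection \<open>The weight\<close>

text \<open>Each quadratic factor splits, because \<open>e^(i \<theta>)\<close> and
  \<open>e^(-i \<theta>)\<close> have product 1 and sum
  \<open>2 cos \<theta> = x sqrt (1 - q)\<close>.\<close>

lemma gfun_pair_inf:
  assumes "x \<in> Iq q" shows "gfun q x \<gamma> = pair_inf \<gamma> (angle x)"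
proof -
  let ?u = "cis (angle x)"
  have "pair_inf \<gamma> (angle x) = (\<Prod>k. (1 - \<gamma> * ?u * Q ^ k) * (1 - \<gamma> * cis (- angle x) * Q ^ k))"
    unfolding pair_inf_def qpoch_inf_def by (rule prodinf_mult[OF convergent_qpoch convergent_qpoch])
  also have "\<dots> = gfun q x \<gamma>"
    unfolding gfun_def
  proof (rule prodinf_cong)
    fix k
    have sum: "?u + cis (- angle x) = of_real (x * sqrt (1 - q))"
      using cos_angle[OF assms] by (simp add: complex_eq_iff)
    have prod: "?u * cis (- angle x) = 1" by (simp add: cis_mult)
    have "(1 - \<gamma> * ?u * Q ^ k) * (1 - \<gamma> * cis (- angle x) * Q ^ k)
        = 1 - \<gamma> * ((?u + cis (- angle x)) * Q ^ k) + \<gamma>\<^sup>2 * (?u * cis (- angle x)) * (Q ^ k)\<^sup>2"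
      by (simp only: power2_eq_square) (simp add: algebra_simps)
    then show "(1 - \<gamma> * ?u * Q ^ k) * (1 - \<gamma> * cis (- angle x) * Q ^ k)
       = 1 - \<gamma> * of_real (x * sqrt (1 - q) * q ^ k) + \<gamma>\<^sup>2 * of_real (q ^ (2 * k))"
      unfolding sum prod by (simp add: power_mult[symmetric] mult.commute)
  qed
  finally show ?thesis by simp
qed

text \<open>The factors with \<open>s\<close> and \<open>-s\<close> give
  \<open>1 - s^2 q^(2k)\<close>, those with the root of \<open>q\<close> give
  \<open>1 - s^2 q^(2k+1)\<close>; together they run through all factors on the right. Hence
  \<open>N\<close> factors of each product match \<open>2 N\<close>. At
  \<open>s = e^(i \<theta>)\<close> and \<open>s = e^(-i \<theta>)\<close> this collapses the
  numerator of the weight.\<close>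

lemma qpoch_inf_quadruple:
  "qpoch_inf s Q * qpoch_inf (- s) Q * qpoch_inf (of_real (sqrt q) * s) Q * qpoch_inf (- of_real (sqrt q) * s) Q
    = qpoch_inf (s\<^sup>2) Q"
proof (rule LIMSEQ_unique)
  let ?r = "of_real (sqrt q) :: complex"
  show "(\<lambda>N. qpoch s Q N * qpoch (- s) Q N * qpoch (?r * s) Q N * qpoch (- ?r * s) Q N)
     \<longlonglongrightarrow> qpoch_inf s Q * qpoch_inf (- s) Q * qpoch_inf (?r * s) Q * qpoch_inf (- ?r * s) Q"
    by (intro tendsto_mult qpoch_tendsto)
  have r2: "?r * ?r = Q" using q_pos by (simp flip: of_real_mult)
  have "qpoch s Q N * qpoch (- s) Q N * qpoch (?r * s) Q N * qpoch (- ?r * s) Q N = qpoch (s\<^sup>2) Q (2 * N)" for N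
  proof (induction N)
    case (Suc N)
    define w where "w = Q ^ N"
    have w2: "Q ^ (2 * N) = w * w" by (simp add: w_def mult_2 power_add)
    have "(1 - s * w) * (1 - - s * w) * (1 - ?r * s * w) * (1 - - ?r * s * w) = (1 - s\<^sup>2 * (w * w)) * (1 - s\<^sup>2 * (?r * ?r) * (w * w))"
      by (simp add: power2_eq_square algebra_simps)
    also have "\<dots> = (1 - s\<^sup>2 * Q ^ (2 * N)) * (1 - s\<^sup>2 * Q ^ Suc (2 * N))"
      unfolding r2 w2 power_Suc by (simp add: mult_ac)
    finally have "(1 - s * w) * (1 - - s * w) * (1 - ?r * s * w) * (1 - - ?r * s * w) = \<dots>" .
    moreover have "qpoch s Q (Suc N) * qpoch (- s) Q (Suc N) * qpoch (?r * s) Q (Suc N) * qpoch (- ?r * s) Q (Suc N)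
      = (qpoch s Q N * qpoch (- s) Q N * qpoch (?r * s) Q N * qpoch (- ?r * s) Q N) *
        ((1 - s * w) * (1 - - s * w) * (1 - ?r * s * w) * (1 - - ?r * s * w))"
      unfolding qpoch_Suc w_def by (simp only: mult_ac)
    ultimately have "qpoch s Q (Suc N) * qpoch (- s) Q (Suc N) * qpoch (?r * s) Q (Suc N) * qpoch (- ?r * s) Q (Suc N)
      = qpoch (s\<^sup>2) Q (2 * N) * ((1 - s\<^sup>2 * Q ^ (2 * N)) * (1 - s\<^sup>2 * Q ^ Suc (2 * N)))"
      using Suc by simp
    then show ?case by (simp add: qpoch_Suc mult.assoc)
  qed simp
  then show "(\<lambda>N. qpoch s Q N * qpoch (- s) Q N * qpoch (?r * s) Q N * qpoch (- ?r * s) Q N) \<longlonglongrightarrow> qpoch_inf (s\<^sup>2) Q"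
    by (simp only:) (rule filterlim_compose[OF qpoch_tendsto], rule filterlim_subseq, auto simp: strict_mono_def)
qed

lemma hermite_weight_pair_inf:
  "pair_inf 1 \<theta> * pair_inf (- 1) \<theta> * pair_inf (of_real (sqrt q)) \<theta> * pair_inf (- of_real (sqrt q)) \<theta> = hermite_weight \<theta>"
proof -
  have sq: "(cis t)\<^sup>2 = cis (2 * t)" for t by (simp add: Complex.DeMoivre)
  have "hermite_weight \<theta> = qpoch_inf ((cis \<theta>)\<^sup>2) Q * qpoch_inf ((cis (- \<theta>))\<^sup>2) Q"
    unfolding sq hermite_weight_def by simp
  also have "\<dots> = pair_inf 1 \<theta> * pair_inf (- 1) \<theta> * pair_inf (of_real (sqrt q)) \<theta> * pair_inf (- of_real (sqrt q)) \<theta>"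
    unfolding qpoch_inf_quadruple[symmetric] pair_inf_def by (simp add: mult_ac)
  finally show ?thesis by simp
qed

definition angle_weight :: "real \<Rightarrow> complex" where
  "angle_weight \<theta> = hermite_weight \<theta> / (pair_inf sqrt_alpha \<theta> * pair_inf (- sqrt_alpha) \<theta>)"

lemma angle_weight_continuous [continuous_intros]: "continuous_on S angle_weight"
  unfolding angle_weight_def by (intro continuous_intros) (use pair_inf_nonzero norm_sqrt_alpha in auto)

lemma angle_weight_even: "angle_weight (- \<theta>) = angle_weight \<theta>"
  by (simp add: angle_weight_def hermite_weight_def pair_inf_def mult_ac)

lemma cnj_qpoch_inf: "cnj (qpoch_inf s Q) = qpoch_inf (cnj s) Q"
proof (rule LIMSEQ_unique)
  show "(\<lambda>N. cnj (qpoch s Q N)) \<longlonglongrightarrow> cnj (qpoch_inf s Q)" by (intro tendsto_cnj qpoch_tendsto)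
  have "cnj (qpoch s Q N) = qpoch (cnj s) Q N" for N by (simp add: qpoch_def)
  then show "(\<lambda>N. cnj (qpoch s Q N)) \<longlonglongrightarrow> qpoch_inf (cnj s) Q" by (simp add: qpoch_tendsto)
qed

text \<open>Numerator and denominator have the form \<open>A * cnj A\<close>; for the denominator,
  conjugation at most exchanges the parameters \<open>a\<close> and \<open>-a\<close>.\<close>

lemma angle_weight_square: "angle_weight \<theta> = of_real ((norm (qpoch_inf (cis (2 * \<theta>)) Q))\<^sup>2 /
    (norm (qpoch_inf (sqrt_alpha * cis \<theta>) Q * qpoch_inf (- sqrt_alpha * cis \<theta>) Q))\<^sup>2)"
proof -
  let ?A = "qpoch_inf (sqrt_alpha * cis \<theta>) Q * qpoch_inf (- sqrt_alpha * cis \<theta>) Q"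
  have "cnj ?A = qpoch_inf (cnj sqrt_alpha * cis (- \<theta>)) Q * qpoch_inf (- cnj sqrt_alpha * cis (- \<theta>)) Q"
    by (simp add: cnj_qpoch_inf cis_cnj)
  also have "\<dots> = qpoch_inf (sqrt_alpha * cis (- \<theta>)) Q * qpoch_inf (- sqrt_alpha * cis (- \<theta>)) Q"
    using cnj_sqrt_alpha by (auto simp: mult.commute)
  finally have "pair_inf sqrt_alpha \<theta> * pair_inf (- sqrt_alpha) \<theta> = ?A * cnj ?A"
    by (simp add: pair_inf_def mult_ac)
  moreover have "hermite_weight \<theta> = qpoch_inf (cis (2 * \<theta>)) Q * cnj (qpoch_inf (cis (2 * \<theta>)) Q)"
    by (simp add: hermite_weight_def cnj_qpoch_inf cis_cnj)
  ultimately show ?thesis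
    unfolding angle_weight_def by (simp only: complex_norm_square of_real_divide)
qed

lemma angle_weight_real: "angle_weight \<theta> = of_real (Re (angle_weight \<theta>))"
  by (simp add: angle_weight_square)

lemma angle_weight_pos: assumes "\<theta> \<in> {0<..<pi}" shows "0 < Re (angle_weight \<theta>)"
proof -
  have "cis (2 * \<theta>) \<noteq> 1"
  proof
    assume "cis (2 * \<theta>) = 1"
    then have "cos (2 * \<theta>) = 1" by (simp add: complex_eq_iff)
    then have "sin \<theta> = 0" using cos_double_sin[of \<theta>] by simp
    then show False using assms sin_gt_zero[of \<theta>] by simp
  qed
  moreover have "qpoch_inf (cis (2 * \<theta>) * Q) Q \<noteq> 0"
    by (rule qpoch_inf_nonzero) (simp add: norm_mult q_less_1)
  ultimately have "qpoch_inf (cis (2 * \<theta>)) Q \<noteq> 0"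
    using qpoch_inf_split[of "cis (2 * \<theta>)" 1] by (simp add: qpoch_Suc)
  moreover have "qpoch_inf (sqrt_alpha * cis \<theta>) Q \<noteq> 0" "qpoch_inf (- sqrt_alpha * cis \<theta>) Q \<noteq> 0"
    using norm_sqrt_alpha by (auto intro!: qpoch_inf_nonzero simp: norm_mult)
  ultimately show ?thesis unfolding angle_weight_square by simp
qed

definition weight_const :: real where
  "weight_const = qpoch_inf q q * qpoch_inf (- \<alpha>) q / (2 * pi)"

lemma weight_const_pos: "0 < weight_const"
  unfolding weight_const_def using alpha_gt q_less_1 by (auto intro!: divide_pos_pos mult_pos_pos qpoch_inf_real_pos)

lemma weight_angle_weight:
  assumes "x \<in> Iq q"
  shows "weight q \<alpha> x = weight_const * sqrt ((1 - q) / (4 - (1 - q) * x\<^sup>2)) * Re (angle_weight (angle x))"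
  unfolding weight_def gfun_pair_inf[OF assms] hermite_weight_pair_inf angle_weight_def weight_const_def sqrt_alpha_def[symmetric] ..

lemma Iq_square_less:
  assumes "x \<in> Iq q" shows "0 < 4 - (1 - q) * x\<^sup>2"
proof -
  have "\<bar>x * sqrt (1 - q) / 2\<bar> < 1" using assms unfolding Iq_iff by auto
  then have "(x * sqrt (1 - q) / 2)\<^sup>2 < 1" by (simp add: abs_square_less_1)
  then show ?thesis using q_less_1 by (simp add: power_mult_distrib power_divide mult.commute)
qed

lemma weight_pos: assumes "x \<in> Iq q" shows "0 < weight q \<alpha> x"
  unfolding weight_angle_weight[OF assms]
  using assms q_less_1 by (auto intro!: mult_pos_pos weight_const_pos angle_weight_pos angle_bounds divide_pos_pos Iq_square_less)

lemma angle_continuous: "continuous_on (Iq q) angle"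
  unfolding angle_def
  by (rule continuous_on_arccos, intro continuous_intros) (auto simp: Iq_iff)

lemma weight_continuous: "continuous_on (Iq q) (weight q \<alpha>)"
proof -
  have "continuous_on (Iq q) (\<lambda>x. weight_const * sqrt ((1 - q) / (4 - (1 - q) * x\<^sup>2)) * Re (angle_weight (angle x)))"
    by (intro continuous_intros continuous_on_compose2[OF angle_weight_continuous[of UNIV] angle_continuous])
       (use Iq_square_less in force)+
  then show ?thesis by (simp add: weight_angle_weight cong: continuous_on_cong_simp)
qed

lemma phi_fun_continuous: "continuous_on (Iq q) (phi_fun q \<alpha> n)"
  unfolding phi_fun_asc_angle[abs_def]
  by (intro continuous_intros continuous_on_compose2[OF asc_angle_continuous[of UNIV] angle_continuous]) auto

lemma Iq_borel [measurable]: "Iq q \<in> sets borel"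
  by (simp add: Iq_def)

abbreviation H :: "real measure" where "H \<equiv> H_measure q \<alpha>"

lemma sets_H [measurable_cong]: "sets H = sets (restrict_space borel (Iq q))"
  by (simp add: H_measure_def sets_restrict_space)

lemma space_H [simp]: "space H = Iq q"
  by (simp add: H_measure_def space_restrict_space)

lemma measurable_H_continuous: "continuous_on (Iq q) f \<Longrightarrow> f \<in> borel_measurable H"
  using borel_measurable_continuous_on_restrict[of "Iq q" f] by (simp cong: measurable_cong_sets add: sets_H)

lemma H_integrable_iff:
  fixes f :: "real \<Rightarrow> 'a::{banach,second_countable_topology}"
  assumes "f \<in> borel_measurable H"
  shows "integrable H f \<longleftrightarrow> set_integrable lborel (Iq q) (\<lambda>x. weight q \<alpha> x *\<^sub>R f x)"
    and "integral\<^sup>L H f = (LINT x:Iq q|lborel. weight q \<alpha> x *\<^sub>R f x)"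
proof -
  have sets_eq: "sets (restrict_space lborel (Iq q)) = sets H" by (simp add: H_measure_def)
  have f: "f \<in> borel_measurable (restrict_space lborel (Iq q))"
    using assms by (simp cong: measurable_cong_sets add: sets_eq)
  have w: "weight q \<alpha> \<in> borel_measurable (restrict_space lborel (Iq q))"
    using measurable_H_continuous[OF weight_continuous] by (simp cong: measurable_cong_sets add: sets_eq)
  have nn: "AE x in restrict_space lborel (Iq q). 0 \<le> weight q \<alpha> x"
    by (rule AE_I2) (auto simp: space_restrict_space intro: less_imp_le weight_pos)
  have S: "Iq q \<inter> space lborel \<in> sets lborel" by simp
  show "integrable H f \<longleftrightarrow> set_integrable lborel (Iq q) (\<lambda>x. weight q \<alpha> x *\<^sub>R f x)"
    unfolding H_measure_def integrable_density[OF f w nn] integrable_restrict_space[OF S] set_integrable_def ..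
  show "integral\<^sup>L H f = (LINT x:Iq q|lborel. weight q \<alpha> x *\<^sub>R f x)"
    unfolding H_measure_def integral_density[OF f w nn] integral_restrict_space[OF S] set_lebesgue_integral_def ..
qed

section \<open>The substitution by the cosine and orthonormality on the interval\<close>

definition scaled_cos :: "real \<Rightarrow> real" where
  "scaled_cos \<theta> = 2 * cos \<theta> / sqrt (1 - q)"

lemma angle_scaled_cos: "\<theta> \<in> {0<..<pi} \<Longrightarrow> angle (scaled_cos \<theta>) = \<theta>"
  using sqrt_pos by (simp add: angle_def scaled_cos_def arccos_cos)

lemma scaled_cos_image: "scaled_cos ` {0<..<pi} = Iq q"
proof
  show "scaled_cos ` {0<..<pi} \<subseteq> Iq q"
  proof safe
    fix \<theta> assume "\<theta> \<in> {0<..<pi}"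
    then have "\<bar>cos \<theta>\<bar> < 1"
      using cos_monotone_0_pi[of 0 \<theta>] cos_monotone_0_pi[of \<theta> pi] by (simp add: abs_less_iff)
    then show "scaled_cos \<theta> \<in> Iq q" unfolding Iq_iff scaled_cos_def using sqrt_pos by auto
  qed
  show "Iq q \<subseteq> scaled_cos ` {0<..<pi}"
  proof
    fix x assume x: "x \<in> Iq q"
    then have "scaled_cos (angle x) = x" using cos_angle[OF x] sqrt_pos by (simp add: scaled_cos_def)
    then show "x \<in> scaled_cos ` {0<..<pi}" using angle_bounds[OF x] by (metis imageI)
  qed
qed

text \<open>The square root in the weight equals \<open>sqrt (1 - q) / (2 sin \<theta>)\<close> and
  is cancelled by the Jacobian.\<close>

lemma weight_subst:
  assumes "\<theta> \<in> {0<..<pi}"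
  shows "2 * sin \<theta> / sqrt (1 - q) * weight q \<alpha> (scaled_cos \<theta>) = weight_const * Re (angle_weight \<theta>)"
proof -
  have s: "0 < sin \<theta>" using assms by (auto intro: sin_gt_zero)
  have "scaled_cos \<theta> \<in> Iq q" using scaled_cos_image assms by blast
  moreover have "4 - (1 - q) * (scaled_cos \<theta>)\<^sup>2 = (2 * sin \<theta>)\<^sup>2"
    using q_less_1 by (simp add: scaled_cos_def power_divide power_mult_distrib sin_squared_eq)
  moreover have "sqrt ((1 - q) / (2 * sin \<theta>)\<^sup>2) = sqrt (1 - q) / (2 * sin \<theta>)"
    unfolding real_sqrt_divide using s by (subst real_sqrt_unique[of "2 * sin \<theta>"]) auto
  ultimately show ?thesis using s sqrt_pos by (simp add: weight_angle_weight angle_scaled_cos[OF assms])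
qed

lemma integral_half:
  fixes f :: "real \<Rightarrow> complex"
  assumes "continuous_on {-pi..pi} f" "\<And>\<theta>. f (- \<theta>) = f \<theta>"
  shows "integral {-pi..pi} f = 2 * integral {0..pi} f"
proof -
  have "integral {-pi..0} f + integral {0..pi} f = integral {-pi..pi} f"
    by (rule Henstock_Kurzweil_Integration.integral_combine) (auto intro: integrable_continuous_interval assms)
  moreover have "integral {-pi..0} f = integral {0..pi} f"
  proof -
    have "integral {-pi..- 0} (\<lambda>\<theta>. f (- \<theta>)) = integral {0..pi} f" by (rule Henstock_Kurzweil_Integration.integral_reflect_real)
    then show ?thesis by (simp add: assms(2))
  qed
  ultimately show ?thesis by simp
qed

text \<open>Change of variables from \<open>(0, \<pi>)\<close>, where the cosine is injective;
  evenness of the integrand connects it with the full period used for orthogonality.\<close>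

lemma asc_angle_inner:
  shows "set_integrable lborel (Iq q) (\<lambda>x. weight q \<alpha> x *\<^sub>R (asc_angle m (angle x) * asc_angle n (angle x)))"
    and "(LINT x:Iq q|lborel. weight q \<alpha> x *\<^sub>R (asc_angle m (angle x) * asc_angle n (angle x))) = (if m = n then of_real (1 / asc_norm n) else 0)"
proof -
  let ?f = "\<lambda>x. weight q \<alpha> x *\<^sub>R (asc_angle m (angle x) * asc_angle n (angle x))"
  let ?g = "\<lambda>\<theta>. asc_angle m \<theta> * asc_angle n \<theta> * angle_weight \<theta>"
  have gc: "continuous_on S (\<lambda>\<theta>. of_real weight_const * ?g \<theta>)" for S by (intro continuous_intros)
  have sub: "\<bar>- (2 * sin \<theta> / sqrt (1 - q))\<bar> *\<^sub>R ?f (scaled_cos \<theta>) = of_real weight_const * ?g \<theta>" if "\<theta> \<in> {0<..<pi}" for \<theta>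
  proof -
    have "0 < sin \<theta>" using that by (auto intro: sin_gt_zero)
    then have "\<bar>- (2 * sin \<theta> / sqrt (1 - q))\<bar> *\<^sub>R ?f (scaled_cos \<theta>)
       = of_real (2 * sin \<theta> / sqrt (1 - q) * weight q \<alpha> (scaled_cos \<theta>)) * (asc_angle m \<theta> * asc_angle n \<theta>)"
      using sqrt_pos by (simp add: angle_scaled_cos[OF that] scaleR_conv_of_real)
    also have "\<dots> = of_real weight_const * ?g \<theta>"
      unfolding weight_subst[OF that] using angle_weight_real[of \<theta>] by simp
    finally show ?thesis .
  qed
  have der: "(scaled_cos has_field_derivative - (2 * sin \<theta> / sqrt (1 - q))) (at \<theta> within {0<..<pi})" for \<theta>
  proof -
    have "((\<lambda>\<theta>. 2 / sqrt (1 - q) * cos \<theta>) has_field_derivative 2 / sqrt (1 - q) * - sin \<theta>) (at \<theta> within {0<..<pi})"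
      by (intro DERIV_cmult has_field_derivative_at_within[OF DERIV_cos])
    then show ?thesis by (simp add: scaled_cos_def[abs_def])
  qed
  have inj: "inj_on scaled_cos {0<..<pi}" using angle_scaled_cos by (intro inj_on_inverseI[where g = angle]) auto
  have "(\<lambda>\<theta>. of_real weight_const * ?g \<theta>) absolutely_integrable_on {0..pi}"
    by (intro absolutely_integrable_continuous_real gc)
  then have abs: "(\<lambda>\<theta>. of_real weight_const * ?g \<theta>) absolutely_integrable_on {0<..<pi}"
    by (rule set_integrable_subset) auto
  then have abs': "(\<lambda>\<theta>. \<bar>- (2 * sin \<theta> / sqrt (1 - q))\<bar> *\<^sub>R ?f (scaled_cos \<theta>)) absolutely_integrable_on {0<..<pi}"
    using sub by (subst set_integrable_cong[OF refl refl]) auto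
  have int': "integral {0<..<pi} (\<lambda>\<theta>. \<bar>- (2 * sin \<theta> / sqrt (1 - q))\<bar> *\<^sub>R ?f (scaled_cos \<theta>)) = integral {0..pi} (\<lambda>\<theta>. of_real weight_const * ?g \<theta>)"
    unfolding integral_open_interval_real using sub by (rule Henstock_Kurzweil_Integration.integral_cong)
  have res: "?f absolutely_integrable_on Iq q \<and> integral (Iq q) ?f = integral {0..pi} (\<lambda>\<theta>. of_real weight_const * ?g \<theta>)"
    unfolding scaled_cos_image[symmetric]
    by (rule has_absolute_integral_change_of_variables_real[THEN iffD1, OF _ der inj conjI[OF abs' int']]) simp
  \<comment> \<open>The change of variables gives integrability for the completed measure; Borel
    measurability brings it back to \<open>lborel\<close>.\<close>
  have meas: "(\<lambda>x. indicator (Iq q) x *\<^sub>R ?f x) \<in> borel_measurable borel"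
  proof -
    have "continuous_on (Iq q) ?f"
      by (intro continuous_intros weight_continuous continuous_on_compose2[OF asc_angle_continuous[of UNIV] angle_continuous]) auto
    then have "?f \<in> borel_measurable (restrict_space borel (Iq q))"
      by (rule borel_measurable_continuous_on_restrict)
    then show ?thesis by (subst (asm) borel_measurable_restrict_space_iff) auto
  qed
  show si: "set_integrable lborel (Iq q) ?f"
    using res meas integrable_completion[of "\<lambda>x. indicator (Iq q) x *\<^sub>R ?f x" lborel] by (simp add: set_integrable_def)
  have "(LINT x:Iq q|lborel. ?f x) = integral {0..pi} (\<lambda>\<theta>. of_real weight_const * ?g \<theta>)"
    using set_borel_integral_eq_integral(2)[OF si] res by simp
  also have "\<dots> = of_real weight_const * (integral {-pi..pi} ?g / 2)"
    by (subst integral_half) (auto intro!: continuous_intros simp: asc_angle_even_real angle_weight_even)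
  also have "integral {-pi..pi} ?g = (if m = n then of_real (4 * pi) / (qpoch_inf Q Q * qpoch_inf (- (sqrt_alpha\<^sup>2)) Q) / (qpoch (- (sqrt_alpha\<^sup>2)) Q n * qpoch Q Q n) else 0)"
    unfolding asc_angle_def angle_weight_def by (rule asc_orthogonality_weight[OF norm_sqrt_alpha])
  also have "qpoch (- (sqrt_alpha\<^sup>2)) Q n * qpoch Q Q n = of_real (asc_norm n)"
    unfolding asc_norm_def sqrt_alpha_square by (simp add: qpoch_of_real of_real_minus[symmetric] del: of_real_minus)
  also have "qpoch_inf Q Q * qpoch_inf (- (sqrt_alpha\<^sup>2)) Q = of_real (weight_const * (2 * pi))"
    unfolding weight_const_def sqrt_alpha_square using qpoch_inf_of_real[of q, where 'a = complex] qpoch_inf_of_real[of "- \<alpha>", where 'a = complex] by simp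
  \<comment> \<open>The constant of the weight is chosen for this point: \<open>4 \<pi>\<close> is
    divided by \<open>2 \<pi>\<close> and by the 2 from halving the period.\<close>
  also have "of_real weight_const * ((if m = n then of_real (4 * pi) / of_real (weight_const * (2 * pi)) / of_real (asc_norm n) else 0) / 2)
      = (if m = n then complex_of_real (1 / asc_norm n) else 0)"
    using weight_const_pos by simp
  finally show "(LINT x:Iq q|lborel. ?f x) = (if m = n then of_real (1 / asc_norm n) else 0)" .
qed

lemma phi_fun_measurable [measurable]: "phi_fun q \<alpha> n \<in> borel_measurable H"
  by (intro measurable_H_continuous phi_fun_continuous)

lemma phi_fun_inner:
  "integrable H (\<lambda>x. phi_fun q \<alpha> m x * phi_fun q \<alpha> n x)"
  "(LINT x|H. phi_fun q \<alpha> m x * phi_fun q \<alpha> n x) = (if m = n then 1 else 0)"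
proof -
  have eq: "(\<lambda>x. weight q \<alpha> x *\<^sub>R (phi_fun q \<alpha> m x * phi_fun q \<alpha> n x))
      = (\<lambda>x. of_real (sqrt (asc_norm m) * sqrt (asc_norm n)) * (weight q \<alpha> x *\<^sub>R (asc_angle m (angle x) * asc_angle n (angle x))))"
    by (simp add: phi_fun_asc_angle fun_eq_iff scaleR_conv_of_real)
  have m: "(\<lambda>x. phi_fun q \<alpha> m x * phi_fun q \<alpha> n x) \<in> borel_measurable H" by measurable
  show "integrable H (\<lambda>x. phi_fun q \<alpha> m x * phi_fun q \<alpha> n x)"
    unfolding H_integrable_iff(1)[OF m] eq by (intro set_integrable_mult_right asc_angle_inner)
  have "sqrt (asc_norm n) * sqrt (asc_norm n) = asc_norm n" using asc_norm_pos[of n] by simp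
  then show "(LINT x|H. phi_fun q \<alpha> m x * phi_fun q \<alpha> n x) = (if m = n then 1 else 0)"
    unfolding H_integrable_iff(2)[OF m] eq set_integral_mult_right asc_angle_inner
    using asc_norm_pos[of n] by (simp flip: of_real_mult)
qed

lemma phi_fun_L2: "phi_fun q \<alpha> n \<in> L2 H"
proof -
  have "(cmod z)\<^sup>2 = Re (z * z)" if "cnj z = z" for z
    using that by (metis Re_complex_of_real complex_norm_square)
  then have eq: "(\<lambda>x. (cmod (phi_fun q \<alpha> n x))\<^sup>2) = (\<lambda>x. Re (phi_fun q \<alpha> n x * phi_fun q \<alpha> n x))"
    by (simp only: cnj_phi_fun)
  have "integrable H (\<lambda>x. (cmod (phi_fun q \<alpha> n x))\<^sup>2)"
    unfolding eq by (rule integrable_Re[OF phi_fun_inner(1)])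
  then show ?thesis by (simp add: L2_def)
qed

lemma phi_fun_0: "phi_fun q \<alpha> 0 x = 1"
  by (simp add: phi_fun_asc_angle asc_norm_def)

sublocale H: orthonormal_sequence H "phi_fun q \<alpha>"
proof -
  have int: "integrable H (\<lambda>x. 1 :: complex)" using phi_fun_inner(1)[of 0 0] by (simp add: phi_fun_0)
  have "(LINT x|H. (1 :: complex)) = 1" using phi_fun_inner(2)[of 0 0] by (simp add: phi_fun_0)
  then have "complex_of_real (measure H (space H)) = 1" by (simp add: scaleR_conv_of_real)
  then have total: "measure H (space H) = 1" by (simp only: of_real_eq_1_iff)
  have "emeasure H (space H) \<noteq> \<infinity>"
    using int by (simp add: integrable_iff_bounded less_top[symmetric])
  then have "finite_measure H" by (rule finite_measureI)
  moreover have "L2_inner H (phi_fun q \<alpha> m) (phi_fun q \<alpha> n) = (if m = n then 1 else 0)" for m n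
    using phi_fun_inner(2)[of m n] by (simp add: L2_inner_def cnj_phi_fun)
  ultimately show "orthonormal_sequence H (phi_fun q \<alpha>)"
    by (intro orthonormal_sequence.intro orthonormal_sequence_axioms.intro total phi_fun_L2)
qed

end

section \<open>Completeness of the polynomials\<close>

text \<open>Since \<open>ennreal\<close> truncates at 0, the densities \<open>k\<close> and
  \<open>- k\<close> give the positive and the negative part as finite measures. They agree on all
  half-lines, hence everywhere, and densities are unique almost everywhere.\<close>

lemma AE_zero_if_tail_integrals_zero:
  fixes k :: "real \<Rightarrow> real"
  assumes k: "integrable lborel k" and tail: "\<And>t. (LINT x|lborel. indicator {t<..} x * k x) = 0"
  shows "AE x in lborel. k x = 0"
proof -
  have [measurable]: "k \<in> borel_measurable borel" using borel_measurable_integrable[OF k] by simp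
  have em: "emeasure (density lborel (\<lambda>x. ennreal (f x))) {t<..} = ennreal (LINT x|lborel. indicator {t<..} x * max 0 (f x))"
    if f: "integrable lborel f" for f :: "real \<Rightarrow> real" and t
  proof -
    have [measurable]: "f \<in> borel_measurable borel" using borel_measurable_integrable[OF f] by simp
    have i: "integrable lborel (\<lambda>x. indicator {t<..} x * max 0 (f x))"
      by (rule Bochner_Integration.integrable_bound[OF f]) (auto simp: indicator_def)
    have "emeasure (density lborel (\<lambda>x. ennreal (f x))) {t<..} = (\<integral>\<^sup>+x. ennreal (f x) * indicator {t<..} x \<partial>lborel)"
      by (rule emeasure_density) auto
    also have "\<dots> = (\<integral>\<^sup>+x. ennreal (indicator {t<..} x * max 0 (f x)) \<partial>lborel)"
      by (intro nn_integral_cong) (auto simp: indicator_def max_def ennreal_neg)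
    also have "\<dots> = ennreal (LINT x|lborel. indicator {t<..} x * max 0 (f x))"
      by (rule nn_integral_eq_integral[OF i]) auto
    finally show ?thesis .
  qed
  have nk: "integrable lborel (\<lambda>x. - k x)" using k by simp
  have i: "integrable lborel (\<lambda>x. indicator {t<..} x * max 0 (k x))"
    "integrable lborel (\<lambda>x. indicator {t<..} x * max 0 (- k x))" for t
    by (rule Bochner_Integration.integrable_bound[OF k]; auto simp: indicator_def)+
  have "density lborel (\<lambda>x. ennreal (k x)) = density lborel (\<lambda>x. ennreal (- k x))"
  proof (rule measure_eqI_lessThan)
    fix t
    have "(LINT x|lborel. indicator {t<..} x * max 0 (k x)) - (LINT x|lborel. indicator {t<..} x * max 0 (- k x))
        = (LINT x|lborel. indicator {t<..} x * max 0 (k x) - indicator {t<..} x * max 0 (- k x))"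
      by (rule Bochner_Integration.integral_diff[symmetric]) (rule i)+
    also have "\<dots> = (LINT x|lborel. indicator {t<..} x * k x)"
      by (intro Bochner_Integration.integral_cong refl) (auto simp: indicator_def max_def)
    finally have "(LINT x|lborel. indicator {t<..} x * max 0 (k x)) = (LINT x|lborel. indicator {t<..} x * max 0 (- k x))"
      using tail by simp
    then show "emeasure (density lborel (\<lambda>x. ennreal (k x))) {t<..} = emeasure (density lborel (\<lambda>x. ennreal (- k x))) {t<..}"
      unfolding em[OF k] em[OF nk] by simp
    show "emeasure (density lborel (\<lambda>x. ennreal (k x))) {t<..} < \<infinity>"
      unfolding em[OF k] by simp
  qed simp_all
  then have "AE x in lborel. ennreal (k x) = ennreal (- k x)"
    by (subst (asm) sigma_finite_measure.density_unique_iff[OF sigma_finite_lborel]) auto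
  then show ?thesis
  proof eventually_elim
    case (elim x)
    then show ?case
      by (cases "0 \<le> k x") (auto simp: ennreal_neg ennreal_eq_0_iff dest: sym)
  qed
qed

context bargmann_parameters begin

definition radius :: real where "radius = 2 / sqrt (1 - q)"

lemma Iq_radius: "x \<in> Iq q \<Longrightarrow> \<bar>x\<bar> \<le> radius"
  by (auto simp: Iq_def radius_def)

lemma H_integrable_mult_bounded:
  fixes h g :: "real \<Rightarrow> complex"
  assumes h: "integrable H h" and g: "g \<in> borel_measurable H" and B: "\<And>x. x \<in> Iq q \<Longrightarrow> norm (g x) \<le> B"
  shows "integrable H (\<lambda>x. h x * g x)"
proof (rule Bochner_Integration.integrable_bound)
  note [measurable] = borel_measurable_integrable[OF h] g
  show "integrable H (\<lambda>x. of_real B * h x)" using h by simp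
  show "(\<lambda>x. h x * g x) \<in> borel_measurable H" by measurable
  have "norm (h x * g x) \<le> norm (of_real B * h x)" if "x \<in> Iq q" for x
  proof -
    have "norm (h x) * norm (g x) \<le> norm (h x) * \<bar>B\<bar>"
      using B[OF that] by (intro mult_left_mono) auto
    then show ?thesis by (simp add: norm_mult mult.commute)
  qed
  then show "AE x in H. norm (h x * g x) \<le> norm (of_real B * h x)" by (auto intro!: AE_I2)
qed

lemma measurable_H_real: "f \<in> borel_measurable borel \<Longrightarrow> f \<in> borel_measurable H"
  unfolding measurable_cong_sets[OF sets_H refl] by (rule measurable_restrict_space1)

text \<open>Powers are never expanded in the polynomials. The claim is proved for \<open>x^k\<close>
  times every polynomial by induction on \<open>k\<close>: the recurrence trades one factor
  \<open>x\<close> for the neighbouring indices. Index 0 is the moment.\<close>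

lemma moments_zero:
  assumes h: "integrable H h" and orth: "\<And>n. (LINT x|H. h x * phi_fun q \<alpha> n x) = 0"
  shows "(LINT x|H. h x * of_real (x ^ k)) = 0"
proof -
  have Kb: "norm (of_real (x ^ k) * asc_angle n (angle x)) \<le> radius ^ k * ((real n + 1) * asc_const (sqrt_alpha * - sqrt_alpha))"
    if "x \<in> Iq q" for k n x
    unfolding norm_mult using Iq_radius[OF that] by (intro mult_mono asc_angle_bound) (auto simp: norm_power power_mono)
  have Km: "(\<lambda>x. of_real (x ^ k) * asc_angle n (angle x)) \<in> borel_measurable H" for k n
    by (intro measurable_H_continuous continuous_intros continuous_on_compose2[OF asc_angle_continuous[of UNIV] angle_continuous]) auto
  have int: "integrable H (\<lambda>x. h x * (of_real (x ^ k) * asc_angle n (angle x)))" for k n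
    using h Km Kb by (rule H_integrable_mult_bounded)
  have "(LINT x|H. h x * (of_real (x ^ k) * asc_angle n (angle x))) = 0" for n
  proof (induction k arbitrary: n)
    case 0
    have "(LINT x|H. h x * phi_fun q \<alpha> n x) = of_real (sqrt (asc_norm n)) * (LINT x|H. h x * asc_angle n (angle x))"
      unfolding phi_fun_asc_angle by (subst integral_mult_right_zero[symmetric]) (simp add: mult_ac)
    then show ?case using orth[of n] asc_norm_pos[of n] by simp
  next
    case (Suc k)
    let ?c = "of_real (sqrt (1 - q)) :: complex"
    have "(LINT x|H. h x * (of_real (x ^ Suc k) * asc_angle n (angle x)))
       = (LINT x|H. (of_real (rec_coeff n) / ?c) * (h x * (of_real (x ^ k) * asc_angle (Suc n) (angle x)))
          + (if n = 0 then 0 else 1 / ?c) * (h x * (of_real (x ^ k) * asc_angle (n - 1) (angle x))))"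
    proof (rule Bochner_Integration.integral_cong[OF refl])
      fix x assume "x \<in> space H"
      then have x: "x \<in> Iq q" by simp
      have c: "?c \<noteq> 0" using sqrt_pos by simp
      have "of_real x * ?c * asc_angle n (angle x) = of_real (rec_coeff n) * asc_angle (Suc n) (angle x) + (if n = 0 then 0 else asc_angle (n - 1) (angle x))"
        using asc_angle_recurrence[of "angle x" n] cos_angle[OF x] by simp
      then have "of_real x * asc_angle n (angle x) = (of_real (rec_coeff n) * asc_angle (Suc n) (angle x) + (if n = 0 then 0 else asc_angle (n - 1) (angle x))) / ?c"
        using c by (simp add: field_simps)
      then show "h x * (of_real (x ^ Suc k) * asc_angle n (angle x)) = (of_real (rec_coeff n) / ?c) * (h x * (of_real (x ^ k) * asc_angle (Suc n) (angle x)))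
          + (if n = 0 then 0 else 1 / ?c) * (h x * (of_real (x ^ k) * asc_angle (n - 1) (angle x)))"
        by (simp add: mult.assoc mult.left_commute[of "of_real x"]) (simp add: add_divide_distrib algebra_simps)
    qed
    also have "\<dots> = (of_real (rec_coeff n) / ?c) * (LINT x|H. h x * (of_real (x ^ k) * asc_angle (Suc n) (angle x)))
          + (if n = 0 then 0 else 1 / ?c) * (LINT x|H. h x * (of_real (x ^ k) * asc_angle (n - 1) (angle x)))"
      by (subst Bochner_Integration.integral_add)
        (simp_all only: integral_mult_right_zero Bochner_Integration.integrable_mult_right int)
    finally show ?case by (simp only: Suc mult_zero_right add_0)
  qed
  from this[of 0] show ?thesis by simp
qed

lemma continuous_zero:
  fixes h :: "real \<Rightarrow> complex" and g :: "real \<Rightarrow> real"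
  assumes h: "integrable H h" and mom: "\<And>k. (LINT x|H. h x * of_real (x ^ k)) = 0"
    and g: "continuous_on UNIV g"
  shows "(LINT x|H. h x * of_real (g x)) = 0"
proof -
  have gm: "(\<lambda>x. complex_of_real (f x)) \<in> borel_measurable H" if "continuous_on UNIV f" for f
    by (intro measurable_H_continuous continuous_intros continuous_on_subset[OF that]) auto
  have "norm (LINT x|H. h x * of_real (g x)) \<le> \<epsilon> * (LINT x|H. norm (h x))" if \<epsilon>: "0 < \<epsilon>" for \<epsilon>
  proof -
    obtain p where p: "real_polynomial_function p" "\<And>x. x \<in> {-radius..radius} \<Longrightarrow> \<bar>g x - p x\<bar> < \<epsilon>"
      using Stone_Weierstrass_real_polynomial_function[of "{-radius..radius}" g \<epsilon>] g \<epsilon>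
      by (metis compact_Icc continuous_on_subset subset_UNIV)
    obtain b m where pb: "p = (\<lambda>x. \<Sum>i\<le>m. b i * x ^ i)"
      using p(1) unfolding real_polynomial_function_iff_sum by blast
    have pc: "continuous_on UNIV p" unfolding pb by (intro continuous_intros)
    have ip: "integrable H (\<lambda>x. h x * of_real (x ^ i))" for i
      by (rule H_integrable_mult_bounded[OF h gm, of "\<lambda>x. x ^ i" "radius ^ i"])
        (auto intro!: continuous_intros power_mono Iq_radius simp: norm_power)
    have "(LINT x|H. h x * of_real (p x)) = (LINT x|H. (\<Sum>i\<le>m. of_real (b i) * (h x * of_real (x ^ i))))"
      unfolding pb by (simp add: sum_distrib_left mult_ac)
    also have "\<dots> = (\<Sum>i\<le>m. of_real (b i) * (LINT x|H. h x * of_real (x ^ i)))"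
      by (subst Bochner_Integration.integral_sum) (simp_all only: integral_mult_right_zero Bochner_Integration.integrable_mult_right ip)
    finally have p0: "(LINT x|H. h x * of_real (p x)) = 0" by (simp only: mom mult_zero_right sum.neutral_const)
    have "compact (f ` {-radius..radius})" if "continuous_on UNIV f" for f :: "real \<Rightarrow> real"
      using that by (intro compact_continuous_image) (auto intro: continuous_on_subset)
    then have bd: "\<exists>B. \<forall>x\<in>{-radius..radius}. norm (f x) \<le> B" if "continuous_on UNIV f" for f :: "real \<Rightarrow> real"
      using that compact_imp_bounded bounded_iff by (metis imageI)
    have ic: "integrable H (\<lambda>x. h x * of_real (f x))" if f: "continuous_on UNIV f" for f
    proof -
      obtain B where B: "\<And>x. x \<in> {-radius..radius} \<Longrightarrow> norm (f x) \<le> B" using bd[OF f] by blast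
      show ?thesis
        by (rule H_integrable_mult_bounded[OF h gm[OF f], of B]) (use B Iq_radius in \<open>fastforce simp: abs_le_iff\<close>)
    qed
    have "(LINT x|H. h x * of_real (g x)) = (LINT x|H. h x * of_real (g x)) - (LINT x|H. h x * of_real (p x))"
      by (simp add: p0)
    also have "\<dots> = (LINT x|H. h x * of_real (g x - p x))"
      by (subst Bochner_Integration.integral_diff[symmetric]) (auto intro: ic g pc simp: right_diff_distrib)
    also have "norm \<dots> \<le> (LINT x|H. \<epsilon> * norm (h x))"
    proof (rule Bochner_Integration.integral_norm_bound_integral)
      show "integrable H (\<lambda>x. h x * of_real (g x - p x))" by (intro ic continuous_intros g pc)
      show "integrable H (\<lambda>x. \<epsilon> * norm (h x))" using h by simp
      fix x assume "x \<in> space H"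
      then have "\<bar>g x - p x\<bar> \<le> \<epsilon>" using p(2)[of x] Iq_radius[of x] by (auto simp: abs_le_iff)
      then show "norm (h x * of_real (g x - p x)) \<le> \<epsilon> * norm (h x)"
        using mult_right_mono[of "\<bar>g x - p x\<bar>" \<epsilon> "norm (h x)"]
        by (simp add: norm_mult mult.commute del: of_real_diff)
    qed
    finally show ?thesis by simp
  qed
  then have le: "\<And>\<epsilon>. 0 < \<epsilon> \<Longrightarrow> norm (LINT x|H. h x * of_real (g x)) \<le> \<epsilon> * (LINT x|H. norm (h x))" .
  \<comment> \<open>The 1 in the rescaled \<open>\<epsilon> / (1 + ...)\<close> avoids dividing by
    an integral that may be 0.\<close>
  have "norm (LINT x|H. h x * of_real (g x)) \<le> 0 + \<epsilon>" if "0 < \<epsilon>" for \<epsilon>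
  proof -
    have nn: "0 \<le> (LINT x|H. norm (h x))" by simp
    have "\<epsilon> / (1 + (LINT x|H. norm (h x))) * (LINT x|H. norm (h x)) \<le> \<epsilon>"
      using that nn by (simp add: divide_simps add_pos_nonneg algebra_simps)
    moreover have "0 < \<epsilon> / (1 + (LINT x|H. norm (h x)))" using that nn by (intro divide_pos_pos add_pos_nonneg) auto
    ultimately show ?thesis using le by fastforce
  qed
  then have "norm (LINT x|H. h x * of_real (g x)) \<le> 0" by (rule field_le_epsilon)
  then show ?thesis by simp
qed

lemma tail_zero:
  fixes h :: "real \<Rightarrow> complex"
  assumes h: "integrable H h" and mom: "\<And>k. (LINT x|H. h x * of_real (x ^ k)) = 0"
  shows "(LINT x|H. h x * of_real (indicator {t<..} x)) = 0"
proof -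
  \<comment> \<open>Ramps of slope \<open>n\<close> that rise from 0 at \<open>t\<close> to 1:
    continuous, bounded by 1, and pointwise convergent to the indicator of the open
    half-line.\<close>
  define g where "g n x = min 1 (max 0 (real n * (x - t)))" for n x
  have gc: "continuous_on UNIV (g n)" for n unfolding g_def by (intro continuous_intros)
  have [measurable]: "g n \<in> borel_measurable borel" for n
    by (intro borel_measurable_continuous_onI gc)
  note [measurable] = borel_measurable_integrable[OF h] measurable_H_real
  have lim: "(\<lambda>n. g n x) \<longlonglongrightarrow> indicator {t<..} x" for x
  proof (cases "t < x")
    case True
    have "\<forall>\<^sub>F n in sequentially. g n x = 1"
    proof -
      obtain N where N: "1 / (x - t) < real N" using reals_Archimedean2 by blast
      show ?thesis using eventually_ge_at_top[of N]
      proof eventually_elim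
        case (elim n)
        have "1 / (x - t) \<le> real n" using N elim by linarith
        then have "1 \<le> real n * (x - t)" using True by (simp add: divide_le_eq)
        then show ?case by (simp add: g_def)
      qed
    qed
    then show ?thesis using True by (simp add: tendsto_eventually)
  next
    case False
    then have "real n * (x - t) \<le> 0" for n by (intro mult_nonneg_nonpos) auto
    then have "g n x = 0" for n by (simp add: g_def max_absorb1)
    then show ?thesis using False by simp
  qed
  have "(\<lambda>n. LINT x|H. h x * of_real (g n x)) \<longlonglongrightarrow> (LINT x|H. h x * of_real (indicator {t<..} x))"
  proof (rule integral_dominated_convergence[where w = "\<lambda>x. norm (h x)"])
    show "integrable H (\<lambda>x. norm (h x))" using h by simp
    show "AE x in H. (\<lambda>n. h x * of_real (g n x)) \<longlonglongrightarrow> h x * of_real (indicator {t<..} x)"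
      by (intro AE_I2 tendsto_mult_left tendsto_of_real lim)
    have "\<bar>g n x\<bar> \<le> 1" for n x by (simp add: g_def min_def max_def)
    then show "AE x in H. norm (h x * of_real (g n x)) \<le> norm (h x)" for n
      by (intro AE_I2) (simp add: norm_mult mult_left_le)
  qed measurable
  moreover have "(LINT x|H. h x * of_real (g n x)) = 0" for n
    using h mom gc by (rule continuous_zero)
  ultimately show ?thesis by (simp add: LIMSEQ_const_iff)
qed

lemma H_real_zero:
  fixes u :: "real \<Rightarrow> real"
  assumes u: "integrable H u" and tail: "\<And>t. (LINT x|H. u x * indicator {t<..} x) = 0"
  shows "AE x in H. u x = 0"
proof -
  note [measurable] = borel_measurable_integrable[OF u] measurable_H_real
  define k where "k x = indicator (Iq q) x *\<^sub>R (weight q \<alpha> x *\<^sub>R u x)" for x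
  have "AE x in lborel. k x = 0"
  proof (rule AE_zero_if_tail_integrals_zero)
    show "integrable lborel k"
      using u unfolding H_integrable_iff(1)[OF borel_measurable_integrable[OF u]] set_integrable_def k_def .
    fix t
    have "(\<lambda>x. u x * indicator {t<..} x) \<in> borel_measurable H" by measurable
    from H_integrable_iff(2)[OF this] tail[of t]
    show "(LINT x|lborel. indicator {t<..} x * k x) = 0"
      by (simp add: k_def set_lebesgue_integral_def mult_ac)
  qed
  then have "AE x in lborel. x \<in> Iq q \<longrightarrow> u x = 0"
    by eventually_elim (auto simp: k_def dest: weight_pos)
  then have aeR: "AE x in restrict_space lborel (Iq q). u x = 0"
    by (subst AE_restrict_space_iff) auto
  have wm: "(\<lambda>x. ennreal (weight q \<alpha> x)) \<in> borel_measurable (restrict_space lborel (Iq q))"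
  proof -
    have sets_eq: "sets (restrict_space lborel (Iq q)) = sets H" by (simp add: H_measure_def)
    have "weight q \<alpha> \<in> borel_measurable (restrict_space lborel (Iq q))"
      unfolding measurable_cong_sets[OF sets_eq refl] by (rule measurable_H_continuous[OF weight_continuous])
    then show ?thesis by (rule measurable_compose[OF _ measurable_ennreal])
  qed
  show ?thesis unfolding H_measure_def AE_density[OF wm] using aeR by eventually_elim simp
qed

lemma H_orthogonal_zero:
  assumes h: "h \<in> L2 H" and orth: "\<And>n. H.coeff h n = 0"
  shows "AE x in H. h x = 0"
proof -
  have hi: "integrable H h" using H.integral_norm_square_le(1)[OF h] .
  have mom: "(LINT x|H. h x * of_real (x ^ k)) = 0" for k
    using hi by (rule moments_zero) (use orth in \<open>simp add: H.coeff_def L2_inner_def cnj_phi_fun\<close>)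
  note [measurable] = L2_measurable[OF h] measurable_H_real
  have iint: "integrable H (\<lambda>x. h x * of_real (indicator {t<..} x))" for t
    by (rule H_integrable_mult_bounded[OF hi, of _ 1]) (auto simp: indicator_def)
  have "AE x in H. Re (h x) = 0"
  proof (rule H_real_zero)
    show "integrable H (\<lambda>x. Re (h x))" using hi by simp
    fix t show "(LINT x|H. Re (h x) * indicator {t<..} x) = 0"
      using integral_Re[OF iint[of t]] tail_zero[OF hi mom, of t] by simp
  qed
  moreover have "AE x in H. Im (h x) = 0"
  proof (rule H_real_zero)
    show "integrable H (\<lambda>x. Im (h x))" using hi by simp
    fix t show "(LINT x|H. Im (h x) * indicator {t<..} x) = 0"
      using integral_Im[OF iint[of t]] tail_zero[OF hi mom, of t] by simp
  qed
  ultimately show ?thesis by eventually_elim (simp add: complex_eq_iff)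
qed

text \<open>Riesz-Fischer supplies a function with the coefficients of \<open>f\<close>; its
  difference from \<open>f\<close> is orthogonal to every polynomial, so it vanishes almost
  everywhere.\<close>

theorem H_complete:
  assumes f: "f \<in> L2 H" shows "H.expands (H.coeff f) f"
proof -
  obtain g where g: "H.expands (H.coeff f) g" using H.riesz_fischer[OF H.bessel[OF f]] by blast
  then have gL2: "g \<in> L2 H" by (simp add: H.expands_def)
  have "AE x in H. f x - g x = 0"
  proof (rule H_orthogonal_zero)
    show "(\<lambda>x. f x - g x) \<in> L2 H" using f gL2 by (rule L2_diff)
    show "H.coeff (\<lambda>x. f x - g x) n = 0" for n
      using H.expands_coeff[OF g] f gL2 by (simp add: H.coeff_def L2_inner_diff_left phi_fun_L2 fun_eq_iff)
  qed
  then have "AE x in H. g x = f x" by eventually_elim simp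
  then show ?thesis by (rule H.expands_cong_AE[OF g L2_measurable[OF f]])
qed

subsection \<open>The transform as a power series\<close>

lemma xfact_asc_norm: "xfact q \<alpha> n = asc_norm n / (1 - q) ^ n"
proof -
  have "qfact q n = qpoch q q n / (1 - q) ^ n"
    by (induction n) (simp_all add: qfact_def qnum_def qpoch_Suc)
  then show ?thesis by (simp add: xfact_def asc_norm_def)
qed

lemma xfact_pos: "0 < xfact q \<alpha> n"
  unfolding xfact_asc_norm using asc_norm_pos q_less_1 by (intro divide_pos_pos) auto

definition monomial :: "nat \<Rightarrow> complex \<Rightarrow> complex" where
  "monomial n z = z ^ n / of_real (sqrt (xfact q \<alpha> n))"

definition scaled_arg :: "complex \<Rightarrow> complex" where
  "scaled_arg z = z * of_real (sqrt (1 - q))"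

lemma norm_scaled_arg: "z \<in> Cq q \<Longrightarrow> norm (scaled_arg z) < 1"
proof -
  assume "z \<in> Cq q"
  then have "(norm (scaled_arg z))\<^sup>2 < 1\<^sup>2"
    using q_less_1 by (simp add: Cq_def scaled_arg_def norm_mult power_mult_distrib mult.commute)
  then show ?thesis by (rule power_less_imp_less_base) simp
qed

text \<open>The roots of \<open>asc_norm n\<close> cancel and the powers of
  \<open>sqrt (1 - q)\<close> move into the argument, so the series of the coherent state becomes
  the generating function.\<close>

lemma monomial_phi_fun: "monomial n z * phi_fun q \<alpha> n x = asc_angle n (angle x) * scaled_arg z ^ n"
proof -
  have "of_real (sqrt (xfact q \<alpha> n)) = complex_of_real (sqrt (asc_norm n)) / of_real (sqrt (1 - q)) ^ n"
    by (simp add: xfact_asc_norm real_sqrt_divide real_sqrt_power)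
  moreover have "complex_of_real (sqrt (asc_norm n)) \<noteq> 0" using asc_norm_pos[of n] by simp
  ultimately show ?thesis by (simp add: monomial_def phi_fun_asc_angle scaled_arg_def power_mult_distrib)
qed

lemma kernel_sums:
  assumes "z \<in> Cq q" shows "(\<lambda>n. monomial n z * phi_fun q \<alpha> n x) sums kernel_T q \<alpha> z x"
proof -
  let ?u = "cis (angle x)"
  have inv: "w / ?u = w * cis (- angle x)" for w using cis_divide[of 0 "angle x"] by (simp add: divide_inverse)
  have "(\<lambda>n. asc sqrt_alpha (- sqrt_alpha) ?u n * scaled_arg z ^ n) sums
      (1 / qpoch_inf (scaled_arg z / ?u) Q * phi21 (sqrt_alpha / ?u) (- sqrt_alpha / ?u) (sqrt_alpha * - sqrt_alpha) Q (scaled_arg z * ?u))"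
    using norm_sqrt_alpha norm_sqrt_alpha_square norm_scaled_arg[OF assms] by (intro asc_sums) auto
  then show ?thesis
    unfolding inv sqrt_alpha_square(2) monomial_phi_fun
    by (simp add: asc_angle_def kernel_T_def Let_def sqrt_alpha_def scaled_arg_def angle_def)
qed

lemma asc_norm_lower: "qpoch_inf \<bar>\<alpha>\<bar> q * qpoch_inf q q \<le> asc_norm n"
proof -
  have "qpoch_inf \<bar>\<alpha>\<bar> q \<le> norm (qpoch (- \<alpha>) (of_real q) n)" "qpoch_inf q q \<le> norm (qpoch q (of_real q) n)"
    using alpha_gt alpha_less q_less_1 by (intro norm_qpoch_ge; simp)+
  then have "qpoch_inf \<bar>\<alpha>\<bar> q \<le> qpoch (- \<alpha>) q n" "qpoch_inf q q \<le> qpoch q q n"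
    using qpoch_real_pos[of "- \<alpha>" n] qpoch_real_pos[of q n] alpha_gt q_less_1 by simp_all
  then show ?thesis unfolding asc_norm_def
    using alpha_gt alpha_less q_less_1 by (intro mult_mono less_imp_le[OF qpoch_inf_real_pos] less_imp_le[OF qpoch_real_pos]) auto
qed

lemma cs_norm_pos:
  assumes "z \<in> Cq q" shows "0 < cs_norm q \<alpha> ((cmod z)\<^sup>2)"
proof -
  define c where "c = qpoch_inf \<bar>\<alpha>\<bar> q * qpoch_inf q q"
  have c: "0 < c" "\<And>n. c \<le> asc_norm n"
    unfolding c_def using alpha_gt alpha_less q_less_1
    by (intro mult_pos_pos qpoch_inf_real_pos; auto) (rule asc_norm_lower)
  define s where "s = (norm (scaled_arg z))\<^sup>2"
  have s: "0 \<le> s" "s < 1" using norm_scaled_arg[OF assms] by (auto simp: s_def abs_square_less_1)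
  have eq: "((cmod z)\<^sup>2) ^ n / xfact q \<alpha> n = s ^ n / asc_norm n" for n
    using q_less_1 by (simp add: xfact_asc_norm s_def scaled_arg_def norm_mult power_mult_distrib)
  have sm: "summable (\<lambda>n. s ^ n / asc_norm n)"
  proof (rule summable_comparison_test_ev)
    show "summable (\<lambda>n. s ^ n * (1 / c))" using s by (intro summable_mult2 summable_geometric) auto
    have "norm (s ^ n / asc_norm n) \<le> s ^ n * (1 / c)" for n
      using c(1) c(2)[of n] s asc_norm_pos[of n] by (auto intro!: divide_left_mono simp: abs_of_pos)
    then show "\<forall>\<^sub>F n in sequentially. norm (s ^ n / asc_norm n) \<le> s ^ n * (1 / c)" by simp
  qed
  have "0 < (\<Sum>n. s ^ n / asc_norm n)"
    using sm by (rule suminf_pos2[where i = 0]) (use s asc_norm_pos in \<open>auto intro!: divide_nonneg_pos\<close>)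
  then show ?thesis by (simp add: cs_norm_def eq)
qed

lemma cnj_coherent_state:
  assumes "z \<in> Cq q"
  shows "of_real (sqrt (cs_norm q \<alpha> ((cmod z)\<^sup>2))) * cnj (coherent_state q \<alpha> z x) = kernel_T q \<alpha> z x"
proof -
  have "(\<lambda>n. cnj (monomial n z * phi_fun q \<alpha> n x)) sums cnj (kernel_T q \<alpha> z x)"
    using kernel_sums[OF assms] by (simp only: sums_cnj)
  then have "(\<lambda>n. cnj z ^ n / of_real (sqrt (xfact q \<alpha> n)) * phi_fun q \<alpha> n x) sums cnj (kernel_T q \<alpha> z x)"
    by (simp add: monomial_def cnj_phi_fun)
  then have ker: "cnj (kernel_T q \<alpha> z x) = (\<Sum>n. cnj z ^ n / of_real (sqrt (xfact q \<alpha> n)) * phi_fun q \<alpha> n x)"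
    by (rule sums_unique)
  have "coherent_state q \<alpha> z x = of_real (1 / sqrt (cs_norm q \<alpha> ((cmod z)\<^sup>2))) * cnj (kernel_T q \<alpha> z x)"
    unfolding coherent_state_def ker ..
  then show ?thesis using cs_norm_pos[OF assms] by simp
qed

lemma bargmann_kernel:
  assumes "z \<in> Cq q"
  shows "bargmann q \<alpha> \<phi> z = (LINT x|H. \<phi> x * kernel_T q \<alpha> z x)"
proof -
  have "bargmann q \<alpha> \<phi> z = (LINT x|H. of_real (sqrt (cs_norm q \<alpha> ((cmod z)\<^sup>2))) * (\<phi> x * cnj (coherent_state q \<alpha> z x)))"
    unfolding bargmann_def L2_inner_def by (rule integral_mult_right_zero[symmetric])
  also have "\<dots> = (LINT x|H. \<phi> x * kernel_T q \<alpha> z x)"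
    unfolding cnj_coherent_state[OF assms, symmetric] by (simp add: mult.left_commute)
  finally show ?thesis .
qed

text \<open>Termwise integration of the kernel series. The majorant \<open>B n\<close> is uniform in
  \<open>x\<close>, and a square integrable \<open>\<phi>\<close> is integrable because the measure
  is finite.\<close>

lemma
  assumes \<phi>: "\<phi> \<in> L2 H" and z: "z \<in> Cq q"
  shows bargmann_integrable: "integrable H (\<lambda>x. \<phi> x * kernel_T q \<alpha> z x)"
    and bargmann_sums: "(\<lambda>n. H.coeff \<phi> n * monomial n z) sums bargmann q \<alpha> \<phi> z"
proof -
  note [measurable] = L2_measurable[OF \<phi>]
  have int: "integrable H \<phi>" by (rule H.integral_norm_square_le(1)[OF \<phi>])
  let ?f = "\<lambda>n x. \<phi> x * (monomial n z * phi_fun q \<alpha> n x)"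
  define B where "B n = (real n + 1) * asc_const (sqrt_alpha * - sqrt_alpha) * norm (scaled_arg z) ^ n" for n
  have sB: "summable B"
    unfolding B_def using summable_mult[OF summable_of_nat_geometric[of "norm (scaled_arg z)"], of "asc_const (sqrt_alpha * - sqrt_alpha)"] norm_scaled_arg[OF z]
    by (simp add: mult_ac)
  have le: "norm (monomial n z * phi_fun q \<alpha> n x) \<le> B n" for n x
    unfolding monomial_phi_fun B_def norm_mult norm_power by (intro mult_right_mono asc_angle_bound) simp
  have fi: "integrable H (?f n)" for n
    by (rule H_integrable_mult_bounded[OF int _ le]) measurable
  have ae: "AE x in H. summable (\<lambda>n. norm (?f n x))"
  proof (rule AE_I2)
    fix x
    show "summable (\<lambda>n. norm (?f n x))"
      by (rule summable_comparison_test_ev[OF _ summable_mult[OF sB, of "norm (\<phi> x)"]])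
        (use le in \<open>auto simp: norm_mult mult_left_mono intro!: always_eventually\<close>)
  qed
  have sn: "summable (\<lambda>n. LINT x|H. norm (?f n x))"
  proof (rule summable_comparison_test_ev[OF _ summable_mult[OF sB, of "LINT x|H. norm (\<phi> x)"]])
    have "norm (LINT x|H. norm (?f n x)) \<le> (LINT x|H. norm (\<phi> x)) * B n" for n
    proof -
      have "(LINT x|H. norm (?f n x)) \<le> (LINT x|H. norm (\<phi> x) * B n)"
      proof (rule integral_mono)
        show "integrable H (\<lambda>x. norm (?f n x))" using fi by simp
        show "integrable H (\<lambda>x. norm (\<phi> x) * B n)" using int by simp
        show "norm (?f n x) \<le> norm (\<phi> x) * B n" for x
          unfolding norm_mult[of "\<phi> x"] by (intro mult_left_mono le) simp
      qed
      then show ?thesis by simp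
    qed
    then show "\<forall>\<^sub>F n in sequentially. norm (LINT x|H. norm (?f n x)) \<le> (LINT x|H. norm (\<phi> x)) * B n"
      by simp
  qed
  have ker: "(\<Sum>n. ?f n x) = \<phi> x * kernel_T q \<alpha> z x" for x
    using sums_mult[OF kernel_sums[OF z, of x], of "\<phi> x"] by (simp add: sums_iff)
  show "integrable H (\<lambda>x. \<phi> x * kernel_T q \<alpha> z x)"
    using integrable_suminf[OF fi ae sn] by (simp only: ker)
  have "(\<lambda>n. integral\<^sup>L H (?f n)) sums (LINT x|H. \<phi> x * kernel_T q \<alpha> z x)"
    using sums_integral[OF fi ae sn] by (simp only: ker)
  moreover have "integral\<^sup>L H (?f n) = H.coeff \<phi> n * monomial n z" for n
  proof -
    have "integral\<^sup>L H (?f n) = (LINT x|H. monomial n z * (\<phi> x * phi_fun q \<alpha> n x))"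
      by (simp add: mult.left_commute)
    then show ?thesis by (simp add: H.coeff_def L2_inner_def cnj_phi_fun mult.commute)
  qed
  ultimately show "(\<lambda>n. H.coeff \<phi> n * monomial n z) sums bargmann q \<alpha> \<phi> z"
    by (simp add: bargmann_kernel[OF z])
qed

lemma bargmann_integral:
  assumes \<phi>: "\<phi> \<in> L2 H" and z: "z \<in> Cq q"
  shows "set_integrable lborel (Iq q) (\<lambda>\<xi>. kernel_T q \<alpha> z \<xi> * \<phi> \<xi> * of_real (weight q \<alpha> \<xi>))"
    and "bargmann q \<alpha> \<phi> z = (LINT \<xi>:Iq q|lborel. kernel_T q \<alpha> z \<xi> * \<phi> \<xi> * of_real (weight q \<alpha> \<xi>))"
proof -
  have int: "integrable H (\<lambda>x. \<phi> x * kernel_T q \<alpha> z x)" by (rule bargmann_integrable[OF \<phi> z])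
  have eq: "(\<lambda>x. weight q \<alpha> x *\<^sub>R (\<phi> x * kernel_T q \<alpha> z x)) = (\<lambda>\<xi>. kernel_T q \<alpha> z \<xi> * \<phi> \<xi> * of_real (weight q \<alpha> \<xi>))"
    by (simp add: scaleR_conv_of_real mult_ac)
  show "set_integrable lborel (Iq q) (\<lambda>\<xi>. kernel_T q \<alpha> z \<xi> * \<phi> \<xi> * of_real (weight q \<alpha> \<xi>))"
    using int unfolding H_integrable_iff(1)[OF borel_measurable_integrable[OF int]] eq .
  show "bargmann q \<alpha> \<phi> z = (LINT \<xi>:Iq q|lborel. kernel_T q \<alpha> z \<xi> * \<phi> \<xi> * of_real (weight q \<alpha> \<xi>))"
    unfolding bargmann_kernel[OF z] H_integrable_iff(2)[OF borel_measurable_integrable[OF int]] eq ..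
qed

end

section \<open>The target space\<close>

lemma (in pair_sigma_finite) integral_product_function:
  fixes g :: "'a \<Rightarrow> complex" and h :: "'b \<Rightarrow> complex"
  assumes g: "integrable M1 g" and h: "integrable M2 h"
  shows "integrable (M1 \<Otimes>\<^sub>M M2) (\<lambda>(x, y). g x * h y)"
    and "(\<integral>p. (case p of (x, y) \<Rightarrow> g x * h y) \<partial>(M1 \<Otimes>\<^sub>M M2)) = integral\<^sup>L M1 g * integral\<^sup>L M2 h"
proof -
  note [measurable] = borel_measurable_integrable[OF g] borel_measurable_integrable[OF h]
  show int: "integrable (M1 \<Otimes>\<^sub>M M2) (\<lambda>(x, y). g x * h y)"
  proof (rule Fubini_integrable)
    show "(\<lambda>(x, y). g x * h y) \<in> borel_measurable (M1 \<Otimes>\<^sub>M M2)" by measurable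
    show "integrable M1 (\<lambda>x. \<integral>y. norm (case (x, y) of (x, y) \<Rightarrow> g x * h y) \<partial>M2)"
      using g by (simp add: norm_mult)
    show "AE x in M1. integrable M2 (\<lambda>y. case (x, y) of (x, y) \<Rightarrow> g x * h y)"
      using h by simp
  qed
  show "(\<integral>p. (case p of (x, y) \<Rightarrow> g x * h y) \<partial>(M1 \<Otimes>\<^sub>M M2)) = integral\<^sup>L M1 g * integral\<^sup>L M2 h"
    unfolding integral_fst'[OF int, symmetric] by simp
qed

context bargmann_parameters begin

section \<open>Rogers-Szego polynomials and the moments of the radial measure\<close>

definition rs :: "real \<Rightarrow> nat \<Rightarrow> real" where
  "rs z n = (\<Sum>k\<le>n. z ^ k / (qpoch q q k * qpoch q q (n - k)))"

lemma rogers_szego_rs: "rogers_szego n z q = qpoch q q n * rs z n"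
  by (simp add: rogers_szego_def rs_def qbinom_def sum_distrib_left)

text \<open>At \<open>u\<^sup>2 = z\<close> the Rogers-Szego polynomial is a \<open>q\<close>-Hermite polynomial, so its recurrence is
  already known.\<close>

lemma rs_asc:
  assumes "z \<noteq> 0" shows "of_real (rs z n) = csqrt (of_real z) ^ n * asc 0 0 (csqrt (of_real z)) n"
proof -
  let ?u = "csqrt (of_real z)"
  have u: "?u \<noteq> 0" "?u * ?u = of_real z" using assms by (simp_all flip: power2_eq_square)
  show ?thesis
    unfolding rs_def asc_def of_real_sum sum_distrib_left
  proof (rule sum.cong)
    fix k assume "k \<in> {..n}"
    then have "?u ^ n = ?u ^ k * ?u ^ (n - k)" by (simp flip: power_add)
    moreover have "?u ^ k * ?u ^ k = of_real z ^ k" by (simp only: u(2) flip: power_mult_distrib)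
    ultimately show "of_real (z ^ k / (qpoch q q k * qpoch q q (n - k))) =
       ?u ^ n * (qpoch (0 / ?u) Q k * qpoch (0 / ?u) Q k / (qpoch (0 * 0) Q k * qpoch Q Q k) * ?u ^ k *
         (1 / (?u ^ (n - k) * qpoch Q Q (n - k))))"
      using u(1) by (simp add: qpoch_of_real[symmetric] mult.assoc[symmetric])
  qed simp
qed

lemma rs_recurrence:
  assumes "z \<noteq> 0"
  shows "(1 - q ^ Suc (Suc n)) * rs z (Suc (Suc n)) = (1 + z) * rs z (Suc n) - z * rs z n"
proof -
  let ?u = "csqrt (of_real z)"
  have u: "?u \<noteq> 0" "?u * ?u = of_real z" using assms by (simp_all flip: power2_eq_square)
  have rec: "(1 - Q ^ Suc (Suc n)) * asc 0 0 ?u (Suc (Suc n)) = (?u + 1 / ?u) * asc 0 0 ?u (Suc n) - asc 0 0 ?u n"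
    using asc_recurrence[of ?u 0 0 n] u(1) by (simp add: algebra_simps add_eq_0_iff2)
  have "(1 - Q ^ Suc (Suc n)) * of_real (rs z (Suc (Suc n)))
      = ?u ^ Suc (Suc n) * ((1 - Q ^ Suc (Suc n)) * asc 0 0 ?u (Suc (Suc n)))"
    unfolding rs_asc[OF assms] by (simp only: mult_ac)
  also have "\<dots> = (?u * ?u + 1) * (?u ^ Suc n * asc 0 0 ?u (Suc n)) - (?u * ?u) * (?u ^ n * asc 0 0 ?u n)"
    unfolding rec using u(1) by (simp add: field_simps)
  also have "\<dots> = (of_real z + 1) * of_real (rs z (Suc n)) - of_real z * of_real (rs z n)"
    unfolding rs_asc[OF assms] u(2) ..
  finally have "complex_of_real ((1 - q ^ Suc (Suc n)) * rs z (Suc (Suc n))) = of_real ((z + 1) * rs z (Suc n) - z * rs z n)"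
    by simp
  then show ?thesis by (simp only: of_real_eq_iff add.commute)
qed

text \<open>For \<open>z < 0\<close> the polynomial has terms of both signs, but all coefficients of its recurrence
  are positive.\<close>

lemma rs_pos:
  assumes "- 1 < z" shows "0 < rs z n"
proof (cases "0 \<le> z")
  case True
  have qq: "0 < qpoch q q k" for k by (rule qpoch_real_pos[OF q_less_1])
  have "0 < z ^ 0 / (qpoch q q 0 * qpoch q q (n - 0))" using qq[of n] by simp
  also have "\<dots> \<le> rs z n"
    unfolding rs_def using True qq
    by (intro member_le_sum) (auto intro!: divide_nonneg_pos mult_pos_pos)
  finally show ?thesis .
next
  case False
  then have z: "z \<noteq> 0" "z < 0" by auto
  show ?thesis
  proof (induction n rule: less_induct)
    case (less n)
    consider "n = 0" | "n = Suc 0" | m where "n = Suc (Suc m)" by (metis not0_implies_Suc)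
    then show ?case
    proof cases
      case 1
      then show ?thesis by (simp add: rs_def)
    next
      case 2
      then show ?thesis using assms q_less_1
        by (simp add: rs_def qpoch_Suc add_divide_distrib[symmetric])
    next
      case 3
      have r: "0 < rs z (Suc m)" "0 < rs z m" using less 3 by simp_all
      have c: "0 < 1 + z" "0 < - z" using assms z by simp_all
      have "0 < (1 + z) * rs z (Suc m) + (- z) * rs z m"
        by (rule add_pos_pos[OF mult_pos_pos[OF c(1) r(1)] mult_pos_pos[OF c(2) r(2)]])
      then have "0 < (1 - q ^ n) * rs z n" using rs_recurrence[OF z(1), of m] 3 by simp
      moreover have "0 < 1 - q ^ n" using qpow_less_1[of "Suc m"] 3 by simp
      ultimately show ?thesis by (simp add: zero_less_mult_iff)
    qed
  qed
qed

lemma rs_generating_function: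
  assumes "\<bar>t\<bar> < 1" "\<bar>z * t\<bar> < 1"
  shows "(\<lambda>n. rs z n * t ^ n) sums (1 / (qpoch_inf t q * qpoch_inf (z * t) q))"
proof -
  have "(\<lambda>n. \<Sum>k\<le>n. ((z * t) ^ k / qpoch q q k) * (t ^ (n - k) / qpoch q q (n - k))) sums
      ((\<Sum>k. (z * t) ^ k / qpoch q q k) * (\<Sum>k. t ^ k / qpoch q q k))"
    using summable_euler[of "z * t"] summable_euler[of t] assms by (intro Cauchy_product_sums) simp_all
  moreover have "(\<Sum>k\<le>n. ((z * t) ^ k / qpoch q q k) * (t ^ (n - k) / qpoch q q (n - k))) = rs z n * t ^ n" for n
    unfolding rs_def sum_distrib_right
  proof (rule sum.cong)
    fix k assume "k \<in> {..n}"
    then have "t ^ n = t ^ k * t ^ (n - k)" by (simp flip: power_add)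
    then show "(z * t) ^ k / qpoch q q k * (t ^ (n - k) / qpoch q q (n - k)) = z ^ k / (qpoch q q k * qpoch q q (n - k)) * t ^ n"
      by (simp add: power_mult_distrib)
  qed simp
  moreover have "(\<Sum>k. s ^ k / qpoch q q k) = 1 / qpoch_inf s q" if "\<bar>s\<bar> < 1" for s
    using sums_unique[OF euler_sums[of s]] that by simp
  ultimately show ?thesis using assms by (simp add: mult.commute)
qed

definition mass :: "nat \<Rightarrow> real" where "mass n = rho_mass q \<alpha> n"

text \<open>\<open>rad 0\<close> is the radius of \<open>Cq q\<close>, so that circle lies on the
  boundary; \<open>rad 1\<close> belongs to the outermost circle inside.\<close>

definition rad :: "nat \<Rightarrow> real" where "rad n = (1 - q) powr (- 1 / 2) * q powr (real n / 2)"

lemma mass_rs: "mass n = qpoch_inf (- \<alpha>) q * qpoch_inf q q * q ^ n * rs (- \<alpha> / q) n"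
  unfolding mass_def rho_mass_def rogers_szego_rs by simp

lemma mass_pos: "0 < mass n"
proof -
  have "- 1 < - \<alpha> / q" using alpha_less q_pos by (simp add: field_simps)
  then show ?thesis
    unfolding mass_rs using alpha_gt q_less_1 qpow_pos[of n]
    by (intro mult_pos_pos qpoch_inf_real_pos rs_pos) auto
qed

lemma rad_pos: "0 < rad n"
  unfolding rad_def using q_pos q_less_1 by simp

lemma rad_square: "(rad n)\<^sup>2 = q ^ n / (1 - q)"
proof -
  have "(rad n)\<^sup>2 = ((1 - q) powr (- 1 / 2) * (1 - q) powr (- 1 / 2)) * (q powr (real n / 2) * q powr (real n / 2))"
    by (simp add: rad_def power2_eq_square mult_ac)
  also have "\<dots> = (1 - q) powr (- 1) * q powr (real n)"
    by (simp only: powr_add[symmetric]) simp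
  also have "\<dots> = q ^ n / (1 - q)"
    using q_pos q_less_1 by (simp add: powr_realpow powr_minus_divide)
  finally show ?thesis .
qed

lemma rad_mono: "m \<le> n \<Longrightarrow> rad n \<le> rad m"
proof -
  assume "m \<le> n"
  then have "(rad n)\<^sup>2 \<le> (rad m)\<^sup>2"
    unfolding rad_square using q_less_1 q_pos by (intro divide_right_mono power_decreasing) auto
  then show ?thesis by (rule power2_le_imp_le) (simp add: rad_pos less_imp_le)
qed

text \<open>The generating function at \<open>t = q^(m+1)\<close> and
  \<open>z = -\<alpha> / q\<close>, so that \<open>z t = -\<alpha> q^m\<close>. Dividing the full
  products \<open>(q; q)_\<infinity>\<close> and \<open>(-\<alpha>; q)_\<infinity>\<close> by these
  tails leaves their first \<open>m\<close> factors, which form \<open>x_m!\<close>.\<close>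

lemma mass_moment: "(\<lambda>n. mass n * rad n ^ (2 * m)) sums xfact q \<alpha> m"
proof -
  have t1: "\<bar>q ^ Suc m\<bar> < 1" using qpow_less_1[of m] qpow_pos[of "Suc m"] by simp
  have zt: "- \<alpha> / q * q ^ Suc m = - \<alpha> * q ^ m" using q_pos by simp
  have t2: "\<bar>- \<alpha> / q * q ^ Suc m\<bar> < 1"
  proof -
    have "\<bar>\<alpha>\<bar> * q ^ m \<le> \<bar>\<alpha>\<bar> * 1" by (intro mult_left_mono qpow_le_1) auto
    then show ?thesis unfolding zt using alpha_gt alpha_less q_less_1 by (simp add: abs_mult power_abs)
  qed
  let ?c = "qpoch_inf (- \<alpha>) q * qpoch_inf q q"
  have nz: "qpoch_inf (q ^ Suc m) q \<noteq> 0" "qpoch_inf (- \<alpha> * q ^ m) q \<noteq> 0"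
    using t1 t2 unfolding zt by (metis qpoch_inf_real_pos abs_less_iff less_irrefl)+
  have "(\<lambda>n. ?c / (1 - q) ^ m * (rs (- \<alpha> / q) n * (q ^ Suc m) ^ n)) sums
      (?c / (1 - q) ^ m * (1 / (qpoch_inf (q ^ Suc m) q * qpoch_inf (- \<alpha> / q * q ^ Suc m) q)))"
    by (intro sums_mult rs_generating_function t1 t2)
  moreover have "?c / (1 - q) ^ m * (rs (- \<alpha> / q) n * (q ^ Suc m) ^ n) = mass n * rad n ^ (2 * m)" for n
    unfolding mass_rs power_mult rad_square
    by (simp add: power_divide power_mult_distrib power_mult[symmetric] mult_ac)
  moreover have "?c / (1 - q) ^ m * (1 / (qpoch_inf (q ^ Suc m) q * qpoch_inf (- \<alpha> / q * q ^ Suc m) q)) = xfact q \<alpha> m"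
  proof -
    have "qpoch_inf q q = qpoch q q m * qpoch_inf (q ^ Suc m) q" using qpoch_inf_split[of q m] by simp
    moreover have "qpoch_inf (- \<alpha>) q = qpoch (- \<alpha>) q m * qpoch_inf (- \<alpha> * q ^ m) q" using qpoch_inf_split[of "- \<alpha>" m] by simp
    ultimately show ?thesis unfolding zt xfact_asc_norm asc_norm_def using nz by simp
  qed
  ultimately show ?thesis by simp
qed

subsection \<open>The target measure\<close>

abbreviation rho :: "real measure" where "rho \<equiv> rho_measure q \<alpha>"

lemma sets_rho [measurable_cong, simp]: "sets rho = sets borel"
  by (simp add: rho_measure_def)

lemma rho_integral:
  fixes f :: "real \<Rightarrow> complex"
  assumes [measurable]: "f \<in> borel_measurable borel" and sm: "summable (\<lambda>n. mass n * norm (f (rad n)))"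
  shows "integrable rho f" "(LINT r|rho. f r) = (\<Sum>n. of_real (mass n) * f (rad n))"
proof -
  have nn: "AE n in count_space UNIV. 0 \<le> rho_mass q \<alpha> n"
    using mass_pos unfolding mass_def by (auto intro!: AE_I2 less_imp_le)
  have int: "integrable (count_space UNIV) (\<lambda>n. rho_mass q \<alpha> n *\<^sub>R f (rad n))"
    unfolding integrable_count_space_nat_iff
    using sm mass_pos by (simp add: mass_def[symmetric] abs_of_pos)
  show "integrable rho f"
    unfolding rho_measure_def rad_def[symmetric]
    by (subst integrable_distr_eq) (auto simp: integrable_density nn int)
  have "(LINT r|rho. f r) = (LINT n|count_space UNIV. rho_mass q \<alpha> n *\<^sub>R f (rad n))"
    unfolding rho_measure_def rad_def[symmetric]
    by (subst integral_distr) (auto simp: integral_density nn)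
  also have "\<dots> = (\<Sum>n. of_real (mass n) * f (rad n))"
    using integral_count_space_nat[OF int] by (simp add: scaleR_conv_of_real mass_def)
  finally show "(LINT r|rho. f r) = (\<Sum>n. of_real (mass n) * f (rad n))" .
qed

lemma finite_measure_rho: "finite_measure rho"
proof (rule finite_measureI)
  have "integrable rho (\<lambda>_. 1 :: complex)"
    using mass_moment[of 0] by (intro rho_integral) (auto simp: sums_iff)
  then show "emeasure rho (space rho) \<noteq> \<infinity>"
    by (simp add: integrable_iff_bounded less_top[symmetric])
qed

definition circle :: "real measure" where
  "circle = scale_measure (ennreal (1 / (2 * pi))) (restrict_space lborel {0..<2 * pi})"

lemma sets_circle: "sets circle = sets (restrict_space borel {0..<2 * pi})"
  by (simp add: circle_def sets_restrict_space)

lemma measurable_circle: "f \<in> borel_measurable borel \<Longrightarrow> f \<in> borel_measurable circle"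
  unfolding measurable_cong_sets[OF sets_circle refl] by (rule measurable_restrict_space1)

lemma finite_measure_circle: "finite_measure circle"
proof (rule finite_measureI)
  have "emeasure circle (space circle) = ennreal (1 / (2 * pi)) * emeasure lborel {0..<2 * pi}"
    by (simp add: circle_def space_scale_measure emeasure_restrict_space space_restrict_space)
  then show "emeasure circle (space circle) \<noteq> \<infinity>" by (simp add: ennreal_mult_eq_top_iff)
qed

lemma circle_density: "circle = density (restrict_space lborel {0..<2 * pi}) (\<lambda>_. ennreal (1 / (2 * pi)))"
  by (rule measure_eqI) (auto simp: circle_def emeasure_density nn_integral_cmult_indicator)

lemma circle_integral_cis:
  "integrable circle (\<lambda>\<theta>. cis (of_int p * \<theta>))"
  "(LINT \<theta>|circle. cis (of_int p * \<theta>)) = (if p = 0 then 1 else 0)"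
proof -
  let ?f = "\<lambda>\<theta>. cis (of_int p * \<theta>)"
  interpret finite_measure circle by (rule finite_measure_circle)
  have fm: "?f \<in> borel_measurable borel" by (intro borel_measurable_continuous_onI continuous_intros)
  show "integrable circle ?f"
    by (rule integrable_const_bound[of _ 1]) (auto intro: measurable_circle fm)
  have si: "set_integrable lborel {0..2 * pi} ?f"
    by (rule borel_integrable_atLeastAtMost') (intro continuous_intros)
  have "(LINT \<theta>|circle. ?f \<theta>) = (LINT \<theta>|restrict_space lborel {0..<2 * pi}. (1 / (2 * pi)) *\<^sub>R ?f \<theta>)"
    unfolding circle_density
    by (rule integral_density) (auto intro!: measurable_restrict_space1 simp: fm)
  also have "\<dots> = (1 / (2 * pi)) *\<^sub>R (LINT \<theta>:{0..<2 * pi}|lborel. ?f \<theta>)"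
    by (simp add: integral_restrict_space set_lebesgue_integral_def)
  also have "(LINT \<theta>:{0..<2 * pi}|lborel. ?f \<theta>) = integral {0..<2 * pi} ?f"
    by (rule set_borel_integral_eq_integral(2)) (rule set_integrable_subset[OF si], auto)
  also have "\<dots> = integral {0..2 * pi} ?f"
    by (rule integral_subset_negligible) (auto intro: negligible_subset[of "{2 * pi}"])
  also have "\<dots> = (if p = 0 then of_real (2 * pi) else 0)"
  proof (cases "p = 0")
    case False
    have "integral {-pi..pi} ?f = integral {-pi + pi..pi + pi} (\<lambda>\<theta>. ?f (\<theta> - pi))"
      using integral_shift_Icc_real[of "-pi" pi "\<lambda>\<theta>. ?f (\<theta> - pi)" pi] by (simp add: o_def)
    also have "\<dots> = integral {0..2 * pi} (\<lambda>\<theta>. cis (- of_int p * pi) * ?f \<theta>)"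
      by (simp add: cis_mult algebra_simps)
    finally show ?thesis using False integral_cis_of_int[of p] by simp
  qed (simp add: scaleR_conv_of_real)
  finally show "(LINT \<theta>|circle. ?f \<theta>) = (if p = 0 then 1 else 0)"
    by (simp add: scaleR_conv_of_real)
qed

abbreviation nu :: "complex measure" where "nu \<equiv> nu_measure q \<alpha>"

text \<open>In polar coordinates the integrand is a function of the angle times one of the radius.
  The radial weight is carried along for two uses: \<open>w = 1\<close> gives orthonormality of the
  monomials, and a cutoff gives integrals that omit the boundary circle.\<close>

lemma nu_integral:
  fixes w :: "real \<Rightarrow> real"
  assumes [measurable]: "w \<in> borel_measurable borel" and bound: "\<And>r. \<bar>w r\<bar> \<le> 1"
  shows "integrable nu (\<lambda>z. of_real (w (norm z)) * (z ^ m * cnj z ^ n))"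
    and "(LINT z|nu. of_real (w (norm z)) * (z ^ m * cnj z ^ n))
      = (if m = n then of_real (\<Sum>j. mass j * (w (rad j) * rad j ^ (2 * n))) else 0)"
proof -
  interpret C: finite_measure circle by (rule finite_measure_circle)
  interpret R: finite_measure rho by (rule finite_measure_rho)
  interpret P: pair_sigma_finite circle rho by unfold_locales
  let ?F = "\<lambda>z. of_real (w (norm z)) * (z ^ m * cnj z ^ n) :: complex"
  let ?g = "\<lambda>\<theta>. cis (of_int (int m - int n) * \<theta>)"
  \<comment> \<open>The absolute value is there because the polar map is integrated over all real
    \<open>r\<close>; the atoms themselves are positive.\<close>
  let ?h = "\<lambda>r. of_real (w \<bar>r\<bar> * r ^ (m + n)) :: complex"
  have [measurable]: "(\<lambda>\<theta>. cis \<theta>) \<in> borel_measurable borel" by (intro borel_measurable_continuous_onI continuous_intros)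
  have [measurable]: "(\<lambda>\<theta>. \<theta>) \<in> borel_measurable circle" by (intro measurable_circle) simp
  have nu: "nu = distr (circle \<Otimes>\<^sub>M rho) borel (\<lambda>(\<theta>, r). of_real r * cis \<theta>)"
    by (simp add: nu_measure_def circle_def)
  have pm: "(\<lambda>(\<theta>, r). of_real r * cis \<theta>) \<in> borel_measurable (circle \<Otimes>\<^sub>M rho)"
    by measurable
  have Fm: "?F \<in> borel_measurable borel" by measurable
  have polar: "?F (case p of (\<theta>, r) \<Rightarrow> of_real r * cis \<theta>) = (case p of (\<theta>, r) \<Rightarrow> ?g \<theta> * ?h r)" for p
  proof (cases p)
    case (Pair \<theta> r)
    have "?g \<theta> = cis \<theta> ^ m * cnj (cis \<theta>) ^ n"
      by (simp add: Complex.DeMoivre cis_cnj cis_mult algebra_simps)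
    then show ?thesis by (simp add: Pair norm_mult power_mult_distrib power_add mult_ac)
  qed
  have sm: "summable (\<lambda>j. mass j * norm (?h (rad j)))"
  proof (rule summable_comparison_test_ev)
    have "summable mass" using mass_moment[of 0] by (simp add: sums_iff)
    then show "summable (\<lambda>j. mass j * rad 0 ^ (m + n))" by (rule summable_mult2)
    have "norm (mass j * norm (?h (rad j))) \<le> mass j * rad 0 ^ (m + n)" for j
    proof -
      have "norm (?h (rad j)) \<le> 1 * rad 0 ^ (m + n)"
        unfolding of_real_mult norm_mult
        using bound rad_pos[of j] rad_mono[of 0 j] by (intro mult_mono) (auto simp: power_mono norm_power)
      then show ?thesis using mass_pos[of j] by (simp add: abs_mult mult_left_mono)
    qed
    then show "\<forall>\<^sub>F j in sequentially. norm (mass j * norm (?h (rad j))) \<le> mass j * rad 0 ^ (m + n)" by simp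
  qed
  have hm: "?h \<in> borel_measurable borel" by measurable
  have hi: "integrable rho ?h" by (rule rho_integral(1)[OF hm sm])
  note prod = P.integral_product_function[OF circle_integral_cis(1)[of "int m - int n"] hi]
  show "integrable nu ?F"
    unfolding nu integrable_distr_eq[OF pm Fm] polar by (rule prod(1))
  have "(LINT z|nu. ?F z) = (LINT \<theta>|circle. ?g \<theta>) * (LINT r|rho. ?h r)"
    unfolding nu integral_distr[OF pm Fm] polar by (rule prod(2))
  also have "\<dots> = (if m = n then (\<Sum>j. of_real (mass j) * ?h (rad j)) else 0)"
    unfolding circle_integral_cis rho_integral(2)[OF hm sm] by simp
  also have "\<dots> = (if m = n then of_real (\<Sum>j. mass j * (w (rad j) * rad j ^ (2 * n))) else 0)"
  proof (cases "m = n")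
    case True
    have "summable (\<lambda>j. norm (mass j * (w (rad j) * rad j ^ (2 * n))))"
      using sm mass_pos rad_pos True by (simp add: abs_mult norm_mult norm_power abs_of_pos mult_2)
    then have "summable (\<lambda>j. mass j * (w (rad j) * rad j ^ (2 * n)))" by (rule summable_norm_cancel)
    then show ?thesis using True rad_pos by (simp add: suminf_of_real mult_2 abs_of_pos)
  qed simp
  finally show "(LINT z|nu. ?F z) = (if m = n then of_real (\<Sum>j. mass j * (w (rad j) * rad j ^ (2 * n))) else 0)" .
qed

lemma sets_nu [measurable_cong, simp]: "sets nu = sets borel"
  by (simp add: nu_measure_def)

lemma monomial_measurable [measurable]: "monomial n \<in> borel_measurable borel"
  unfolding monomial_def[abs_def] by (intro borel_measurable_continuous_onI continuous_intros) (use xfact_pos[of n] in auto)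

lemma monomial_inner:
  "integrable nu (\<lambda>z. monomial m z * cnj (monomial n z))"
  "(LINT z|nu. monomial m z * cnj (monomial n z)) = (if m = n then 1 else 0)"
proof -
  have eq: "(\<lambda>z. monomial m z * cnj (monomial n z)) =
     (\<lambda>z. (1 / of_real (sqrt (xfact q \<alpha> m) * sqrt (xfact q \<alpha> n))) * (of_real 1 * (z ^ m * cnj z ^ n)))"
    by (simp add: monomial_def)
  note I = nu_integral[of "\<lambda>_. 1" m n]
  show "integrable nu (\<lambda>z. monomial m z * cnj (monomial n z))"
    unfolding eq using I(1) by (intro Bochner_Integration.integrable_mult_right) simp
  have "(\<Sum>j. mass j * (1 * rad j ^ (2 * n))) = xfact q \<alpha> n" using mass_moment[of n] by (simp add: sums_iff)
  then show "(LINT z|nu. monomial m z * cnj (monomial n z)) = (if m = n then 1 else 0)"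
    unfolding eq integral_mult_right_zero using I(2) xfact_pos[of n] by (auto simp flip: of_real_mult)
qed

lemma monomial_L2: "monomial n \<in> L2 nu"
proof -
  have "integrable nu (\<lambda>z. Re (monomial n z * cnj (monomial n z)))" by (rule integrable_Re[OF monomial_inner(1)])
  moreover have "Re (monomial n z * cnj (monomial n z)) = (cmod (monomial n z))\<^sup>2" for z
    by (metis Re_complex_of_real complex_norm_square)
  ultimately show ?thesis by (simp add: L2_def)
qed

lemma orthonormal_monomial: "orthonormal_sequence nu monomial"
proof -
  have int: "integrable nu (\<lambda>z. 1 :: complex)" using nu_integral(1)[of "\<lambda>_. 1" 0 0] by simp
  have "(LINT z|nu. (1 :: complex)) = 1" using monomial_inner(2)[of 0 0] by (simp add: monomial_def xfact_asc_norm asc_norm_def)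
  then have "complex_of_real (measure nu (space nu)) = 1" by (simp add: scaleR_conv_of_real)
  then have total: "measure nu (space nu) = 1" by (simp only: of_real_eq_1_iff)
  have "emeasure nu (space nu) \<noteq> \<infinity>"
    using int by (simp add: integrable_iff_bounded less_top[symmetric])
  then have "finite_measure nu" by (rule finite_measureI)
  then show ?thesis
    by (intro orthonormal_sequence.intro orthonormal_sequence_axioms.intro total monomial_L2)
       (simp_all add: L2_inner_def monomial_inner)
qed

sublocale N: orthonormal_sequence nu monomial
  by (rule orthonormal_monomial)

lemma partial_monomial_span: "F \<in> monomial_span q \<alpha> \<longleftrightarrow> (\<exists>c N. F = N.partial c N)"
  unfolding monomial_span_def N.partial_def[abs_def] monomial_def by blast

text \<open>Membership, defined by approximation from the span, becomes convergence of the own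
  Fourier series. Hence all later arguments concern coefficient sequences only.\<close>

lemma A2_iff: "F \<in> A2 q \<alpha> \<longleftrightarrow> N.expands (N.coeff F) F"
proof
  assume F: "F \<in> A2 q \<alpha>"
  show "N.expands (N.coeff F) F"
  proof (rule N.closure_span_expands)
    show "F \<in> L2 nu" using F by (simp add: A2_def)
    fix \<epsilon> :: real assume "0 < \<epsilon>"
    then have "0 < sqrt \<epsilon>" by simp
    then obtain p where "p \<in> monomial_span q \<alpha>" "L2_norm nu (\<lambda>z. F z - p z) < sqrt \<epsilon>"
      using F unfolding A2_def by blast
    then show "\<exists>c N. sqnorm nu (\<lambda>x. F x - N.partial c N x) < \<epsilon>"
      unfolding partial_monomial_span L2_norm_sqnorm by auto
  qed
next
  assume ex: "N.expands (N.coeff F) F"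
  have "\<exists>p\<in>monomial_span q \<alpha>. L2_norm nu (\<lambda>z. F z - p z) < \<epsilon>" if "0 < \<epsilon>" for \<epsilon>
  proof -
    have "\<forall>\<^sub>F N in sequentially. sqnorm nu (\<lambda>x. F x - N.partial (N.coeff F) N x) < \<epsilon>\<^sup>2"
      using ex that unfolding N.expands_def by (intro order_tendstoD(2)) auto
    then obtain N where "sqnorm nu (\<lambda>x. F x - N.partial (N.coeff F) N x) < \<epsilon>\<^sup>2"
      using eventually_happens'[OF sequentially_bot] by blast
    then have "L2_norm nu (\<lambda>z. F z - N.partial (N.coeff F) N z) < \<epsilon>"
      unfolding L2_norm_sqnorm using that by (intro real_less_lsqrt) auto
    then show ?thesis using partial_monomial_span by blast
  qed
  then show "F \<in> A2 q \<alpha>" using ex by (simp add: A2_def N.expands_def)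
qed

section \<open>Recovering the coefficients from the inner circles\<close>

lemma norm_monomial_bound:
  assumes "norm z \<le> rad 1"
  shows "norm (monomial n z) \<le> rad 1 ^ n / sqrt (xfact q \<alpha> n)"
proof -
  have "norm (monomial n z) = norm z ^ n / sqrt (xfact q \<alpha> n)"
    using xfact_pos[of n] by (simp add: monomial_def norm_divide norm_power)
  also have "\<dots> \<le> rad 1 ^ n / sqrt (xfact q \<alpha> n)"
    using assms xfact_pos[of n] by (intro divide_right_mono power_mono) auto
  finally show ?thesis .
qed

lemma rad_1_Cq: "norm z \<le> rad 1 \<Longrightarrow> z \<in> Cq q"
proof -
  assume "norm z \<le> rad 1"
  then have "(norm z)\<^sup>2 \<le> (rad 1)\<^sup>2" by (intro power_mono) auto
  then have "(1 - q) * (norm z)\<^sup>2 \<le> (1 - q) * (q / (1 - q))"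
    unfolding rad_square using q_less_1 by (intro mult_left_mono) auto
  then show ?thesis using q_less_1 by (simp add: Cq_def)
qed

text \<open>On the circle of radius \<open>rad 1\<close> the normalized monomials decay like
  \<open>q^(n/2)\<close>, because \<open>asc_norm\<close> is bounded below; bounded coefficients
  thus give a uniformly convergent series.\<close>

lemma summable_rad_1: "summable (\<lambda>n. rad 1 ^ n / sqrt (xfact q \<alpha> n))"
proof -
  define c where "c = qpoch_inf \<bar>\<alpha>\<bar> q * qpoch_inf q q"
  have c: "0 < c" unfolding c_def using alpha_gt alpha_less q_less_1 by (intro mult_pos_pos qpoch_inf_real_pos) auto
  have cD: "c \<le> asc_norm n" for n unfolding c_def by (rule asc_norm_lower)
  show ?thesis
  proof (rule summable_comparison_test_ev)
    show "summable (\<lambda>n. sqrt q ^ n * (1 / sqrt c))"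
      using q_pos q_less_1 by (intro summable_mult2 summable_geometric) simp
    have "norm (rad 1 ^ n / sqrt (xfact q \<alpha> n)) \<le> sqrt q ^ n * (1 / sqrt c)" for n
    proof -
      have "rad 1 = sqrt q / sqrt (1 - q)"
        using rad_square[of 1] rad_pos[of 1] by (metis less_imp_le power_one_right real_sqrt_divide real_sqrt_unique)
      then have "rad 1 ^ n / sqrt (xfact q \<alpha> n) = sqrt q ^ n / sqrt (asc_norm n)"
        using q_less_1 by (simp add: xfact_asc_norm real_sqrt_divide real_sqrt_power power_divide)
      also have "\<dots> \<le> sqrt q ^ n / sqrt c"
        using c cD[of n] q_pos by (intro divide_left_mono) (auto intro!: mult_pos_pos less_le_trans[OF c])
      finally show ?thesis using rad_pos[of 1] xfact_pos[of n] by simp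
    qed
    then show "\<forall>\<^sub>F n in sequentially. norm (rad 1 ^ n / sqrt (xfact q \<alpha> n)) \<le> sqrt q ^ n * (1 / sqrt c)" by simp
  qed
qed

text \<open>The outermost circle of \<open>\<nu>\<close> is not in \<open>Cq q\<close>; this shows that an element of \<open>A2\<close> is nevertheless
  determined by its values inside. The power series is tested against \<open>z\<^sup>n\<close> on the smaller
  circles, where it converges uniformly.\<close>

lemma coefficients_unique_inside:
  assumes b: "\<And>n. norm (b n) \<le> B"
    and zero: "AE z in nu. z \<in> Cq q \<longrightarrow> (\<lambda>n. b n * monomial n z) sums 0"
  shows "b n = 0"
proof -
  define w :: "real \<Rightarrow> real" where "w = indicator {..rad 1}"
  have wm [measurable]: "w \<in> borel_measurable borel" unfolding w_def by simp
  have w1: "\<bar>w r\<bar> \<le> 1" for r by (simp add: w_def indicator_def)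
  let ?s = "\<lambda>m. complex_of_real (sqrt (xfact q \<alpha> m))"
  let ?f = "\<lambda>m z. b m * monomial m z * (of_real (w (norm z)) * cnj z ^ n)"
  have feq: "?f m = (\<lambda>z. b m / ?s m * (of_real (w (norm z)) * (z ^ m * cnj z ^ n)))" for m
    by (simp add: monomial_def fun_eq_iff)
  have fi: "integrable nu (?f m)" for m
    unfolding feq by (intro Bochner_Integration.integrable_mult_right nu_integral wm w1)
  have fint: "integral\<^sup>L nu (?f m) = b m / ?s m * (if m = n then of_real (\<Sum>j. mass j * (w (rad j) * rad j ^ (2 * n))) else 0)" for m
    unfolding feq integral_mult_right_zero nu_integral(2)[OF wm w1] ..
  define T where "T m = \<bar>B\<bar> * (rad 1 ^ m / sqrt (xfact q \<alpha> m)) * rad 1 ^ n" for m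
  have sT: "summable T" unfolding T_def by (intro summable_mult summable_mult2 summable_rad_1)
  have fT: "norm (?f m z) \<le> T m" for m z
  proof (cases "norm z \<le> rad 1")
    case True
    have "norm (b m) * norm (monomial m z) * norm (of_real (w (norm z)) * cnj z ^ n) \<le> \<bar>B\<bar> * (rad 1 ^ m / sqrt (xfact q \<alpha> m)) * rad 1 ^ n"
      using b[of m] norm_monomial_bound[OF True, of m] True rad_pos[of 1] xfact_pos[of m]
      by (intro mult_mono) (auto simp: w_def norm_power power_mono)
    then show ?thesis by (simp add: T_def norm_mult)
  next
    case False
    then show ?thesis using rad_pos[of 1] xfact_pos[of m] by (simp add: w_def T_def)
  qed
  have ae: "AE z in nu. summable (\<lambda>m. norm (?f m z))"
    by (intro AE_I2 summable_comparison_test_ev[OF _ sT] always_eventually allI) (simp add: fT)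
  have sn: "summable (\<lambda>m. LINT z|nu. norm (?f m z))"
  proof (rule summable_comparison_test_ev[OF _ sT])
    have "norm (LINT z|nu. norm (?f m z)) \<le> T m" for m
    proof -
      have "(LINT z|nu. norm (?f m z)) \<le> (LINT z|nu. T m)"
        using fi[of m] fT by (intro integral_mono) auto
      then show ?thesis using N.total by simp
    qed
    then show "\<forall>\<^sub>F m in sequentially. norm (LINT z|nu. norm (?f m z)) \<le> T m" by simp
  qed
  have s1: "(\<lambda>m. integral\<^sup>L nu (?f m)) sums (LINT z|nu. (\<Sum>m. ?f m z))"
    by (rule sums_integral[OF fi ae sn])
  have "(LINT z|nu. (\<Sum>m. ?f m z)) = (LINT z|nu. 0)"
  proof (rule integral_cong_AE)
    show "(\<lambda>z. \<Sum>m. ?f m z) \<in> borel_measurable nu"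
      using borel_measurable_integrable[OF fi] by (rule borel_measurable_suminf)
    show "AE z in nu. (\<Sum>m. ?f m z) = 0"
      using zero
    proof eventually_elim
      case (elim z)
      show ?case
      proof (cases "norm z \<le> rad 1")
        case True
        then have "(\<lambda>m. b m * monomial m z) sums 0" using elim rad_1_Cq by blast
        from sums_mult2[OF this, of "of_real (w (norm z)) * cnj z ^ n"] show ?thesis by (simp add: sums_iff)
      qed (simp add: w_def)
    qed
  qed simp
  then have "(\<lambda>m. integral\<^sup>L nu (?f m)) sums 0" using s1 by simp
  moreover have "(\<lambda>m. integral\<^sup>L nu (?f m)) sums (integral\<^sup>L nu (?f n))"
    using sums_single[of n "\<lambda>m. integral\<^sup>L nu (?f n)"] by (rule sums_cong[THEN iffD1, rotated]) (auto simp: fint)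
  ultimately have z: "integral\<^sup>L nu (?f n) = 0" using sums_unique2 by blast
  \<comment> \<open>The cutoff removes the atom 0, but the atom 1 has positive mass and positive
    radius, so the coefficient can be divided out.\<close>
  have "0 < (\<Sum>j. mass j * (w (rad j) * rad j ^ (2 * n)))"
  proof (rule suminf_pos2[where i = 1])
    have "summable (\<lambda>j. mass j * rad j ^ (2 * n))" using mass_moment[of n] by (simp add: sums_iff)
    then show "summable (\<lambda>j. mass j * (w (rad j) * rad j ^ (2 * n)))"
      by (rule summable_comparison_test_ev[rotated])
        (use mass_pos rad_pos in \<open>auto intro!: always_eventually mult_nonneg_nonneg simp: w_def indicator_def abs_mult less_imp_le\<close>)
    show "0 \<le> mass j * (w (rad j) * rad j ^ (2 * n))" for j
      using mass_pos[of j] rad_pos[of j] by (auto simp: w_def indicator_def)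
    show "0 < mass 1 * (w (rad 1) * rad 1 ^ (2 * n))"
      using mass_pos[of 1] rad_pos[of 1] by (simp add: w_def)
  qed
  moreover have "?s n \<noteq> 0" using xfact_pos[of n] by simp
  ultimately show "b n = 0" using z unfolding fint by simp
qed

subsection \<open>The isometry\<close>

lemma partial_bargmann:
  assumes "\<phi> \<in> L2 H" "z \<in> Cq q"
  shows "(\<lambda>M. N.partial (H.coeff \<phi>) M z) \<longlonglongrightarrow> bargmann q \<alpha> \<phi> z"
  using bargmann_sums[OF assms] by (simp add: sums_def N.partial_def)

text \<open>Inside the disc \<open>U \<phi>\<close> is the power series with the coefficients of
  \<open>\<phi>\<close>, and almost everywhere there also the one with its own coefficients. The
  difference of the two has bounded coefficients and is tested on the inner circles.\<close>

lemma realizes_expands: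
  assumes U: "realizes_bargmann q \<alpha> U" and \<phi>: "\<phi> \<in> L2 H"
  shows "N.expands (H.coeff \<phi>) (U \<phi>)"
proof -
  have A2: "U \<phi> \<in> A2 q \<alpha>" and eq: "\<And>z. z \<in> Cq q \<Longrightarrow> U \<phi> z = bargmann q \<alpha> \<phi> z"
    using U \<phi> unfolding realizes_bargmann_def by auto
  define d where "d = N.coeff (U \<phi>)"
  have ex: "N.expands d (U \<phi>)" using A2 unfolding d_def A2_iff .
  define b where "b n = H.coeff \<phi> n - d n" for n
  have "\<exists>B. \<forall>n. norm (c n) \<le> B" if "summable (\<lambda>n. (cmod (c n))\<^sup>2)" for c :: "nat \<Rightarrow> complex"
  proof -
    have "(\<lambda>n. sqrt ((cmod (c n))\<^sup>2)) \<longlonglongrightarrow> sqrt 0" by (intro tendsto_real_sqrt summable_LIMSEQ_zero that)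
    then have "c \<longlonglongrightarrow> 0" by (simp add: tendsto_norm_zero_iff)
    then have "Bseq c" by (rule convergent_imp_Bseq[OF convergentI])
    then show ?thesis by (auto simp: Bseq_def)
  qed
  then obtain B1 B2 where "\<And>n. norm (H.coeff \<phi> n) \<le> B1" "\<And>n. norm (d n) \<le> B2"
    using H.bessel[OF \<phi>] sums_summable[OF N.expands_parseval[OF ex]] by metis
  then have b: "norm (b n) \<le> B1 + B2" for n
    unfolding b_def by (intro order_trans[OF norm_triangle_ineq4] add_mono)
  have dsum: "AE z in nu. z \<in> Cq q \<longrightarrow> (\<lambda>n. d n * monomial n z) sums U \<phi> z"
  proof -
    \<comment> \<open>Convergence is borrowed from the interval side: some \<open>f\<close> has
      \<open>d\<close> as its coefficients, and this series is its transform.\<close>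
    have sm: "summable (\<lambda>n. d n * monomial n z)" if "z \<in> Cq q" for z
    proof -
      obtain f where "H.expands d f" using H.riesz_fischer sums_summable[OF N.expands_parseval[OF ex]] by blast
      then have "f \<in> L2 H" by (simp add: H.expands_def)
      moreover have "H.coeff f = d" by (rule H.expands_coeff) fact
      ultimately show ?thesis using bargmann_sums[OF _ that, of f] by (auto simp: sums_iff)
    qed
    have "AE z in nu. z \<in> Cq q \<longrightarrow> U \<phi> z = (\<Sum>n. d n * monomial n z)"
      using ex by (rule N.expands_pointwise_AE) (use sm in \<open>simp add: N.partial_def summable_LIMSEQ\<close>)
    then show ?thesis by eventually_elim (use sm in \<open>auto simp: sums_iff\<close>)
  qed
  have "AE z in nu. z \<in> Cq q \<longrightarrow> (\<lambda>n. b n * monomial n z) sums 0"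
    using dsum
  proof eventually_elim
    case (elim z)
    show ?case
    proof
      assume z: "z \<in> Cq q"
      from sums_diff[OF bargmann_sums[OF \<phi> z]] elim z eq[OF z]
      show "(\<lambda>n. b n * monomial n z) sums 0" by (fastforce simp: b_def left_diff_distrib)
    qed
  qed
  then have "b n = 0" for n by (rule coefficients_unique_inside[OF b])
  then have "H.coeff \<phi> = d" by (simp add: b_def fun_eq_iff)
  then show ?thesis using ex by simp
qed

text \<open>The transform on the open disc is completed by the values of a mean-square limit
  \<open>G\<close> with the same coefficients; inside the disc both agree almost everywhere.\<close>

lemma realizes_exists: "\<exists>U. realizes_bargmann q \<alpha> U"
proof -
  have "\<exists>F. F \<in> A2 q \<alpha> \<and> (\<forall>z\<in>Cq q. F z = bargmann q \<alpha> \<phi> z)" if \<phi>: "\<phi> \<in> L2 H" for \<phi>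
  proof -
    let ?c = "H.coeff \<phi>"
    obtain G where G: "N.expands ?c G" using N.riesz_fischer[OF H.bessel[OF \<phi>]] by blast
    have [measurable]: "G \<in> borel_measurable borel" using G by (auto simp: N.expands_def dest: L2_measurable)
    define F where "F z = (if z \<in> Cq q then bargmann q \<alpha> \<phi> z else G z)" for z
    have "open (Cq q)"
      unfolding Cq_def by (intro open_Collect_less continuous_intros)
    then have [measurable]: "Cq q \<in> sets borel" by simp
    have [measurable]: "N.partial ?c M \<in> borel_measurable borel" for M
      using L2_measurable[OF N.partial_L2[of ?c M]] by simp
    \<comment> \<open>Measurability of the transform in \<open>z\<close> comes from its being the
      pointwise limit of the partial sums on the disc.\<close>
    have "F \<in> borel_measurable borel"
    proof (rule borel_measurable_LIMSEQ_metric)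
      show "(\<lambda>z. if z \<in> Cq q then N.partial ?c M z else G z) \<in> borel_measurable borel" for M by measurable
      show "(\<lambda>M. if z \<in> Cq q then N.partial ?c M z else G z) \<longlonglongrightarrow> F z" for z
        using partial_bargmann[OF \<phi>] by (simp add: F_def)
    qed
    moreover have "AE z in nu. z \<in> Cq q \<longrightarrow> G z = bargmann q \<alpha> \<phi> z"
      by (rule N.expands_pointwise_AE[OF G partial_bargmann[OF \<phi>]])
    then have "AE z in nu. G z = F z" by eventually_elim (simp add: F_def)
    ultimately have "N.expands ?c F" by (intro N.expands_cong_AE[OF G]) auto
    then have "F \<in> A2 q \<alpha>" unfolding A2_iff by (simp add: N.expands_coeff)
    then show ?thesis by (auto simp: F_def)
  qed
  then obtain U where "\<And>\<phi>. \<phi> \<in> L2 H \<Longrightarrow> U \<phi> \<in> A2 q \<alpha> \<and> (\<forall>z\<in>Cq q. U \<phi> z = bargmann q \<alpha> \<phi> z)"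
    by metis
  then show ?thesis unfolding realizes_bargmann_def by blast
qed

text \<open>\<open>f\<close> and \<open>U f\<close> have expansions with the same coefficients in
  complete orthonormal sequences of the two spaces. Linearity and injectivity are uniqueness of
  coefficients, the isometry is Parseval, and surjectivity is Riesz-Fischer on the interval.\<close>

lemma realizes_isometric:
  assumes U: "realizes_bargmann q \<alpha> U"
  shows "L2_isometric_isomorphism H (L2 H) nu (A2 q \<alpha>) U"
  unfolding L2_isometric_isomorphism_def
proof (intro conjI ballI allI)
  have UE: "N.expands (H.coeff f) (U f)" if "f \<in> L2 H" for f using U that by (rule realizes_expands)
  show "U f \<in> A2 q \<alpha>" if "f \<in> L2 H" for f using U that by (simp add: realizes_bargmann_def)
  show "(AE x in nu. U f x = U g x) \<longleftrightarrow> (AE x in H. f x = g x)" if f: "f \<in> L2 H" and g: "g \<in> L2 H" for f g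
  proof
    assume "AE x in nu. U f x = U g x"
    then have "N.expands (H.coeff f) (U g)"
      using UE[OF f] UE[OF g] by (intro N.expands_cong_AE[OF UE[OF f]]) (auto simp: N.expands_def dest: L2_measurable)
    then have "H.coeff f = H.coeff g" using N.expands_coeff UE[OF g] by metis
    then show "AE x in H. f x = g x" using H_complete[OF f] H_complete[OF g] H.expands_AE_unique by metis
  next
    assume "AE x in H. f x = g x"
    then have "H.expands (H.coeff f) g"
      by (intro H.expands_cong_AE[OF H_complete[OF f]] L2_measurable[OF g])
    then have "H.coeff g = H.coeff f" by (rule H.expands_coeff)
    then show "AE x in nu. U f x = U g x" using UE[OF f] UE[OF g] N.expands_AE_unique by metis
  qed
  show "AE y in nu. U (\<lambda>x. a * f x + b * g x) y = a * U f y + b * U g y" if f: "f \<in> L2 H" and g: "g \<in> L2 H" for f g a b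
  proof -
    have "H.expands (\<lambda>n. a * H.coeff f n + b * H.coeff g n) (\<lambda>x. a * f x + b * g x)"
      by (intro H.expands_linear H_complete f g)
    then have "H.coeff (\<lambda>x. a * f x + b * g x) = (\<lambda>n. a * H.coeff f n + b * H.coeff g n)"
      by (rule H.expands_coeff)
    moreover have "(\<lambda>x. a * f x + b * g x) \<in> L2 H" by (intro L2_add L2_cmult f g)
    ultimately have "N.expands (\<lambda>n. a * H.coeff f n + b * H.coeff g n) (U (\<lambda>x. a * f x + b * g x))"
      using UE by metis
    moreover have "N.expands (\<lambda>n. a * H.coeff f n + b * H.coeff g n) (\<lambda>y. a * U f y + b * U g y)"
      by (intro N.expands_linear UE f g)
    ultimately show ?thesis by (rule N.expands_AE_unique)
  qed
  show "L2_norm nu (U f) = L2_norm H f" if f: "f \<in> L2 H" for f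
    using N.expands_parseval[OF UE[OF f]] H.expands_parseval[OF H_complete[OF f]] sums_unique2
    unfolding L2_norm_sqnorm by metis
  show "\<exists>f\<in>L2 H. AE y in nu. U f y = h y" if h: "h \<in> A2 q \<alpha>" for h
  proof -
    have ex: "N.expands (N.coeff h) h" using h unfolding A2_iff .
    then obtain f where f: "H.expands (N.coeff h) f"
      using H.riesz_fischer sums_summable[OF N.expands_parseval[OF ex]] by blast
    then have fL: "f \<in> L2 H" by (simp add: H.expands_def)
    have "AE y in nu. U f y = h y"
      using UE[OF fL] ex unfolding H.expands_coeff[OF f] by (rule N.expands_AE_unique)
    then show ?thesis using fL by blast
  qed
qed

end

theorem theorem1:
  fixes q \<alpha> :: real
  assumes "0 < q" "q < 1" "- 1 < \<alpha>" "\<alpha> < q"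
  shows "(\<exists>U. realizes_bargmann q \<alpha> U) \<and>
    (\<forall>U. realizes_bargmann q \<alpha> U \<longrightarrow>
       L2_isometric_isomorphism (H_measure q \<alpha>) (L2 (H_measure q \<alpha>)) (nu_measure q \<alpha>) (A2 q \<alpha>) U) \<and>
    (\<forall>\<phi>\<in>L2 (H_measure q \<alpha>). \<forall>z\<in>Cq q.
       set_integrable lborel (Iq q) (\<lambda>\<xi>. kernel_T q \<alpha> z \<xi> * \<phi> \<xi> * of_real (weight q \<alpha> \<xi>)) \<and>
       bargmann q \<alpha> \<phi> z =
         (LINT \<xi>:Iq q|lborel. kernel_T q \<alpha> z \<xi> * \<phi> \<xi> * of_real (weight q \<alpha> \<xi>)))"
proof -
  interpret bargmann_parameters q \<alpha> using assms by unfold_locales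
  show ?thesis using realizes_exists realizes_isometric bargmann_integral by blast
qed

end
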